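(* Let $b:\mathbb{R}^d\times\mathcal{P}(\mathbb{R}^d)\to\mathbb{R}^d$ be a measurable function for which there is a constant $K$ such that $$|b(x,\mu)-b(x',\mu')|\le K\big(|x-x'|+\Pi_{\mathbb{R}^d}(\mu,\mu')\big),\qquad |b(x,\mu)|\le K,$$ for all $x,x'\in\mathbb{R}^d$, $\mu,\mu'\in\mathcal{P}(\mathbb{R}^d)$. Then the function $$\Psi:(\mathcal{P}(\mathbb{R}^d\times D_T),\Pi_{\mathbb{R}^d\times D_T})\to(\mathcal{P}(D_T),\Pi_{D_T}),\qquad \nu\mapsto(S^\nu)_\#\nu,$$ is continuous. Equivalently, $\Psi$ is continuous with respect to the topologies of weak convergence of measures.
   Context: $T>0$ is fixed and $D_T=D([0,T],\mathbb{R}^d)$ is the space of càdlàg functions, endowed with the Skorokhod metric $\sigma(\gamma,\gamma')=\inf_{\lambda\in\Lambda}\{\|\lambda\|+\|\gamma-\gamma'\circ\lambda\|_\infty\}$, where $\Lambda$ is the set of strictly increasing bijections of $[0,T]$ and $\|\lambda\|=\sup_{s\ne t}\big|\log\frac{\lambda_t-\lambda_s}{t-s}\big|$; $(D_T,\sigma)$ is Polish. $\mathcal{P}(E)$ denotes the Borel probability measures on $E$. For each of the Polish spaces $(E,d)$ involved, $\Pi_E$ is a metric on $\mathcal{P}(E)$ that is complete, metrizes weak convergence of measures, and satisfies $\Pi_E(\mathcal{L}(X),\mathcal{L}(X'))\le\mathbb{E}\,d(X,X')$ for any two $E$-valued random variables $X,X'$ on a common probability space. For $\nu\in\mathcal{P}(\mathbb{R}^d\times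 D_T)$, $S^\nu:\mathbb{R}^d\times D_T\to D_T$ is the unique measurable map such that $x=S^\nu(x_0,\gamma)$ solves, for every $(x_0,\gamma)$, $$x_t=x_0+\int_0^t b(x_s,(x_s)_\#\nu)\,ds+\gamma_t,\qquad t\in[0,T],$$ where $(x_s)_\#\nu$ is the push-forward of $\nu$ under $(x_0,\gamma)\mapsto S^\nu(x_0,\gamma)_s$. *)

theory Defs
  imports "HOL-Probability.Probability"
begin

section \<open>Skorokhod space\<close>

text \<open>Paths are extended by \<^const>\<open>undefined\<close> outside the time interval, so that equality of paths is
  equality on the interval.\<close>

definition cadlag :: "real \<Rightarrow> (real \<Rightarrow> 'a::real_normed_vector) set" where
  "cadlag T = {\<gamma> \<in> extensional {0..T}.
     (\<forall>t\<in>{0..<T}. (\<gamma> \<longlongrightarrow> \<gamma> t) (at_right t)) \<and> (\<forall>t\<in>{0<..T}. \<exists>l. (\<gamma> \<longlongrightarrow> l) (at_left t))}"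

definition time_changes :: "real \<Rightarrow> (real \<Rightarrow> real) set" where
  "time_changes T = {\<tau>. strict_mono_on {0..T} \<tau> \<and> bij_betw \<tau> {0..T} {0..T}}"

definition time_change_norm :: "real \<Rightarrow> (real \<Rightarrow> real) \<Rightarrow> ennreal" where
  "time_change_norm T \<tau> =
     (SUP (s, t) \<in> {(s, t). s \<in> {0..T} \<and> t \<in> {0..T} \<and> s \<noteq> t}. ennreal \<bar>ln ((\<tau> t - \<tau> s) / (t - s))\<bar>)"

definition sup_dist :: "real \<Rightarrow> (real \<Rightarrow> 'a::real_normed_vector) \<Rightarrow> (real \<Rightarrow> 'a) \<Rightarrow> ennreal" where
  "sup_dist T f g = (SUP t\<in>{0..T}. ennreal (norm (f t - g t)))"

definition skorokhod_dist :: "real \<Rightarrow> (real \<Rightarrow> 'a::real_normed_vector) \<Rightarrow> (real \<Rightarrow> 'a) \<Rightarrow> real" where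
  "skorokhod_dist T \<gamma> \<gamma>' =
     enn2real (INF \<tau>\<in>time_changes T. time_change_norm T \<tau> + sup_dist T \<gamma> (\<gamma>' \<circ> \<tau>))"

definition skorokhod_metric :: "real \<Rightarrow> (real \<Rightarrow> 'a::real_normed_vector) metric" where
  "skorokhod_metric T = metric (cadlag T, skorokhod_dist T)"

abbreviation skorokhod_topology :: "real \<Rightarrow> (real \<Rightarrow> 'a::real_normed_vector) topology" where
  "skorokhod_topology T \<equiv> mtopology_of (skorokhod_metric T)"

subsection \<open>The Skorokhod distance is a metric\<close>

lemma cadlag_bounded:
  fixes \<gamma> :: "real \<Rightarrow> 'a::real_normed_vector"
  assumes "\<gamma> \<in> cadlag T"
  obtains B where "\<And>t. t \<in> {0..T} \<Longrightarrow> norm (\<gamma> t) \<le> B"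
proof -
  have loc: "\<exists>U. open U \<and> t \<in> U \<and> (\<exists>B. \<forall>u\<in>U \<inter> {0..T}. norm (\<gamma> u) \<le> B)" if t: "t \<in> {0..T}" for t
  proof -
    have "\<exists>e>0. \<exists>B. \<forall>u\<in>{t<..<t+e} \<inter> {0..T}. norm (\<gamma> u) \<le> B"
    proof (cases "t < T")
      case True
      then have "(\<gamma> \<longlongrightarrow> \<gamma> t) (at_right t)" using assms t by (auto simp: cadlag_def)
      then have "eventually (\<lambda>u. dist (\<gamma> u) (\<gamma> t) < 1) (at_right t)"
        by (rule tendstoD) simp
      then obtain c where c: "c > t" "\<And>u. u > t \<Longrightarrow> u < c \<Longrightarrow> dist (\<gamma> u) (\<gamma> t) < 1"
        by (auto simp: eventually_at_right_field)
      have "norm (\<gamma> u) \<le> norm (\<gamma> t) + 1" if "u \<in> {t<..<t+(c-t)}" for u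
        using c(2)[of u] that norm_triangle_sub[of "\<gamma> u" "\<gamma> t"] by (auto simp: dist_norm)
      then show ?thesis using c(1) by (intro exI[of _ "c - t"] conjI exI[of _ "norm (\<gamma> t) + 1"]) auto
    qed (use t in \<open>auto intro!: exI[of _ 1]\<close>)
    then obtain e1 B1 where e1: "e1 > 0" "\<And>u. u\<in>{t<..<t+e1} \<inter> {0..T} \<Longrightarrow> norm (\<gamma> u) \<le> B1" by blast
    have "\<exists>e>0. \<exists>B. \<forall>u\<in>{t-e<..<t} \<inter> {0..T}. norm (\<gamma> u) \<le> B"
    proof (cases "0 < t")
      case True
      then have "t \<in> {0<..T}" using t by auto
      then obtain l where "(\<gamma> \<longlongrightarrow> l) (at_left t)" using assms unfolding cadlag_def by blast
      then have "eventually (\<lambda>u. dist (\<gamma> u) l < 1) (at_left t)"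
        by (rule tendstoD) simp
      then obtain c where c: "c < t" "\<And>u. u > c \<Longrightarrow> u < t \<Longrightarrow> dist (\<gamma> u) l < 1"
        by (auto simp: eventually_at_left_field)
      have "norm (\<gamma> u) \<le> norm l + 1" if "u \<in> {t-(t-c)<..<t}" for u
        using c(2)[of u] that norm_triangle_sub[of "\<gamma> u" l] by (auto simp: dist_norm)
      then show ?thesis using c(1) by (intro exI[of _ "t - c"] conjI exI[of _ "norm l + 1"]) auto
    qed (use t in \<open>auto intro!: exI[of _ 1]\<close>)
    then obtain e2 B2 where e2: "e2 > 0" "\<And>u. u\<in>{t-e2<..<t} \<inter> {0..T} \<Longrightarrow> norm (\<gamma> u) \<le> B2" by blast
    let ?B = "max (norm (\<gamma> t)) (max B1 B2)"
    have "norm (\<gamma> u) \<le> ?B" if "u \<in> {t-e2<..<t+e1} \<inter> {0..T}" for u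
    proof (cases u t rule: linorder_cases)
      case less then have "norm (\<gamma> u) \<le> B2" using that by (intro e2(2)) auto then show ?thesis by simp
    next
      case greater then have "norm (\<gamma> u) \<le> B1" using that by (intro e1(2)) auto then show ?thesis by simp
    qed simp
    then show ?thesis using e1(1) e2(1) by (intro exI[of _ "{t-e2<..<t+e1}"] conjI exI[of _ ?B]) auto
  qed
  then obtain U where U: "\<And>t. t \<in> {0..T} \<Longrightarrow> open (U t) \<and> t \<in> U t \<and> (\<exists>B. \<forall>u\<in>U t \<inter> {0..T}. norm (\<gamma> u) \<le> B)"
    by metis
  then obtain B where B: "\<And>t u. t \<in> {0..T} \<Longrightarrow> u \<in> U t \<inter> {0..T} \<Longrightarrow> norm (\<gamma> u) \<le> B t"
    by metis
  obtain C where C: "C \<subseteq> {0..T}" "finite C" "{0..T} \<subseteq> (\<Union>t\<in>C. U t)"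
    using compactE_image[of "{0..T}" "{0..T}" U] U by (metis UN_I compact_Icc subsetI)
  have "norm (\<gamma> u) \<le> (\<Sum>t\<in>C. \<bar>B t\<bar>)" if u: "u \<in> {0..T}" for u
  proof -
    obtain t where t: "t \<in> C" "u \<in> U t" using subsetD[OF C(3) u] by blast
    have "norm (\<gamma> u) \<le> B t" using B[of t u] t C(1) u by blast
    also have "\<dots> \<le> \<bar>B t\<bar>" by simp
    also have "\<dots> \<le> (\<Sum>t\<in>C. \<bar>B t\<bar>)" using t C by (intro member_le_sum) auto
    finally show ?thesis .
  qed
  then show thesis by (rule that)
qed

lemma id_time_changes: "id \<in> time_changes T"
  by (auto simp: time_changes_def strict_mono_on_def)

lemma time_change_norm_id: "time_change_norm T id = 0"
  by (auto simp: time_change_norm_def SUP_eq_iff bot_ennreal intro!: antisym SUP_least)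

lemma time_changes_in: "\<tau> \<in> time_changes T \<Longrightarrow> t \<in> {0..T} \<Longrightarrow> \<tau> t \<in> {0..T}"
  by (auto simp: time_changes_def dest: bij_betwE)

lemma time_changes_ratio:
  assumes "\<tau> \<in> time_changes T" "s \<in> {0..T}" "t \<in> {0..T}" "s \<noteq> t"
  shows "(\<tau> t - \<tau> s) / (t - s) > 0"
proof -
  have "s < t \<Longrightarrow> \<tau> s < \<tau> t" "t < s \<Longrightarrow> \<tau> t < \<tau> s"
    using assms by (auto simp: time_changes_def strict_mono_on_def)
  then show ?thesis using assms(4) by (cases "s < t") (auto simp: zero_less_divide_iff)
qed

lemma time_changes_neq:
  assumes "\<tau> \<in> time_changes T" "s \<in> {0..T}" "t \<in> {0..T}" "s \<noteq> t"
  shows "\<tau> s \<noteq> \<tau> t"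
  using time_changes_ratio[OF assms] by auto

lemma time_changes_ends:
  assumes "\<tau> \<in> time_changes T" "0 < T"
  shows "\<tau> 0 = 0" "\<tau> T = T"
proof -
  have m: "\<tau> s \<le> \<tau> t" if "s \<in> {0..T}" "t \<in> {0..T}" "s \<le> t" for s t
    using assms that by (cases "s = t") (auto simp: time_changes_def strict_mono_on_def less_imp_le)
  have im: "\<tau> ` {0..T} = {0..T}" using assms by (auto simp: time_changes_def bij_betw_def)
  obtain s where s: "s \<in> {0..T}" "\<tau> s = 0" using im assms(2) by (metis atLeastAtMost_iff imageE less_imp_le order_refl)
  obtain t where t: "t \<in> {0..T}" "\<tau> t = T" using im assms(2) by (metis atLeastAtMost_iff imageE less_imp_le order_refl)
  show "\<tau> 0 = 0" using m[of 0 s] s time_changes_in[OF assms(1), of 0] assms(2) by auto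
  show "\<tau> T = T" using m[of t T] t time_changes_in[OF assms(1), of T] assms(2) by auto
qed

lemma time_changes_comp:
  assumes "\<tau> \<in> time_changes T" "\<tau>' \<in> time_changes T"
  shows "\<tau>' \<circ> \<tau> \<in> time_changes T"
proof -
  have "strict_mono_on {0..T} (\<tau>' \<circ> \<tau>)"
    using assms time_changes_in[OF assms(1)]
    by (auto simp: time_changes_def strict_mono_on_def)
  then show ?thesis using assms by (auto simp: time_changes_def intro: bij_betw_trans)
qed

lemma time_changes_inv:
  assumes "\<tau> \<in> time_changes T"
  shows "inv_into {0..T} \<tau> \<in> time_changes T"
proof -
  have bij: "bij_betw \<tau> {0..T} {0..T}" and sm: "strict_mono_on {0..T} \<tau>"
    using assms by (auto simp: time_changes_def)
  have bi: "bij_betw (inv_into {0..T} \<tau>) {0..T} {0..T}" by (rule bij_betw_inv_into[OF bij])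
  have "strict_mono_on {0..T} (inv_into {0..T} \<tau>)"
  proof (rule strict_mono_onI)
    fix s t assume st: "s \<in> {0..T}" "t \<in> {0..T}" "s < t"
    let ?i = "inv_into {0..T} \<tau>"
    have i: "?i s \<in> {0..T}" "?i t \<in> {0..T}" "\<tau> (?i s) = s" "\<tau> (?i t) = t"
      using st bij bi by (auto simp del: atLeastAtMost_iff dest: bij_betwE intro: bij_betw_inv_into_right)
    show "?i s < ?i t"
    proof (rule ccontr)
      assume "\<not> ?i s < ?i t"
      then have "?i t < ?i s \<or> ?i t = ?i s" by auto
      then show False using strict_mono_onD[OF sm i(2,1)] i(3,4) st(3) by auto
    qed
  qed
  then show ?thesis using bi by (auto simp: time_changes_def)
qed

lemma time_change_norm_inv:
  assumes "\<tau> \<in> time_changes T"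
  shows "time_change_norm T (inv_into {0..T} \<tau>) \<le> time_change_norm T \<tau>"
proof -
  let ?i = "inv_into {0..T} \<tau>"
  have bij: "bij_betw \<tau> {0..T} {0..T}" using assms by (auto simp: time_changes_def)
  have "ennreal \<bar>ln ((?i t - ?i s) / (t - s))\<bar> \<le> time_change_norm T \<tau>"
    if st: "s \<in> {0..T}" "t \<in> {0..T}" "s \<noteq> t" for s t
  proof -
    have i: "?i s \<in> {0..T}" "?i t \<in> {0..T}" "\<tau> (?i s) = s" "\<tau> (?i t) = t"
      using st bij time_changes_in[OF time_changes_inv[OF assms]]
      by (auto simp del: atLeastAtMost_iff intro: bij_betw_inv_into_right)
    then have ne: "?i s \<noteq> ?i t" using st by metis
    have p: "(t - s) / (?i t - ?i s) > 0" using time_changes_ratio[OF assms i(1,2) ne] i by simp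
    have "(?i t - ?i s) / (t - s) = inverse ((t - s) / (?i t - ?i s))" by simp
    then have "ln ((?i t - ?i s) / (t - s)) = - ln ((t - s) / (?i t - ?i s))"
      using p by (metis ln_inverse)
    then have "ennreal \<bar>ln ((?i t - ?i s) / (t - s))\<bar> = ennreal \<bar>ln ((\<tau> (?i t) - \<tau> (?i s)) / (?i t - ?i s))\<bar>"
      using i by simp
    also have "\<dots> \<le> time_change_norm T \<tau>"
      unfolding time_change_norm_def using i ne by (intro SUP_upper2[of "(?i s, ?i t)"]) auto
    finally show ?thesis .
  qed
  then show ?thesis unfolding time_change_norm_def[of T ?i] by (intro SUP_least) auto
qed

lemma time_change_norm_comp:
  assumes "\<tau> \<in> time_changes T" "\<tau>' \<in> time_changes T"
  shows "time_change_norm T (\<tau>' \<circ> \<tau>) \<le> time_change_norm T \<tau> + time_change_norm T \<tau>'"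
proof -
  have "ennreal \<bar>ln (((\<tau>' \<circ> \<tau>) t - (\<tau>' \<circ> \<tau>) s) / (t - s))\<bar> \<le> time_change_norm T \<tau> + time_change_norm T \<tau>'"
    if st: "s \<in> {0..T}" "t \<in> {0..T}" "s \<noteq> t" for s t
  proof -
    note i = time_changes_in[OF assms(1) st(1)] time_changes_in[OF assms(1) st(2)]
    note ne = time_changes_neq[OF assms(1) st]
    let ?a = "(\<tau> t - \<tau> s) / (t - s)" and ?b = "(\<tau>' (\<tau> t) - \<tau>' (\<tau> s)) / (\<tau> t - \<tau> s)"
    have p: "?a > 0" "?b > 0" using time_changes_ratio[OF assms(1) st] time_changes_ratio[OF assms(2) i ne] .
    have "((\<tau>' \<circ> \<tau>) t - (\<tau>' \<circ> \<tau>) s) / (t - s) = ?a * ?b" using ne by simp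
    then have "ln (((\<tau>' \<circ> \<tau>) t - (\<tau>' \<circ> \<tau>) s) / (t - s)) = ln ?a + ln ?b"
      using p by (metis ln_mult_pos)
    then have "ennreal \<bar>ln (((\<tau>' \<circ> \<tau>) t - (\<tau>' \<circ> \<tau>) s) / (t - s))\<bar> \<le> ennreal (\<bar>ln ?a\<bar> + \<bar>ln ?b\<bar>)"
      by (intro ennreal_leI) linarith
    also have "\<dots> = ennreal \<bar>ln ?a\<bar> + ennreal \<bar>ln ?b\<bar>" by simp
    also have "\<dots> \<le> time_change_norm T \<tau> + time_change_norm T \<tau>'"
      unfolding time_change_norm_def using st i ne
      by (intro add_mono SUP_upper2[of "(s, t)"] SUP_upper2[of "(\<tau> s, \<tau> t)"]) auto
    finally show ?thesis .
  qed
  then show ?thesis unfolding time_change_norm_def[of T "\<tau>' \<circ> \<tau>"] by (intro SUP_least) auto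
qed

lemma time_change_norm_displacement:
  assumes "\<tau> \<in> time_changes T" "0 < T" "t \<in> {0..T}" "time_change_norm T \<tau> \<le> ennreal e" "0 \<le> e"
  shows "\<bar>\<tau> t - t\<bar> \<le> T * (exp e - 1)"
proof (cases "t = 0")
  case True
  then show ?thesis using time_changes_ends[OF assms(1,2)] assms by simp
next
  case False
  have t: "0 < t" "t \<le> T" using False assms by auto
  let ?q = "\<tau> t / t"
  have q: "?q > 0" using time_changes_ratio[OF assms(1), of 0 t] time_changes_ends[OF assms(1,2)] assms t by simp
  have "ennreal \<bar>ln ?q\<bar> \<le> time_change_norm T \<tau>"
    unfolding time_change_norm_def using time_changes_ends[OF assms(1,2)] assms t
    by (intro SUP_upper2[of "(0, t)"]) auto
  then have "\<bar>ln ?q\<bar> \<le> e" using assms(4,5) by (metis ennreal_le_iff order_trans)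
  then have "- e \<le> ln ?q" "ln ?q \<le> e" by auto
  then have b: "exp (- e) \<le> ?q" "?q \<le> exp e" using q by (metis exp_le_cancel_iff exp_ln)+
  have "1 - exp (-e) \<le> exp e - 1"
    using exp_ge_add_one_self[of e] exp_ge_add_one_self[of "-e"] by linarith
  then have "\<bar>?q - 1\<bar> \<le> exp e - 1" using b by linarith
  then have "t * \<bar>?q - 1\<bar> \<le> T * (exp e - 1)" using t by (intro mult_mono) auto
  moreover have "\<bar>\<tau> t - t\<bar> = t * \<bar>?q - 1\<bar>" using t by (simp add: field_simps flip: abs_mult_pos)
  ultimately show ?thesis by simp
qed

lemma sup_dist_triangle: "sup_dist T f h \<le> sup_dist T f g + sup_dist T g h"
  unfolding sup_dist_def
proof (rule SUP_least)
  fix t assume t: "t \<in> {0..T}"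
  have "ennreal (norm (f t - h t)) \<le> ennreal (norm (f t - g t) + norm (g t - h t))"
    by (intro ennreal_leI) (metis diff_add_cancel diff_diff_eq2 norm_triangle_ineq add_diff_eq)
  also have "\<dots> = ennreal (norm (f t - g t)) + ennreal (norm (g t - h t))" by simp
  also have "\<dots> \<le> (SUP t\<in>{0..T}. ennreal (norm (f t - g t))) + (SUP t\<in>{0..T}. ennreal (norm (g t - h t)))"
    by (intro add_mono SUP_upper t)
  finally show "ennreal (norm (f t - h t)) \<le> \<dots>" .
qed

lemma sup_dist_time_change:
  assumes "\<tau> \<in> time_changes T"
  shows "sup_dist T (f \<circ> \<tau>) (g \<circ> \<tau>) = sup_dist T f g"
proof -
  have "{0..T} = \<tau> ` {0..T}" using assms by (auto simp: time_changes_def bij_betw_def)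
  then show ?thesis unfolding sup_dist_def by (metis (mono_tags, lifting) SUP_cong comp_apply image_image)
qed

abbreviation skorokhod_edist :: "real \<Rightarrow> (real \<Rightarrow> 'a::real_normed_vector) \<Rightarrow> (real \<Rightarrow> 'a) \<Rightarrow> ennreal" where
  "skorokhod_edist T \<gamma> \<gamma>' \<equiv> (INF \<tau>\<in>time_changes T. time_change_norm T \<tau> + sup_dist T \<gamma> (\<gamma>' \<circ> \<tau>))"

lemma skorokhod_edist_commute_le:
  fixes f g :: "real \<Rightarrow> 'a::real_normed_vector"
  shows "skorokhod_edist T f g \<le> skorokhod_edist T g f"
proof (rule INF_greatest)
  fix \<tau> assume \<tau>: "\<tau> \<in> time_changes T"
  let ?i = "inv_into {0..T} \<tau>"
  have "\<tau> ` {0..T} = {0..T}" using \<tau> by (auto simp: time_changes_def bij_betw_def)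
  then have "sup_dist T (f \<circ> \<tau> \<circ> ?i) (g \<circ> ?i) = sup_dist T f (g \<circ> ?i)"
    unfolding sup_dist_def by (intro SUP_cong) (auto simp: f_inv_into_f)
  then have "sup_dist T f (g \<circ> ?i) = sup_dist T (f \<circ> \<tau>) g"
    using sup_dist_time_change[OF time_changes_inv[OF \<tau>], of "f \<circ> \<tau>" g] by simp
  also have "\<dots> = sup_dist T g (f \<circ> \<tau>)" by (simp add: sup_dist_def norm_minus_commute)
  finally show "skorokhod_edist T f g \<le> time_change_norm T \<tau> + sup_dist T g (f \<circ> \<tau>)"
    using time_change_norm_inv[OF \<tau>] time_changes_inv[OF \<tau>]
    by (intro INF_lower2[of ?i] add_mono) auto
qed

lemma INF_add_const_ennreal:
  fixes f :: "'i \<Rightarrow> ennreal"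
  assumes "A \<noteq> {}"
  shows "(INF i\<in>A. f i + c) = (INF i\<in>A. f i) + c"
  using continuous_at_Inf_mono[of "\<lambda>x. x + c" "f ` A"] assms
  using continuous_add[of "at_right (INF i\<in>A. f i)", of "\<lambda>x. x" "\<lambda>x. c"]
  by (auto simp: mono_def image_comp o_def)

lemma INF_const_add_ennreal:
  fixes f :: "'i \<Rightarrow> ennreal"
  assumes "A \<noteq> {}"
  shows "(INF i\<in>A. c + f i) = c + (INF i\<in>A. f i)"
  using INF_add_const_ennreal[OF assms, of f c] by (simp add: ac_simps)

lemma skorokhod_edist_triangle:
  fixes f g h :: "real \<Rightarrow> 'a::real_normed_vector"
  shows "skorokhod_edist T f h \<le> skorokhod_edist T f g + skorokhod_edist T g h"
proof -
  have *: "skorokhod_edist T f h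
      \<le> (time_change_norm T \<tau> + sup_dist T f (g \<circ> \<tau>)) + (time_change_norm T \<tau>' + sup_dist T g (h \<circ> \<tau>'))"
    if \<tau>: "\<tau> \<in> time_changes T" "\<tau>' \<in> time_changes T" for \<tau> \<tau>'
  proof -
    have "skorokhod_edist T f h \<le> time_change_norm T (\<tau>' \<circ> \<tau>) + sup_dist T f (h \<circ> (\<tau>' \<circ> \<tau>))"
      by (intro INF_lower time_changes_comp \<tau>)
    also have "\<dots> \<le> (time_change_norm T \<tau> + time_change_norm T \<tau>')
        + (sup_dist T f (g \<circ> \<tau>) + sup_dist T (g \<circ> \<tau>) (h \<circ> \<tau>' \<circ> \<tau>))"
      unfolding comp_assoc by (intro add_mono time_change_norm_comp \<tau> sup_dist_triangle)
    also have "sup_dist T (g \<circ> \<tau>) (h \<circ> \<tau>' \<circ> \<tau>) = sup_dist T g (h \<circ> \<tau>')"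
      by (rule sup_dist_time_change[OF \<tau>(1)])
    finally show ?thesis by (simp only: ac_simps)
  qed
  have ne: "time_changes T \<noteq> {}" using id_time_changes by auto
  have 2: "skorokhod_edist T f h \<le> (time_change_norm T \<tau> + sup_dist T f (g \<circ> \<tau>)) + skorokhod_edist T g h"
    if "\<tau> \<in> time_changes T" for \<tau>
    unfolding INF_const_add_ennreal[symmetric, OF ne] by (intro INF_greatest * that)
  show ?thesis
    unfolding INF_add_const_ennreal[symmetric, OF ne] by (intro INF_greatest 2)
qed

lemma skorokhod_edist_finite:
  fixes f g :: "real \<Rightarrow> 'a::real_normed_vector"
  assumes "f \<in> cadlag T" "g \<in> cadlag T"
  shows "skorokhod_edist T f g < top"
proof -
  obtain B B' where B: "\<And>t. t \<in> {0..T} \<Longrightarrow> norm (f t) \<le> B" "\<And>t. t \<in> {0..T} \<Longrightarrow> norm (g t) \<le> B'"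
    using cadlag_bounded[OF assms(1)] cadlag_bounded[OF assms(2)] by metis
  have "sup_dist T f g \<le> ennreal (B + B')"
    unfolding sup_dist_def
  proof (intro SUP_least ennreal_leI)
    fix t assume "t \<in> {0..T}"
    then show "norm (f t - g t) \<le> B + B'"
      using B[of t] norm_triangle_ineq4[of "f t" "g t"] by linarith
  qed
  then have "skorokhod_edist T f g \<le> ennreal (B + B')"
    by (intro INF_lower2[OF id_time_changes]) (simp add: time_change_norm_id)
  then show ?thesis using ennreal_less_top le_less_trans by blast
qed

lemma skorokhod_edist_zero:
  fixes f g :: "real \<Rightarrow> 'a::real_normed_vector"
  assumes "0 < T" "f \<in> cadlag T" "g \<in> cadlag T" "skorokhod_edist T f g = 0"
  shows "f = g"
proof -
  have ex: "\<exists>\<tau>\<in>time_changes T. (\<forall>t\<in>{0..T}. \<bar>\<tau> t - t\<bar> \<le> T * (exp e - 1) \<and> norm (f t - g (\<tau> t)) \<le> e)"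
    if e: "e > 0" for e :: real
  proof -
    have "skorokhod_edist T f g < ennreal e" using assms e by simp
    then obtain \<tau> where \<tau>: "\<tau> \<in> time_changes T" "time_change_norm T \<tau> + sup_dist T f (g \<circ> \<tau>) < ennreal e"
      by (auto simp: INF_less_iff)
    have "time_change_norm T \<tau> \<le> time_change_norm T \<tau> + sup_dist T f (g \<circ> \<tau>)"
      "sup_dist T f (g \<circ> \<tau>) \<le> time_change_norm T \<tau> + sup_dist T f (g \<circ> \<tau>)"
      by (simp_all add: add_increasing add_increasing2)
    then have n: "time_change_norm T \<tau> \<le> ennreal e" "sup_dist T f (g \<circ> \<tau>) \<le> ennreal e"
      using \<tau>(2) by (meson less_imp_le order_trans)+
    have "norm (f t - g (\<tau> t)) \<le> e" if "t \<in> {0..T}" for t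
    proof -
      have "ennreal (norm (f t - g (\<tau> t))) \<le> sup_dist T f (g \<circ> \<tau>)"
        unfolding sup_dist_def using that by (intro SUP_upper2[of t]) auto
      then show ?thesis using n(2) e by (metis ennreal_le_iff less_imp_le order_trans)
    qed
    moreover have "\<bar>\<tau> t - t\<bar> \<le> T * (exp e - 1)" if "t \<in> {0..T}" for t
      using time_change_norm_displacement[OF \<tau>(1) assms(1) that n(1)] e by simp
    ultimately show ?thesis using \<tau>(1) by blast
  qed
  have "norm (f t - g t) \<le> 3 * e" if t: "t \<in> {0..T}" and e: "e > 0" for t and e :: real
  proof (cases "t = T")
    case True
    obtain \<tau> where "\<tau> \<in> time_changes T" "norm (f t - g (\<tau> t)) \<le> e" using ex[OF e] t by blast
    then show ?thesis using time_changes_ends[of \<tau> T] assms(1) True e by simp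
  next
    case False
    then have tT: "t < T" "t \<in> {0..<T}" using t by auto
    have "(f \<longlongrightarrow> f t) (at_right t)" "(g \<longlongrightarrow> g t) (at_right t)"
      using assms(2,3) tT(2) by (auto simp: cadlag_def)
    then have "eventually (\<lambda>u. dist (f u) (f t) < e \<and> dist (g u) (g t) < e) (at_right t)"
      using e by (intro eventually_conj) (auto dest: tendstoD)
    then obtain c where c: "c > t" "\<And>u. u > t \<Longrightarrow> u < c \<Longrightarrow> dist (f u) (f t) < e \<and> dist (g u) (g t) < e"
      by (auto simp: eventually_at_right_field)
    define m where "m = min c T"
    have m: "t < m" "m \<le> c" "m \<le> T" using c(1) tT(1) by (simp_all add: m_def)
    define d where "d = (m - t) / 2"
    have "2 * d = m - t" by (simp add: d_def)
    then have d: "d > 0" "t + 2 * d \<le> c" "t + 2 * d \<le> T" using m by linarith+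
    have "((\<lambda>e. T * (exp e - 1)) \<longlongrightarrow> T * (exp 0 - 1)) (at_right 0)"
      by (intro tendsto_intros)
    then have "eventually (\<lambda>e. T * (exp e - 1) < d) (at_right 0)"
      using d(1) by (auto dest: order_tendstoD(2))
    then obtain r where r: "r > 0" "\<And>u. u > 0 \<Longrightarrow> u < r \<Longrightarrow> T * (exp u - 1) < d"
      by (auto simp: eventually_at_right_field)
    define e' where "e' = min e (r / 2)"
    have e': "e' > 0" "e' \<le> e" using e r(1) by (simp_all add: e'_def)
    have "e' < r" using r(1) by (simp add: e'_def min_less_iff_disj)
    then have e'3: "T * (exp e' - 1) < d" using r(2) e'(1) by blast
    have u: "t + d \<in> {0..T}" using t d by auto
    obtain \<tau> where \<tau>: "\<bar>\<tau> (t + d) - (t + d)\<bar> \<le> T * (exp e' - 1)" "norm (f (t + d) - g (\<tau> (t + d))) \<le> e'"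
      using ex[OF e'(1)] u by blast
    have "\<tau> (t + d) > t" "\<tau> (t + d) < c" using \<tau>(1) e'3 d by linarith+
    then have "dist (g (\<tau> (t + d))) (g t) < e" using c(2) by blast
    moreover have "dist (f (t + d)) (f t) < e" using c(2)[of "t + d"] d by auto
    moreover have "dist (f (t + d)) (g (\<tau> (t + d))) \<le> e" using \<tau>(2) e' by (simp add: dist_norm)
    ultimately have "dist (f t) (g t) \<le> 3 * e"
      using dist_triangle[of "f t" "g t" "f (t + d)"] dist_triangle[of "f (t + d)" "g t" "g (\<tau> (t + d))"]
      by (simp add: dist_commute)
    then show ?thesis by (simp add: dist_norm)
  qed
  note bound = this
  have "norm (f t - g t) \<le> 0" if "t \<in> {0..T}" for t
  proof (rule field_le_epsilon)
    fix e :: real assume "0 < e"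
    then show "norm (f t - g t) \<le> 0 + e" using bound[OF that, of "e / 3"] by simp
  qed
  then show "f = g" using assms(2,3) by (intro extensionalityI[of f "{0..T}" g]) (auto simp: cadlag_def)
qed

lemma Metric_space_skorokhod:
  assumes "0 < T"
  shows "Metric_space (cadlag T :: (real \<Rightarrow> 'a::real_normed_vector) set) (skorokhod_dist T)"
proof
  fix f g h :: "real \<Rightarrow> 'a"
  show "0 \<le> skorokhod_dist T f g" by (simp add: skorokhod_dist_def)
  show "skorokhod_dist T f g = skorokhod_dist T g f"
    unfolding skorokhod_dist_def
    by (rule arg_cong[where f = enn2real], intro antisym skorokhod_edist_commute_le)
  assume f: "f \<in> cadlag T" and g: "g \<in> cadlag T"
  show "skorokhod_dist T f g = 0 \<longleftrightarrow> f = g"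
  proof
    assume "skorokhod_dist T f g = 0"
    then have "skorokhod_edist T f g = 0"
      using skorokhod_edist_finite[OF f g] by (metis enn2real_eq_0_iff less_irrefl skorokhod_dist_def)
    then show "f = g" by (rule skorokhod_edist_zero[OF assms f g])
  next
    assume "f = g"
    have "sup_dist T g g \<le> 0" unfolding sup_dist_def by (rule SUP_least) simp
    then have "skorokhod_edist T g g \<le> 0"
      by (intro INF_lower2[OF id_time_changes]) (simp add: time_change_norm_id)
    then show "skorokhod_dist T f g = 0" using \<open>f = g\<close> by (simp add: skorokhod_dist_def)
  qed
  assume h: "h \<in> cadlag T"
  have "skorokhod_dist T f h \<le> enn2real (skorokhod_edist T f g + skorokhod_edist T g h)"
    unfolding skorokhod_dist_def
    using skorokhod_edist_finite[OF f g] skorokhod_edist_finite[OF g h]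
    by (intro enn2real_mono skorokhod_edist_triangle) auto
  also have "\<dots> = skorokhod_dist T f g + skorokhod_dist T g h"
    unfolding skorokhod_dist_def
    by (intro enn2real_plus skorokhod_edist_finite f g h)
  finally show "skorokhod_dist T f h \<le> skorokhod_dist T f g + skorokhod_dist T g h" .
qed

lemma
  assumes "0 < T"
  shows mspace_skorokhod_metric [simp]:
      "mspace (skorokhod_metric T) = (cadlag T :: (real \<Rightarrow> 'a::real_normed_vector) set)"
    and mdist_skorokhod_metric [simp]:
      "mdist (skorokhod_metric T) = (skorokhod_dist T :: (real \<Rightarrow> 'a) \<Rightarrow> _)"
  using Metric_space_skorokhod[OF assms, where 'a='a]
  by (simp_all add: skorokhod_metric_def Metric_space.mspace_metric Metric_space.mdist_metric)

section \<open>Spaces of Borel probability measures\<close>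

definition borel_of :: "'e topology \<Rightarrow> 'e measure" where
  "borel_of X = sigma (topspace X) {U. openin X U}"

definition prob_measures :: "'e topology \<Rightarrow> 'e measure set" where
  "prob_measures X = space (prob_algebra (borel_of X))"

lemma borel_of_euclidean [simp]: "borel_of euclidean = borel"
  by (simp add: borel_of_def borel_def)

lemma prob_measures_iff: "\<mu> \<in> prob_measures X \<longleftrightarrow> prob_space \<mu> \<and> sets \<mu> = sets (borel_of X)"
  by (auto simp: prob_measures_def space_prob_algebra)

definition weak_topology :: "'e topology \<Rightarrow> 'e measure topology" where
  "weak_topology X = topology_generated_by
     {{\<mu> \<in> prob_measures X. (\<integral>x. f x \<partial>\<mu>) \<in> U} | f (U :: real set).
        continuous_map X euclideanreal f \<and> bounded (f ` topspace X) \<and> open U}"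

lemma topspace_weak_topology [simp]: "topspace (weak_topology X) = prob_measures X"
proof -
  have "prob_measures X = {\<mu> \<in> prob_measures X. (\<integral>x. (\<lambda>_. 0) x \<partial>\<mu>) \<in> (UNIV :: real set)}" by simp
  moreover have "continuous_map X euclideanreal (\<lambda>_. 0)" "bounded ((\<lambda>_. 0 :: real) ` topspace X)"
    by (auto simp: bounded_iff)
  ultimately have "prob_measures X \<in> {{\<mu> \<in> prob_measures X. (\<integral>x. f x \<partial>\<mu>) \<in> U} | f (U :: real set).
        continuous_map X euclideanreal f \<and> bounded (f ` topspace X) \<and> open U}"
    by blast
  then show ?thesis
    unfolding weak_topology_def topology_generated_by_topspace by blast
qed

text \<open>A bound for random variables on arbitrary probability spaces is equivalent to one on
  probability spaces with sample points in \<open>'e \<times> 'e\<close>, since \<open>(X, X')\<close> can be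
  replaced by the coordinate maps under its joint law.  The expectation may be infinite.\<close>

definition admissible_metric :: "'e metric \<Rightarrow> 'e measure metric \<Rightarrow> bool" where
  "admissible_metric E \<rho> \<longleftrightarrow>
     mspace \<rho> = prob_measures (mtopology_of E) \<and>
     mcomplete_of \<rho> \<and>
     mtopology_of \<rho> = weak_topology (mtopology_of E) \<and>
     (\<forall>(M :: ('e \<times> 'e) measure) X X'.
        prob_space M \<longrightarrow>
        X \<in> M \<rightarrow>\<^sub>M borel_of (mtopology_of E) \<longrightarrow> X' \<in> M \<rightarrow>\<^sub>M borel_of (mtopology_of E) \<longrightarrow>
        ennreal (mdist \<rho> (distr M (borel_of (mtopology_of E)) X) (distr M (borel_of (mtopology_of E)) X'))
          \<le> (\<integral>\<^sup>+ \<omega>. ennreal (mdist E (X \<omega>) (X' \<omega>)) \<partial>M))"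

section \<open>Solution maps of the McKean--Vlasov equation\<close>

definition input_topology :: "real \<Rightarrow> ('a::real_normed_vector \<times> (real \<Rightarrow> 'a)) topology" where
  "input_topology T = prod_topology euclidean (skorokhod_topology T)"

definition is_solution_map ::
  "('a::euclidean_space \<times> 'a measure \<Rightarrow> 'a) \<Rightarrow> real \<Rightarrow> ('a \<times> (real \<Rightarrow> 'a)) measure
     \<Rightarrow> ('a \<times> (real \<Rightarrow> 'a) \<Rightarrow> (real \<Rightarrow> 'a)) \<Rightarrow> bool" where
  "is_solution_map b T \<nu> S \<longleftrightarrow>
     S \<in> borel_of (input_topology T) \<rightarrow>\<^sub>M borel_of (skorokhod_topology T) \<and>
     (\<forall>x\<^sub>0. \<forall>\<gamma>\<in>cadlag T.
        let x = S (x\<^sub>0, \<gamma>); drift = (\<lambda>s. b (x s, distr \<nu> borel (\<lambda>\<omega>. S \<omega> s))) in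
        set_integrable lborel {0..T} drift \<and>
        (\<forall>t\<in>{0..T}. x t = x\<^sub>0 + (LINT s:{0..t}|lborel. drift s) + \<gamma> t))"

end

theory Submission
  imports Defs
begin

text \<open>Since all spaces of measures are metrizable, it suffices to follow a weakly convergent sequence
  \<open>\<nu>\<^sub>n \<rightarrow> \<nu>\<close>. For a fixed input law the difference \<open>x - \<gamma>\<close> of solution and input is \<open>K\<close>-Lipschitz in
  time and, by Gronwall's inequality, depends uniformly on \<open>x\<^sub>0\<close> and on \<open>\<gamma>\<close> in \<open>L\<^sup>1\<close>. As Skorokhod
  convergence implies \<open>L\<^sup>1\<close> convergence, \<open>S\<^sup>\<nu>\<close> is Skorokhod continuous, and evaluation of the solution at
  time \<open>s\<close> is continuous at every input whose path is continuous at \<open>s\<close>.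

  Let \<open>a\<^sub>n(s)\<close> be the distance of the laws of \<open>S\<^sup>\<nu>\<^sub>s\<close> under \<open>\<nu>\<^sub>n\<close> and under \<open>\<nu>\<close>. A second use of Gronwall's
  inequality bounds the distance of \<open>S\<close> for \<open>\<nu>\<^sub>n\<close> from \<open>S\<close> for \<open>\<nu>\<close>, uniformly in the input, by a constant
  times the integral of \<open>min (2 K) (K a\<^sub>n(s))\<close>. This tends to \<open>0\<close> by dominated convergence: for almost
  every \<open>s\<close> the input path is \<open>\<nu>\<close>-almost surely continuous at \<open>s\<close>, so that \<open>a\<^sub>n(s) \<rightarrow> 0\<close> by the mapping
  theorem.\<close>

section \<open>Right-continuous functions and cadlag paths\<close>

text \<open>Evaluation at a fixed time is not continuous on Skorokhod space, so weak convergence of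
  the inputs yields convergence of the marginal laws at almost every time, without uniformity. Hence
  only time integrals of their distances are estimated. The cap \<open>2 K\<close> comes from the
  bound on \<open>b\<close>: it supplies the integrable majorant for \<open>a\<^sub>n\<close> and
  the finiteness that Gronwall's inequality needs.

  The input law enters twice, as the integrating measure and through the solution map. Both for
  marginals and for path laws the triangle inequality passes through the law of
  \<open>S\<^sup>\<nu>\<close> under \<open>\<nu>\<^sub>n\<close>. On one side two maps share the
  measure \<open>\<nu>\<^sub>n\<close>, and the coupling bound turns pathwise estimates into
  estimates of laws; on the other side the map is fixed and only the measure moves.

  Solution minus input is the right quantity because all jumps sit in the input: the remainder
  hardly feels a time change, so a time change that aligns two inputs also aligns their solutions.

  Measurability in time always comes from right continuity.\<close>

lemma cadlag_right: "\<gamma> \<in> cadlag T \<Longrightarrow> t \<in> {0..<T} \<Longrightarrow> (\<gamma> \<longlongrightarrow> \<gamma> t) (at_right t)"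
  by (simp add: cadlag_def)

lemma cadlag_left: "\<gamma> \<in> cadlag T \<Longrightarrow> t \<in> {0<..T} \<Longrightarrow> \<exists>l. (\<gamma> \<longlongrightarrow> l) (at_left t)"
  by (simp add: cadlag_def)

text \<open>For each \<open>e\<close> the points of oscillation at least \<open>e\<close> do not
  accumulate inside the interval: near any \<open>y\<close> the one-sided limits make the path
  nearly constant on either side. Such a set is countable, and the discontinuities lie in the union
  over \<open>e = 1 / Suc n\<close>.\<close>

lemma countable_cadlag_discontinuities:
  fixes \<gamma> :: "real \<Rightarrow> 'a::real_normed_vector"
  assumes "\<gamma> \<in> cadlag T"
  shows "countable {t \<in> {0<..<T}. \<not> isCont \<gamma> t}"
proof -
  define small where "small e t \<longleftrightarrow> (\<exists>d>0. \<forall>u v. \<bar>u - t\<bar> < d \<longrightarrow> \<bar>v - t\<bar> < d \<longrightarrow> dist (\<gamma> u) (\<gamma> v) < e)" for e t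
  have smallI: "small e t" if "t \<in> {p<..<q}" "\<And>u. u \<in> {p<..<q} \<Longrightarrow> dist (\<gamma> u) l < e / 2" for e t p q l
    unfolding small_def
  proof (intro exI conjI allI impI)
    show "0 < min (t - p) (q - t)" using that(1) by auto
    fix u v assume "\<bar>u - t\<bar> < min (t - p) (q - t)" "\<bar>v - t\<bar> < min (t - p) (q - t)"
    then have "u \<in> {p<..<q}" "v \<in> {p<..<q}" by auto
    then show "dist (\<gamma> u) (\<gamma> v) < e" using that(2)[of u] that(2)[of v] dist_triangle_half_l[of "\<gamma> u" l e "\<gamma> v"] by blast
  qed
  have sparse: "{t. \<not> small e t} sparse_in {0<..<T}" if e: "e > 0" for e
    unfolding sparse_in_eventually_iff[OF open_greaterThanLessThan]
  proof
    fix y :: real assume y: "y \<in> {0<..<T}"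
    obtain l where l: "(\<gamma> \<longlongrightarrow> l) (at_left y)" using cadlag_left[OF assms, of y] y by auto
    have "(\<gamma> \<longlongrightarrow> \<gamma> y) (at_right y)" using cadlag_right[OF assms, of y] y by auto
    then have "eventually (\<lambda>u. dist (\<gamma> u) (\<gamma> y) < e / 2) (at_right y)" using e by (intro tendstoD) auto
    then obtain q where q: "q > y" "\<And>u. u > y \<Longrightarrow> u < q \<Longrightarrow> dist (\<gamma> u) (\<gamma> y) < e / 2"
      by (auto simp: eventually_at_right_field)
    have "eventually (\<lambda>u. dist (\<gamma> u) l < e / 2) (at_left y)" using e l by (intro tendstoD) auto
    then obtain p where p: "p < y" "\<And>u. u > p \<Longrightarrow> u < y \<Longrightarrow> dist (\<gamma> u) l < e / 2"
      by (auto simp: eventually_at_left_field)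
    have "eventually (\<lambda>t. small e t) (at_right y)"
      unfolding eventually_at_right_field using q(1)
      by (intro exI[of _ q] conjI allI impI smallI[of _ y q "\<gamma> y"] q(2)) auto
    moreover have "eventually (\<lambda>t. small e t) (at_left y)"
      unfolding eventually_at_left_field using p(1)
      by (intro exI[of _ p] conjI allI impI smallI[of _ p y l] p(2)) auto
    ultimately show "\<forall>\<^sub>F t in at y. t \<notin> {t. \<not> small e t}"
      by (simp add: eventually_at_split)
  qed
  have "countable (\<Union>n. {0<..<T} \<inter> {t. \<not> small (1 / real (Suc n)) t})"
    by (intro countable_UN countableI_type sparse_imp_countable sparse) auto
  moreover have "{t \<in> {0<..<T}. \<not> isCont \<gamma> t} \<subseteq> (\<Union>n. {0<..<T} \<inter> {t. \<not> small (1 / real (Suc n)) t})"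
  proof (rule ccontr)
    assume "\<not> ?thesis"
    then obtain t where t: "\<not> isCont \<gamma> t" "\<And>n. small (1 / real (Suc n)) t" by blast
    have "isCont \<gamma> t" unfolding continuous_at_eps_delta
    proof (intro allI impI)
      fix e :: real assume "e > 0"
      then obtain n where n: "1 / real (Suc n) < e" using nat_approx_posE by blast
      obtain d where "d > 0" "\<And>u v. \<bar>u - t\<bar> < d \<Longrightarrow> \<bar>v - t\<bar> < d \<Longrightarrow> dist (\<gamma> u) (\<gamma> v) < 1 / real (Suc n)"
        using t(2)[of n] unfolding small_def by blast
      then have "0 < d \<and> (\<forall>x'. dist x' t < d \<longrightarrow> dist (\<gamma> x') (\<gamma> t) < e)"
        using n by (metis abs_zero diff_self dist_real_def less_trans)
      then show "\<exists>d>0. \<forall>x'. dist x' t < d \<longrightarrow> dist (\<gamma> x') (\<gamma> t) < e" by blast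
    qed
    with t show False by simp
  qed
  ultimately show ?thesis by (rule countable_subset[rotated])
qed

lemma AE_isCont_cadlag:
  assumes "\<gamma> \<in> cadlag T"
  shows "AE t in lborel. t \<in> {0..T} \<longrightarrow> t \<in> {0<..<T} \<and> isCont \<gamma> t"
proof (rule AE_I')
  show "{0, T} \<union> {t \<in> {0<..<T}. \<not> isCont \<gamma> t} \<in> null_sets lborel"
    using countable_cadlag_discontinuities[OF assms]
    by (intro countable_imp_null_set_lborel) auto
qed auto

text \<open>Replacing \<open>s\<close> by the first grid point strictly to its right leaves only
  countably many time indices, hence a jointly measurable function; right continuity lets the mesh
  tend to 0.\<close>

lemma right_continuous_measurable_pair:
  fixes F :: "real \<Rightarrow> 'b \<Rightarrow> 'a::metric_space"
  assumes T: "0 \<le> T"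
    and meas: "\<And>s. s \<in> {0..T} \<Longrightarrow> F s \<in> borel_measurable M"
    and rc: "\<And>s x. s \<in> {0..<T} \<Longrightarrow> x \<in> space M \<Longrightarrow> ((\<lambda>u. F u x) \<longlongrightarrow> F s x) (at_right s)"
  shows "(\<lambda>(s, x). F (max 0 (min T s)) x) \<in> borel_measurable (borel \<Otimes>\<^sub>M M)"
proof -
  \<comment> \<open>The \<open>+ 1\<close> puts the grid point strictly to the right of
    \<open>s\<close>, as \<open>at_right\<close> demands; the clamp makes it \<open>T\<close> for
    all \<open>s\<close> at or beyond \<open>T\<close>.\<close>
  define q where "q n i = max 0 (min T ((real_of_int i + 1) / real (Suc n)))" for n i
  define k where "k n s = \<lfloor>real (Suc n) * s\<rfloor>" for n s
  have kq: "s < (real_of_int (k n s) + 1) / real (Suc n)" "(real_of_int (k n s) + 1) / real (Suc n) \<le> s + 1 / real (Suc n)" for n s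
  proof -
    have "real (Suc n) * s < real_of_int (k n s) + 1" "real_of_int (k n s) \<le> real (Suc n) * s"
      unfolding k_def by linarith+
    then show "s < (real_of_int (k n s) + 1) / real (Suc n)" "(real_of_int (k n s) + 1) / real (Suc n) \<le> s + 1 / real (Suc n)"
      by (simp_all add: field_simps del: of_nat_Suc)
  qed
  have inv: "(\<lambda>n. 1 / real (Suc n)) \<longlonglongrightarrow> 0" using LIMSEQ_inverse_real_of_nat by (simp add: inverse_eq_divide)
  show ?thesis
  proof (rule borel_measurable_LIMSEQ_metric)
    fix n
    have "(\<lambda>p. F (q n (k n (fst p))) (snd p)) \<in> borel_measurable (borel \<Otimes>\<^sub>M M)"
    proof (rule measurable_compose_countable[where f = "\<lambda>i p. F (q n i) (snd p)" and g = "\<lambda>p. k n (fst p)"])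
      fix i show "(\<lambda>p. F (q n i) (snd p)) \<in> borel_measurable (borel \<Otimes>\<^sub>M M)"
        using T by (intro measurable_compose[OF measurable_snd meas]) (auto simp: q_def)
      show "(\<lambda>p. k n (fst p)) \<in> borel \<Otimes>\<^sub>M M \<rightarrow>\<^sub>M count_space UNIV"
        unfolding k_def by measurable
    qed
    then show "(\<lambda>(s, x). F (q n (k n s)) x) \<in> borel_measurable (borel \<Otimes>\<^sub>M M)" by (simp add: case_prod_beta')
  next
    fix p :: "real \<times> 'b" assume "p \<in> space (borel \<Otimes>\<^sub>M M)"
    then obtain s x where p: "p = (s, x)" "x \<in> space M" by (auto simp: space_pair_measure)
    consider "s < 0" | "T \<le> s" "0 \<le> s" | "s \<in> {0..<T}" by fastforce
    then have "(\<lambda>n. F (q n (k n s)) x) \<longlonglongrightarrow> F (max 0 (min T s)) x"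
    proof cases
      case 1
      then have "eventually (\<lambda>n. 1 / real (Suc n) < - s) sequentially"
        using order_tendstoD(2)[OF inv, of "- s"] by simp
      then have "eventually (\<lambda>n. F (q n (k n s)) x = F 0 x) sequentially"
      proof eventually_elim
        case (elim n)
        then have "(real_of_int (k n s) + 1) / real (Suc n) \<le> 0" using kq(2)[where n = n and s = s] by linarith
        then show ?case by (simp add: q_def min_le_iff_disj)
      qed
      then show ?thesis using 1 by (simp add: tendsto_eventually)
    next
      case 2
      then have "q n (k n s) = T" for n
        using kq(1)[of s n] T unfolding q_def by (simp add: min_def)
      then show ?thesis using 2 T by simp
    next
      case 3
      have "(\<lambda>n. (real_of_int (k n s) + 1) / real (Suc n)) \<longlonglongrightarrow> s"
      proof (rule tendsto_sandwich[of "\<lambda>_. s" _ _ "\<lambda>n. s + 1 / real (Suc n)"])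
        show "(\<lambda>n. s + 1 / real (Suc n)) \<longlonglongrightarrow> s" using tendsto_add[OF tendsto_const[of s] inv] by simp
        show "\<forall>\<^sub>F n in sequentially. s \<le> (real_of_int (k n s) + 1) / real (Suc n)"
          using kq(1) by (intro always_eventually allI less_imp_le)
        show "\<forall>\<^sub>F n in sequentially. (real_of_int (k n s) + 1) / real (Suc n) \<le> s + 1 / real (Suc n)"
          using kq(2) by (intro always_eventually allI)
      qed simp
      then have "(\<lambda>n. q n (k n s)) \<longlonglongrightarrow> max 0 (min T s)" unfolding q_def by (intro tendsto_intros)
      moreover have "q n (k n s) > s" for n using kq(1)[of s n] 3 unfolding q_def by auto
      ultimately have "filterlim (\<lambda>n. q n (k n s)) (at_right s) sequentially"
        using 3 by (auto simp: filterlim_at intro!: always_eventually) (metis less_irrefl)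
      then have "(\<lambda>n. F (q n (k n s)) x) \<longlonglongrightarrow> F s x"
        by (rule filterlim_compose[OF rc[OF 3 p(2)]])
      then show ?thesis using 3 by simp
    qed
    then show "(\<lambda>n. case p of (s, x) \<Rightarrow> F (q n (k n s)) x) \<longlonglongrightarrow> (case p of (s, x) \<Rightarrow> F (max 0 (min T s)) x)"
      by (simp add: p)
  qed
qed

lemma right_continuous_measurable:
  fixes f :: "real \<Rightarrow> 'a::metric_space"
  assumes "0 \<le> T" "\<And>s. s \<in> {0..<T} \<Longrightarrow> (f \<longlongrightarrow> f s) (at_right s)"
  shows "(\<lambda>s. f (max 0 (min T s))) \<in> borel_measurable borel"
proof -
  \<comment> \<open>A one-point parameter space turns the statement about pairs into one about a
    single function.\<close>
  have "(\<lambda>(s, x). f (max 0 (min T s))) \<in> borel_measurable (borel \<Otimes>\<^sub>M count_space (UNIV :: unit set))"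
    using assms by (intro right_continuous_measurable_pair) auto
  from measurable_compose[OF measurable_Pair2' this, of "()"] show ?thesis by simp
qed

section \<open>Weak convergence\<close>

lemma limitin_mtopology_of:
  "limitin (mtopology_of m) f l F \<longleftrightarrow>
     l \<in> mspace m \<and> eventually (\<lambda>x. f x \<in> mspace m) F \<and> ((\<lambda>x. mdist m (f x) l) \<longlongrightarrow> 0) F"
  unfolding mtopology_of_def by (rule Metric_space.limitin_metric_dist_null[OF Metric_space_mspace_mdist])

lemma continuous_map_sequentiallyI:
  assumes "f \<in> mspace m \<rightarrow> topspace Y"
    and "\<And>\<sigma> l. range \<sigma> \<subseteq> mspace m \<Longrightarrow> limitin (mtopology_of m) \<sigma> l sequentially \<Longrightarrow>
      limitin Y (\<lambda>n. f (\<sigma> n)) (f l) sequentially"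
  shows "continuous_map (mtopology_of m) Y f"
  unfolding continuous_map_atin topspace_mtopology_of
proof
  have ev: "eventually P (atin (mtopology_of m) a) \<longleftrightarrow>
      (\<forall>\<sigma>. range \<sigma> \<subseteq> mspace m - {a} \<and> limitin (mtopology_of m) \<sigma> a sequentially \<longrightarrow>
        eventually (\<lambda>n. P (\<sigma> n)) sequentially)" for P a
    unfolding mtopology_of_def by (rule Metric_space.eventually_atin_sequentially[OF Metric_space_mspace_mdist])
  fix x assume x: "x \<in> mspace m"
  show "limitin Y f (f x) (atin (mtopology_of m) x)"
    unfolding limitin_def
  proof (intro conjI allI impI)
    show "f x \<in> topspace Y" using assms(1) x by auto
    fix U assume U: "openin Y U \<and> f x \<in> U"
    show "\<forall>\<^sub>F x in atin (mtopology_of m) x. f x \<in> U"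
      unfolding ev
    proof (intro allI impI)
      fix \<sigma> assume "range \<sigma> \<subseteq> mspace m - {x} \<and> limitin (mtopology_of m) \<sigma> x sequentially"
      then have "limitin Y (\<lambda>n. f (\<sigma> n)) (f x) sequentially" by (intro assms(2)) auto
      then show "\<forall>\<^sub>F n in sequentially. f (\<sigma> n) \<in> U" using U by (simp add: limitin_def)
    qed
  qed
qed

text \<open>The topology is given by a subbase, so convergence of integrals only controls subbasic
  sets directly; finite intersections and unions follow by induction over the generated open
  sets.\<close>

lemma limitin_weak_topology:
  "limitin (weak_topology X) \<mu>s \<mu> F \<longleftrightarrow>
     \<mu> \<in> prob_measures X \<and> eventually (\<lambda>n. \<mu>s n \<in> prob_measures X) F \<and>
     (\<forall>f. continuous_map X euclideanreal f \<longrightarrow> bounded (f ` topspace X) \<longrightarrow>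
        ((\<lambda>n. \<integral>x. f x \<partial>\<mu>s n) \<longlongrightarrow> (\<integral>x. f x \<partial>\<mu>)) F)" (is "?L \<longleftrightarrow> ?R")
proof
  assume L: ?L
  have "eventually (\<lambda>n. \<mu>s n \<in> prob_measures X) F"
    using limitinD[OF L openin_topspace] L by (auto dest: limitin_topspace)
  moreover have "((\<lambda>n. \<integral>x. f x \<partial>\<mu>s n) \<longlongrightarrow> (\<integral>x. f x \<partial>\<mu>)) F"
    if f: "continuous_map X euclideanreal f" "bounded (f ` topspace X)" for f
  proof (rule topological_tendstoI)
    fix U :: "real set" assume U: "open U" "(\<integral>x. f x \<partial>\<mu>) \<in> U"
    have "openin (weak_topology X) {\<mu> \<in> prob_measures X. (\<integral>x. f x \<partial>\<mu>) \<in> U}"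
      unfolding weak_topology_def by (rule topology_generated_by_Basis) (use f U in blast)
    then have "eventually (\<lambda>n. \<mu>s n \<in> {\<mu> \<in> prob_measures X. (\<integral>x. f x \<partial>\<mu>) \<in> U}) F"
      using L U limitin_topspace[OF L] by (intro limitinD[OF L]) auto
    then show "eventually (\<lambda>n. (\<integral>x. f x \<partial>\<mu>s n) \<in> U) F" by (rule eventually_mono) auto
  qed
  ultimately show ?R using limitin_topspace[OF L] by auto
next
  assume R: ?R
  have "eventually (\<lambda>n. \<mu>s n \<in> U) F" if "openin (weak_topology X) U" "\<mu> \<in> U" for U
  proof -
    have "generate_topology_on {{\<mu> \<in> prob_measures X. (\<integral>x. f x \<partial>\<mu>) \<in> U} | f (U :: real set).
        continuous_map X euclideanreal f \<and> bounded (f ` topspace X) \<and> open U} U"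
      using that(1) unfolding weak_topology_def by (rule openin_topology_generated_by)
    then show ?thesis using that(2)
    proof induction
      case (Int a b) then show ?case by (auto intro: eventually_conj)
    next
      case (UN K)
      then obtain k where "k \<in> K" "eventually (\<lambda>n. \<mu>s n \<in> k) F" by blast
      then show ?case by (auto elim: eventually_mono)
    next
      case (Basis s)
      then obtain f U where s: "s = {\<mu> \<in> prob_measures X. (\<integral>x. f x \<partial>\<mu>) \<in> U}"
        "continuous_map X euclideanreal f" "bounded (f ` topspace X)" "open (U :: real set)" by blast
      then have "((\<lambda>n. \<integral>x. f x \<partial>\<mu>s n) \<longlongrightarrow> (\<integral>x. f x \<partial>\<mu>)) F" using R by blast
      then have "eventually (\<lambda>n. (\<integral>x. f x \<partial>\<mu>s n) \<in> U) F"
        using s Basis(2) by (auto dest: topological_tendstoD)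
      then show ?case using R unfolding s by (auto intro: eventually_conj)
    qed auto
  qed
  then show ?L using R by (auto simp: limitin_def)
qed

text \<open>\<open>f\<close> need not be measurable, in which case both sides are lower integrals.\<close>

lemma nn_integral_distr_le:
  assumes "X \<in> M \<rightarrow>\<^sub>M N"
  shows "(\<integral>\<^sup>+ y. f y \<partial>distr M N X) \<le> (\<integral>\<^sup>+ \<omega>. f (X \<omega>) \<partial>M)"
  unfolding nn_integral_def[of "distr M N X" f]
proof (rule SUP_least)
  fix g assume g: "g \<in> {g. simple_function (distr M N X) g \<and> g \<le> f}"
  then have "integral\<^sup>S (distr M N X) g = (\<integral>\<^sup>+ y. g y \<partial>distr M N X)"
    by (simp add: nn_integral_eq_simple_integral)
  also have "\<dots> = (\<integral>\<^sup>+ \<omega>. g (X \<omega>) \<partial>M)"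
    using g by (intro nn_integral_distr[OF assms]) (auto dest: borel_measurable_simple_function)
  also have "\<dots> \<le> (\<integral>\<^sup>+ \<omega>. f (X \<omega>) \<partial>M)"
    using g by (intro nn_integral_mono) (auto simp: le_fun_def)
  finally show "integral\<^sup>S (distr M N X) g \<le> (\<integral>\<^sup>+ \<omega>. f (X \<omega>) \<partial>M)" .
qed

section \<open>Borel sets of a topology, laws, and the coupling bound\<close>

lemma space_borel_of [simp]: "space (borel_of X) = topspace X"
  unfolding borel_of_def by (rule space_measure_of) (auto dest: openin_subset)

lemma sets_borel_ofI: "openin X U \<Longrightarrow> U \<in> sets (borel_of X)"
  unfolding borel_of_def by (subst sets_measure_of) (auto dest: openin_subset)

lemma measurable_borel_ofI:
  assumes "f \<in> space M \<rightarrow> topspace X" "\<And>U. openin X U \<Longrightarrow> f -` U \<inter> space M \<in> sets M"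
  shows "f \<in> M \<rightarrow>\<^sub>M borel_of X"
  unfolding borel_of_def using assms by (intro measurable_measure_of) (auto dest: openin_subset)

lemma continuous_map_borel_of_measurable:
  assumes "continuous_map X Y f"
  shows "f \<in> borel_of X \<rightarrow>\<^sub>M borel_of Y"
proof (rule measurable_borel_ofI)
  show "f \<in> space (borel_of X) \<rightarrow> topspace Y" using continuous_map_funspace[OF assms] by simp
  fix U assume "openin Y U"
  then have "openin X {x \<in> topspace X. f x \<in> U}" using assms by (auto simp: continuous_map_def)
  moreover have "f -` U \<inter> space (borel_of X) = {x \<in> topspace X. f x \<in> U}" by auto
  ultimately show "f -` U \<inter> space (borel_of X) \<in> sets (borel_of X)" by (simp add: sets_borel_ofI)
qed

lemma prob_measures_distr:
  assumes "prob_space M" "X \<in> M \<rightarrow>\<^sub>M borel_of Y"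
  shows "distr M (borel_of Y) X \<in> prob_measures Y"
  using prob_space.prob_space_distr[OF assms] by (simp add: prob_measures_iff)

text \<open>Passing to the joint law of \<open>X\<close> and \<open>Y\<close> removes the
  restriction of \<open>admissible_metric\<close> to sample spaces of pairs. The distance need not
  be measurable for the product sigma-algebra, which is why only the inequality
  \<open>nn_integral_distr_le\<close> is available and the expectations are lower integrals.\<close>

lemma admissible_metric_le:
  assumes "admissible_metric E \<rho>" "prob_space M"
    and X: "X \<in> M \<rightarrow>\<^sub>M borel_of (mtopology_of E)" and Y: "Y \<in> M \<rightarrow>\<^sub>M borel_of (mtopology_of E)"
  shows "ennreal (mdist \<rho> (distr M (borel_of (mtopology_of E)) X) (distr M (borel_of (mtopology_of E)) Y))
    \<le> (\<integral>\<^sup>+ \<omega>. ennreal (mdist E (X \<omega>) (Y \<omega>)) \<partial>M)"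
proof -
  let ?B = "borel_of (mtopology_of E)"
  let ?Z = "\<lambda>\<omega>. (X \<omega>, Y \<omega>)"
  let ?N = "distr M (?B \<Otimes>\<^sub>M ?B) ?Z"
  have Z: "?Z \<in> M \<rightarrow>\<^sub>M ?B \<Otimes>\<^sub>M ?B" using X Y by (rule measurable_Pair)
  have fs: "distr ?N ?B fst = distr M ?B X" "distr ?N ?B snd = distr M ?B Y"
    using Z by (simp_all add: distr_distr comp_def)
  have "ennreal (mdist \<rho> (distr ?N ?B fst) (distr ?N ?B snd)) \<le> (\<integral>\<^sup>+ \<omega>. ennreal (mdist E (fst \<omega>) (snd \<omega>)) \<partial>?N)"
    using assms(1) prob_space.prob_space_distr[OF assms(2) Z] measurable_fst[of ?B ?B] measurable_snd[of ?B ?B]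
    unfolding admissible_metric_def by (simp only: measurable_distr_eq1)
  also have "\<dots> \<le> (\<integral>\<^sup>+ \<omega>. ennreal (mdist E (X \<omega>) (Y \<omega>)) \<partial>M)"
    using nn_integral_distr_le[OF Z, of "\<lambda>\<omega>. ennreal (mdist E (fst \<omega>) (snd \<omega>))"] by simp
  finally show ?thesis by (simp only: fs)
qed

subsection \<open>Lipschitz envelopes and almost everywhere continuous functions\<close>

lemma prob_measuresD:
  assumes "\<nu> \<in> prob_measures X"
  shows "prob_space \<nu>" "sets \<nu> = sets (borel_of X)" "space \<nu> = topspace X"
  using assms sets_eq_imp_space_eq[of \<nu> "borel_of X"] by (auto simp: prob_measures_iff)

lemma integrable_bounded_prob_measures:
  fixes F :: "'e \<Rightarrow> 'a::{banach, second_countable_topology}"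
  assumes "\<nu> \<in> prob_measures X" "F \<in> borel_measurable (borel_of X)" "\<And>x. x \<in> topspace X \<Longrightarrow> norm (F x) \<le> B"
  shows "integrable \<nu> F"
proof -
  interpret prob_space \<nu> using prob_measuresD[OF assms(1)] by simp
  have "F \<in> borel_measurable \<nu>"
    using assms(2) prob_measuresD(2)[OF assms(1)] by (simp cong: measurable_cong_sets)
  then show ?thesis
    using assms(3) prob_measuresD(3)[OF assms(1)] by (intro integrable_const_bound[of _ B]) auto
qed

text \<open>The sup-convolution, or Pasch-Hausdorff envelope: for bounded \<open>F\<close> and
  nonnegative \<open>k\<close> it is the least \<open>k\<close>-Lipschitz majorant of
  \<open>F\<close>. It approximates \<open>F\<close> from above by bounded continuous
  functions.\<close>

definition lipschitz_envelope :: "'e metric \<Rightarrow> real \<Rightarrow> ('e \<Rightarrow> real) \<Rightarrow> 'e \<Rightarrow> real" where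
  "lipschitz_envelope m k F x = (SUP y\<in>mspace m. F y - k * mdist m x y)"

context
  fixes m :: "'e metric" and F :: "'e \<Rightarrow> real" and B k :: real
  assumes bound: "\<And>x. x \<in> mspace m \<Longrightarrow> \<bar>F x\<bar> \<le> B" and k: "0 \<le> k"
begin

lemma lipschitz_envelope_bdd: "bdd_above ((\<lambda>y. F y - k * mdist m x y) ` mspace m)"
proof (rule bdd_aboveI2)
  fix y assume "y \<in> mspace m"
  then show "F y - k * mdist m x y \<le> B"
    using bound[of y] mult_nonneg_nonneg[OF k mdist_nonneg[of m x y]] by linarith
qed

lemma lipschitz_envelope_ge:
  assumes "x \<in> mspace m"
  shows "F x \<le> lipschitz_envelope m k F x"
proof -
  have z: "mdist m x x = 0" using assms by simp
  have "F x = F x - k * mdist m x x" unfolding z by simp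
  also have "\<dots> \<le> lipschitz_envelope m k F x"
    unfolding lipschitz_envelope_def by (rule cSUP_upper[OF assms lipschitz_envelope_bdd])
  finally show ?thesis .
qed

lemma lipschitz_envelope_le:
  assumes "x \<in> mspace m" "\<And>y. y \<in> mspace m \<Longrightarrow> F y - k * mdist m x y \<le> c"
  shows "lipschitz_envelope m k F x \<le> c"
  unfolding lipschitz_envelope_def using assms by (intro cSUP_least) auto

lemma lipschitz_envelope_abs_le:
  assumes "x \<in> mspace m"
  shows "\<bar>lipschitz_envelope m k F x\<bar> \<le> B"
proof -
  have "lipschitz_envelope m k F x \<le> B"
  proof (rule lipschitz_envelope_le[OF assms])
    fix y assume "y \<in> mspace m"
    then show "F y - k * mdist m x y \<le> B"
      using bound[of y] mult_nonneg_nonneg[OF k mdist_nonneg[of m x y]] by linarith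
  qed
  then show ?thesis using lipschitz_envelope_ge[OF assms] bound[OF assms] by linarith
qed

lemma lipschitz_envelope_lipschitz:
  assumes "x \<in> mspace m" "y \<in> mspace m"
  shows "lipschitz_envelope m k F x \<le> lipschitz_envelope m k F y + k * mdist m x y"
proof (rule lipschitz_envelope_le[OF assms(1)])
  fix z assume z: "z \<in> mspace m"
  have "F z - k * mdist m y z \<le> lipschitz_envelope m k F y"
    unfolding lipschitz_envelope_def by (rule cSUP_upper[OF z lipschitz_envelope_bdd])
  moreover have "k * mdist m y z \<le> k * (mdist m x y + mdist m x z)"
    using mdist_triangle[of y m x z] assms z k by (intro mult_left_mono) (auto simp: mdist_commute)
  ultimately show "F z - k * mdist m x z \<le> lipschitz_envelope m k F y + k * mdist m x y"
    by (simp add: algebra_simps)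
qed

lemma continuous_map_lipschitz_envelope:
  "continuous_map (mtopology_of m) euclideanreal (lipschitz_envelope m k F)"
proof -
  have "Lipschitz_continuous_map m euclidean_metric (lipschitz_envelope m k F)"
    unfolding Lipschitz_continuous_map_def
  proof (intro conjI exI ballI)
    fix x y assume "x \<in> mspace m" "y \<in> mspace m"
    then show "mdist euclidean_metric (lipschitz_envelope m k F x) (lipschitz_envelope m k F y) \<le> k * mdist m x y"
      using lipschitz_envelope_lipschitz[of x y] lipschitz_envelope_lipschitz[of y x]
      by (simp add: dist_real_def mdist_commute abs_le_iff)
  qed auto
  then show ?thesis using Lipschitz_continuous_imp_continuous_map by fastforce
qed

end

text \<open>Points near \<open>x\<close> contribute little more than \<open>F x\<close> by
  continuity, and for large \<open>k\<close> the penalty rules out all other points.\<close>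

lemma lipschitz_envelope_tendsto:
  assumes bound: "\<And>x. x \<in> mspace m \<Longrightarrow> \<bar>F x\<bar> \<le> B" and x: "x \<in> mspace m"
    and cont: "\<forall>\<sigma>. limitin (mtopology_of m) \<sigma> x sequentially \<longrightarrow> (\<lambda>n. F (\<sigma> n)) \<longlonglongrightarrow> F x"
  shows "(\<lambda>k. lipschitz_envelope m (real k) F x) \<longlonglongrightarrow> F x"
proof (rule LIMSEQ_I)
  fix e :: real assume e: "e > 0"
  have "\<exists>n. \<forall>y\<in>mspace m. mdist m x y < inverse (real (Suc n)) \<longrightarrow> F y < F x + e / 2"
  proof (rule ccontr)
    assume "\<not> ?thesis"
    then obtain \<sigma> where \<sigma>: "\<And>n. \<sigma> n \<in> mspace m" "\<And>n. mdist m x (\<sigma> n) < inverse (real (Suc n))" "\<And>n. F (\<sigma> n) \<ge> F x + e / 2"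
      by (metis linorder_not_less)
    have "(\<lambda>n. mdist m (\<sigma> n) x) \<longlonglongrightarrow> 0"
      by (rule tendsto_sandwich[OF _ _ tendsto_const LIMSEQ_inverse_real_of_nat])
        (use \<sigma>(2) in \<open>auto simp: mdist_commute less_imp_le intro!: always_eventually\<close>)
    then have "limitin (mtopology_of m) \<sigma> x sequentially" using \<sigma>(1) x by (simp add: limitin_mtopology_of)
    then have "(\<lambda>n. F (\<sigma> n)) \<longlonglongrightarrow> F x" using cont by blast
    then have "F x + e / 2 \<le> F x" using \<sigma>(3) by (intro LIMSEQ_le_const) auto
    then show False using e by simp
  qed
  then obtain n where n: "\<And>y. y \<in> mspace m \<Longrightarrow> mdist m x y < inverse (real (Suc n)) \<Longrightarrow> F y < F x + e / 2" by blast
  have B: "0 \<le> B" using bound[OF x] by linarith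
  \<comment> \<open>At distance at least \<open>inverse (Suc n)\<close> the penalty is then at least
    \<open>2 * B\<close>, the largest possible oscillation of \<open>F\<close>.\<close>
  obtain N :: nat where N: "2 * B * real (Suc n) \<le> real N" using real_arch_simple by blast
  have "norm (lipschitz_envelope m (real k) F x - F x) < e" if k: "k \<ge> N" for k
  proof -
    have "lipschitz_envelope m (real k) F x \<le> F x + e / 2"
    proof (rule lipschitz_envelope_le[OF bound _ x])
      show "0 \<le> real k" by simp
      fix y assume y: "y \<in> mspace m"
      show "F y - real k * mdist m x y \<le> F x + e / 2"
      proof (cases "mdist m x y < inverse (real (Suc n))")
        case True
        have "0 \<le> real k * mdist m x y" by simp
        then show ?thesis using n[OF y True] by linarith
      next
        case False
        have "2 * B = (2 * B * real (Suc n)) * inverse (real (Suc n))" by (simp del: of_nat_Suc)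
        also have "\<dots> \<le> real k * mdist m x y"
          using False k N B by (intro mult_mono) auto
        finally show ?thesis using bound[OF y] bound[OF x] e by linarith
      qed
    qed
    then show ?thesis using lipschitz_envelope_ge[of m F B "real k", OF bound _ x] e by (simp add: abs_less_iff)
  qed
  then show "\<exists>N. \<forall>k\<ge>N. norm (lipschitz_envelope m (real k) F x - F x) < e" by blast
qed

text \<open>The envelopes majorize \<open>F\<close> under every measure, their integrals pass to the
  weak limit, and under the limit law they decrease to \<open>F\<close> at almost every point.
  Majorants give an upper bound only.\<close>

lemma weak_limit_AE_continuous_upper:
  fixes F :: "'e \<Rightarrow> real"
  assumes lim: "limitin (weak_topology (mtopology_of m)) \<nu>s \<nu> sequentially"
    and F: "F \<in> borel_measurable (borel_of (mtopology_of m))"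
    and bound: "\<And>x. x \<in> mspace m \<Longrightarrow> \<bar>F x\<bar> \<le> B"
    and cont: "AE x in \<nu>. \<forall>\<sigma>. limitin (mtopology_of m) \<sigma> x sequentially \<longrightarrow> (\<lambda>n. F (\<sigma> n)) \<longlonglongrightarrow> F x"
    and e: "0 < e"
  shows "eventually (\<lambda>n. (\<integral>x. F x \<partial>\<nu>s n) < (\<integral>x. F x \<partial>\<nu>) + e) sequentially"
proof -
  let ?G = "\<lambda>k. lipschitz_envelope m (real k) F"
  have \<nu>: "\<nu> \<in> prob_measures (mtopology_of m)"
    and \<nu>s: "eventually (\<lambda>n. \<nu>s n \<in> prob_measures (mtopology_of m)) sequentially"
    using lim by (auto simp: limitin_weak_topology)
  interpret prob_space \<nu> using prob_measuresD[OF \<nu>] by simp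
  have Gc: "continuous_map (mtopology_of m) euclideanreal (?G k)" for k
    using bound by (rule continuous_map_lipschitz_envelope) auto
  then have Gm: "?G k \<in> borel_measurable (borel_of (mtopology_of m))" for k
    using continuous_map_borel_of_measurable by fastforce
  have Gb: "\<bar>?G k x\<bar> \<le> B" if "x \<in> mspace m" for k x
    using bound _ that by (rule lipschitz_envelope_abs_le) auto
  note [measurable_cong] = prob_measuresD(2)[OF \<nu>]
  have "(\<lambda>k. \<integral>x. ?G k x \<partial>\<nu>) \<longlonglongrightarrow> (\<integral>x. F x \<partial>\<nu>)"
  proof (rule integral_dominated_convergence[where w = "\<lambda>_. B"])
    show "AE x in \<nu>. (\<lambda>k. ?G k x) \<longlonglongrightarrow> F x"
      using cont AE_space
    proof eventually_elim
      case (elim x)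
      then show ?case using prob_measuresD(3)[OF \<nu>] by (intro lipschitz_envelope_tendsto[OF bound]) auto
    qed
    show "AE x in \<nu>. norm (?G k x) \<le> B" for k
      using AE_space by eventually_elim (use Gb prob_measuresD(3)[OF \<nu>] in auto)
  qed (use F Gm in measurable)
  then have "eventually (\<lambda>k. (\<integral>x. ?G k x \<partial>\<nu>) < (\<integral>x. F x \<partial>\<nu>) + e) sequentially"
    using e by (intro order_tendstoD) auto
  then obtain k where k: "(\<integral>x. ?G k x \<partial>\<nu>) < (\<integral>x. F x \<partial>\<nu>) + e"
    by (auto simp: eventually_sequentially)
  have "bounded (?G k ` topspace (mtopology_of m))" using Gb by (auto simp: bounded_iff)
  then have "(\<lambda>n. \<integral>x. ?G k x \<partial>\<nu>s n) \<longlonglongrightarrow> (\<integral>x. ?G k x \<partial>\<nu>)"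
    using lim Gc by (simp add: limitin_weak_topology)
  then have "eventually (\<lambda>n. (\<integral>x. ?G k x \<partial>\<nu>s n) < (\<integral>x. F x \<partial>\<nu>) + e) sequentially"
    using k by (rule order_tendstoD)
  then show ?thesis using \<nu>s
  proof eventually_elim
    case (elim n)
    have "(\<integral>x. F x \<partial>\<nu>s n) \<le> (\<integral>x. ?G k x \<partial>\<nu>s n)"
      using elim(2) F Gm Gb bound prob_measuresD(3)[OF elim(2)] lipschitz_envelope_ge[of m F B "real k", OF bound]
      by (intro integral_mono integrable_bounded_prob_measures[of _ "mtopology_of m" _ B]) auto
    then show ?case using elim(1) by linarith
  qed
qed

text \<open>The missing lower bound is the upper bound for \<open>- F\<close>. This is the mapping
  theorem for bounded functionals whose discontinuities are negligible for the limit law.\<close>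

lemma weak_limit_AE_continuous:
  fixes F :: "'e \<Rightarrow> real"
  assumes lim: "limitin (weak_topology (mtopology_of m)) \<nu>s \<nu> sequentially"
    and F: "F \<in> borel_measurable (borel_of (mtopology_of m))"
    and bound: "\<And>x. x \<in> mspace m \<Longrightarrow> \<bar>F x\<bar> \<le> B"
    and cont: "AE x in \<nu>. \<forall>\<sigma>. limitin (mtopology_of m) \<sigma> x sequentially \<longrightarrow> (\<lambda>n. F (\<sigma> n)) \<longlonglongrightarrow> F x"
  shows "(\<lambda>n. \<integral>x. F x \<partial>\<nu>s n) \<longlonglongrightarrow> (\<integral>x. F x \<partial>\<nu>)"
proof (rule order_tendstoI)
  fix a assume a: "a < (\<integral>x. F x \<partial>\<nu>)"
  have "AE x in \<nu>. \<forall>\<sigma>. limitin (mtopology_of m) \<sigma> x sequentially \<longrightarrow> (\<lambda>n. - F (\<sigma> n)) \<longlonglongrightarrow> - F x"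
    using cont by eventually_elim (auto intro: tendsto_minus)
  then have "eventually (\<lambda>n. (\<integral>x. - F x \<partial>\<nu>s n) < (\<integral>x. - F x \<partial>\<nu>) + ((\<integral>x. F x \<partial>\<nu>) - a)) sequentially"
    using F bound a by (intro weak_limit_AE_continuous_upper[OF lim, of _ B]) auto
  then show "eventually (\<lambda>n. a < (\<integral>x. F x \<partial>\<nu>s n)) sequentially" by simp
next
  fix a assume "(\<integral>x. F x \<partial>\<nu>) < a"
  then show "eventually (\<lambda>n. (\<integral>x. F x \<partial>\<nu>s n) < a) sequentially"
    using weak_limit_AE_continuous_upper[OF lim F bound cont, of "a - (\<integral>x. F x \<partial>\<nu>)"] by simp
qed

section \<open>Convergence in Skorokhod space\<close>

text \<open>Closeness witnessed by a single time change. It agrees with smallness of the distance up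
  to a factor 2 and hides the infimum over time changes.\<close>

definition skorokhod_close :: "real \<Rightarrow> real \<Rightarrow> (real \<Rightarrow> 'a::real_normed_vector) \<Rightarrow> (real \<Rightarrow> 'a) \<Rightarrow> bool" where
  "skorokhod_close T e f g \<longleftrightarrow>
     (\<exists>\<tau>\<in>time_changes T. time_change_norm T \<tau> \<le> ennreal e \<and> (\<forall>t\<in>{0..T}. norm (f t - g (\<tau> t)) \<le> e))"

lemma skorokhod_close_if_dist_less:
  fixes f g :: "real \<Rightarrow> 'a::real_normed_vector"
  assumes "f \<in> cadlag T" "g \<in> cadlag T" "skorokhod_dist T f g < e"
  shows "skorokhod_close T e f g"
proof -
  have "0 \<le> skorokhod_dist T f g" by (simp add: skorokhod_dist_def)
  then have e: "e > 0" using assms(3) by linarith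
  have "skorokhod_edist T f g < ennreal e"
  proof -
    have "skorokhod_edist T f g = ennreal (skorokhod_dist T f g)"
      unfolding skorokhod_dist_def using skorokhod_edist_finite[OF assms(1,2)] by (rule ennreal_enn2real[symmetric])
    then show ?thesis using ennreal_lessI[OF e assms(3)] by simp
  qed
  then obtain \<tau> where \<tau>: "\<tau> \<in> time_changes T" "time_change_norm T \<tau> + sup_dist T f (g \<circ> \<tau>) < ennreal e"
    by (auto simp: INF_less_iff)
  have "time_change_norm T \<tau> \<le> time_change_norm T \<tau> + sup_dist T f (g \<circ> \<tau>)"
    "sup_dist T f (g \<circ> \<tau>) \<le> time_change_norm T \<tau> + sup_dist T f (g \<circ> \<tau>)"
    by (simp_all add: add_increasing add_increasing2)
  then have n: "time_change_norm T \<tau> \<le> ennreal e" "sup_dist T f (g \<circ> \<tau>) \<le> ennreal e"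
    using \<tau>(2) by (meson less_imp_le order_trans)+
  have "norm (f t - g (\<tau> t)) \<le> e" if "t \<in> {0..T}" for t
  proof -
    have "ennreal (norm (f t - g (\<tau> t))) \<le> sup_dist T f (g \<circ> \<tau>)"
      unfolding sup_dist_def using that by (intro SUP_upper2[of t]) auto
    then show ?thesis using n(2) e by (metis ennreal_le_iff less_imp_le order_trans)
  qed
  then show ?thesis using \<tau>(1) n(1) by (auto simp: skorokhod_close_def)
qed

lemma skorokhod_dist_le_if_close:
  assumes "skorokhod_close T e f g" "0 \<le> e"
  shows "skorokhod_dist T f g \<le> 2 * e"
proof -
  obtain \<tau> where \<tau>: "\<tau> \<in> time_changes T" "time_change_norm T \<tau> \<le> ennreal e" "\<And>t. t \<in> {0..T} \<Longrightarrow> norm (f t - g (\<tau> t)) \<le> e"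
    using assms(1) by (auto simp: skorokhod_close_def)
  have "sup_dist T f (g \<circ> \<tau>) \<le> ennreal e"
    unfolding sup_dist_def using \<tau>(3) by (intro SUP_least ennreal_leI) auto
  then have "skorokhod_edist T f g \<le> ennreal e + ennreal e"
    using \<tau> by (intro INF_lower2[OF \<tau>(1)] add_mono)
  also have "\<dots> = ennreal (2 * e)" using assms(2) by (simp flip: ennreal_plus)
  finally show ?thesis unfolding skorokhod_dist_def using assms(2) by (intro enn2real_leI) auto
qed

lemma limitin_skorokhod:
  fixes \<gamma> :: "real \<Rightarrow> 'a::real_normed_vector"
  assumes "0 < T"
  shows "limitin (skorokhod_topology T) \<gamma>s \<gamma> F \<longleftrightarrow>
    \<gamma> \<in> cadlag T \<and> eventually (\<lambda>n. \<gamma>s n \<in> cadlag T) F \<and> (\<forall>e>0. eventually (\<lambda>n. skorokhod_close T e (\<gamma>s n) \<gamma>) F)"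
  (is "?L \<longleftrightarrow> ?R")
proof
  assume L: ?L
  then have g: "\<gamma> \<in> cadlag T" and gs: "eventually (\<lambda>n. \<gamma>s n \<in> cadlag T) F"
    and d: "((\<lambda>n. skorokhod_dist T (\<gamma>s n) \<gamma>) \<longlongrightarrow> 0) F"
    using assms by (auto simp: limitin_mtopology_of)
  have "eventually (\<lambda>n. skorokhod_close T e (\<gamma>s n) \<gamma>) F" if "e > 0" for e
    using order_tendstoD(2)[OF d that] gs
    by eventually_elim (use g in \<open>auto intro: skorokhod_close_if_dist_less\<close>)
  then show ?R using g gs by auto
next
  assume R: ?R
  have "((\<lambda>n. skorokhod_dist T (\<gamma>s n) \<gamma>) \<longlongrightarrow> 0) F"
  proof (rule tendstoI)
    fix e :: real assume e: "e > 0"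
    then have "eventually (\<lambda>n. skorokhod_close T (e / 3) (\<gamma>s n) \<gamma>) F" using R by simp
    then show "eventually (\<lambda>n. dist (skorokhod_dist T (\<gamma>s n) \<gamma>) 0 < e) F"
    proof eventually_elim
      case (elim n)
      then have "skorokhod_dist T (\<gamma>s n) \<gamma> \<le> 2 * (e / 3)" using e by (intro skorokhod_dist_le_if_close) auto
      moreover have "0 \<le> skorokhod_dist T (\<gamma>s n) \<gamma>" by (simp add: skorokhod_dist_def)
      ultimately show ?case using e by (simp add: dist_real_def)
    qed
  qed
  then show ?L using R assms by (auto simp: limitin_mtopology_of)
qed

text \<open>\<open>T * (exp e - 1)\<close> is the largest displacement that
  \<open>time_change_norm_displacement\<close> allows for a time change of norm at most
  \<open>e\<close>.\<close>

lemma small_displacement: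
  fixes d :: real
  assumes "0 < d"
  obtains e where "0 < e" "e \<le> d" "T * (exp e - 1) < d"
proof -
  have "((\<lambda>e. T * (exp e - 1)) \<longlongrightarrow> T * (exp 0 - 1)) (at_right 0)" by (intro tendsto_intros)
  then have "eventually (\<lambda>e. T * (exp e - 1) < d) (at_right 0)"
    using assms by (auto dest: order_tendstoD(2))
  then obtain r where r: "r > 0" "\<And>u. u > 0 \<Longrightarrow> u < r \<Longrightarrow> T * (exp u - 1) < d"
    by (auto simp: eventually_at_right_field)
  show thesis
    by (rule that[of "min d (r / 2)"]) (use assms r in \<open>auto simp: min_less_iff_disj\<close>)
qed

lemma skorokhod_close_displacement:
  fixes f g :: "real \<Rightarrow> 'a::real_normed_vector"
  assumes "0 < T" "skorokhod_close T e f g" "0 \<le> e"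
  obtains \<tau> where "\<tau> \<in> time_changes T" "time_change_norm T \<tau> \<le> ennreal e"
    "\<And>t. t \<in> {0..T} \<Longrightarrow> norm (f t - g (\<tau> t)) \<le> e" "\<And>t. t \<in> {0..T} \<Longrightarrow> \<bar>\<tau> t - t\<bar> \<le> T * (exp e - 1)"
proof -
  obtain \<tau> where \<tau>: "\<tau> \<in> time_changes T" "time_change_norm T \<tau> \<le> ennreal e"
    "\<And>t. t \<in> {0..T} \<Longrightarrow> norm (f t - g (\<tau> t)) \<le> e"
    using assms(2) by (auto simp: skorokhod_close_def)
  show thesis
    by (rule that[OF \<tau>]) (use time_change_norm_displacement[OF \<tau>(1) assms(1) _ \<tau>(2) assms(3)] in auto)
qed

text \<open>The time change displaces \<open>t\<close> slightly, and continuity of the limit path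
  absorbs this; at a jump the displaced time could fall on either side.\<close>

lemma skorokhod_limit_at_continuity_point:
  fixes \<gamma> :: "real \<Rightarrow> 'a::real_normed_vector"
  assumes T: "0 < T" and lim: "limitin (skorokhod_topology T) \<gamma>s \<gamma> F" and t: "t \<in> {0..T}" "isCont \<gamma> t"
  shows "((\<lambda>n. \<gamma>s n t) \<longlongrightarrow> \<gamma> t) F"
proof (rule tendstoI)
  fix r :: real assume r: "r > 0"
  obtain d where d: "d > 0" "\<And>u. \<bar>u - t\<bar> < d \<Longrightarrow> dist (\<gamma> u) (\<gamma> t) < r / 2"
    using t(2) r unfolding continuous_at_eps_delta by (metis dist_real_def half_gt_zero)
  obtain e where e: "0 < e" "e \<le> min d (r / 2)" "T * (exp e - 1) < min d (r / 2)"
    using small_displacement[of "min d (r / 2)" T] d(1) r by auto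
  have "eventually (\<lambda>n. skorokhod_close T e (\<gamma>s n) \<gamma>) F" using lim e(1) limitin_skorokhod[OF T] by blast
  then show "eventually (\<lambda>n. dist (\<gamma>s n t) (\<gamma> t) < r) F"
  proof eventually_elim
    case (elim n)
    obtain \<tau> where \<tau>: "norm (\<gamma>s n t - \<gamma> (\<tau> t)) \<le> e" "\<bar>\<tau> t - t\<bar> \<le> T * (exp e - 1)"
      using skorokhod_close_displacement[OF T elim] e(1) t(1) by (metis less_imp_le)
    have "dist (\<gamma> (\<tau> t)) (\<gamma> t) < r / 2" using \<tau>(2) e(3) by (intro d(2)) auto
    moreover have "dist (\<gamma>s n t) (\<gamma> (\<tau> t)) \<le> r / 2" using \<tau>(1) e(2) by (simp add: dist_norm)
    ultimately show ?case using dist_triangle[of "\<gamma>s n t" "\<gamma> t" "\<gamma> (\<tau> t)"] by linarith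
  qed
qed

text \<open>Every time change fixes \<open>T\<close>, so evaluation there is continuous even at
  paths that jump at \<open>T\<close>.\<close>

lemma skorokhod_limit_at_end:
  fixes \<gamma> :: "real \<Rightarrow> 'a::real_normed_vector"
  assumes T: "0 < T" and lim: "limitin (skorokhod_topology T) \<gamma>s \<gamma> F"
  shows "((\<lambda>n. \<gamma>s n T) \<longlongrightarrow> \<gamma> T) F"
proof (rule tendstoI)
  fix r :: real assume r: "r > 0"
  then have "eventually (\<lambda>n. skorokhod_close T (r / 2) (\<gamma>s n) \<gamma>) F" using lim limitin_skorokhod[OF T] half_gt_zero by blast
  then show "eventually (\<lambda>n. dist (\<gamma>s n T) (\<gamma> T) < r) F"
  proof eventually_elim
    case (elim n)
    obtain \<tau> where \<tau>: "\<tau> \<in> time_changes T" "norm (\<gamma>s n T - \<gamma> (\<tau> T)) \<le> r / 2"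
      using skorokhod_close_displacement[OF T elim] r T by (metis atLeastAtMost_iff half_gt_zero less_imp_le order_refl)
    then show ?case using time_changes_ends[OF \<tau>(1) T] r by (simp add: dist_norm)
  qed
qed

lemma skorokhod_limit_bounded:
  fixes \<gamma> :: "real \<Rightarrow> 'a::real_normed_vector"
  assumes T: "0 < T" and lim: "limitin (skorokhod_topology T) \<gamma>s \<gamma> F"
  obtains B where "eventually (\<lambda>n. \<forall>t\<in>{0..T}. norm (\<gamma>s n t - \<gamma> t) \<le> B) F"
proof -
  have "\<gamma> \<in> cadlag T" using lim limitin_skorokhod[OF T] by blast
  then obtain C where C: "\<And>t. t \<in> {0..T} \<Longrightarrow> norm (\<gamma> t) \<le> C" using cadlag_bounded by blast
  have "eventually (\<lambda>n. skorokhod_close T 1 (\<gamma>s n) \<gamma>) F" using lim limitin_skorokhod[OF T] zero_less_one by blast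
  then have "eventually (\<lambda>n. \<forall>t\<in>{0..T}. norm (\<gamma>s n t - \<gamma> t) \<le> 1 + 2 * C) F"
  proof eventually_elim
    case (elim n)
    then obtain \<tau> where \<tau>: "\<tau> \<in> time_changes T" "\<And>t. t \<in> {0..T} \<Longrightarrow> norm (\<gamma>s n t - \<gamma> (\<tau> t)) \<le> 1"
      by (auto simp: skorokhod_close_def)
    show ?case
    proof
      fix t assume t: "t \<in> {0..T}"
      have "norm (\<gamma>s n t - \<gamma> t) \<le> norm (\<gamma>s n t - \<gamma> (\<tau> t)) + norm (\<gamma> (\<tau> t) - \<gamma> t)"
        using norm_triangle_ineq[of "\<gamma>s n t - \<gamma> (\<tau> t)" "\<gamma> (\<tau> t) - \<gamma> t"] by simp
      then show "norm (\<gamma>s n t - \<gamma> t) \<le> 1 + 2 * C"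
        using \<tau>(2)[OF t] C[OF t] C[OF time_changes_in[OF \<tau>(1) t]] norm_triangle_ineq4[of "\<gamma> (\<tau> t)" "\<gamma> t"] by linarith
    qed
  qed
  then show thesis by (rule that)
qed

section \<open>Time integrals of cadlag paths and measurability of evaluation\<close>

lemma cadlag_measurable_clamp:
  "\<gamma> \<in> cadlag T \<Longrightarrow> 0 \<le> T \<Longrightarrow> (\<lambda>s. \<gamma> (max 0 (min T s))) \<in> borel_measurable borel"
  by (intro right_continuous_measurable cadlag_right) auto

lemma set_borel_measurable_cadlag:
  fixes \<gamma> :: "real \<Rightarrow> 'a::{real_normed_vector, second_countable_topology}"
  assumes "\<gamma> \<in> cadlag T" "A \<in> sets borel" "A \<subseteq> {0..T}"
  shows "set_borel_measurable lborel A \<gamma>"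
proof (cases "0 \<le> T")
  case True
  \<comment> \<open>Clamping the time gives a Borel function on the whole line, and the indicator
    makes it equal to the original integrand. The same replacement prepares the later measurability
    arguments in time.\<close>
  have "(\<lambda>s. indicator A s *\<^sub>R \<gamma> (max 0 (min T s))) \<in> borel_measurable borel"
    using assms(2) by (intro borel_measurable_scaleR cadlag_measurable_clamp[OF assms(1) True]) simp
  moreover have "(\<lambda>s. indicator A s *\<^sub>R \<gamma> (max 0 (min T s))) = (\<lambda>s. indicator A s *\<^sub>R \<gamma> s)"
    using assms(3) by (auto simp: fun_eq_iff split: split_indicator)
  ultimately show ?thesis by (simp add: set_borel_measurable_def)
next
  case False
  then have "A = {}" using assms(3) by auto
  then show ?thesis by (simp add: set_borel_measurable_def)
qed

lemma set_integrable_cadlag: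
  fixes \<gamma> :: "real \<Rightarrow> 'a::euclidean_space"
  assumes "\<gamma> \<in> cadlag T" "A \<in> sets borel" "A \<subseteq> {0..T}"
  shows "set_integrable lborel A \<gamma>"
proof -
  obtain B where B: "\<And>t. t \<in> {0..T} \<Longrightarrow> norm (\<gamma> t) \<le> B" using cadlag_bounded[OF assms(1)] by blast
  have "set_integrable lborel {0..T} (\<lambda>_. B)" by (rule borel_integrable_atLeastAtMost') simp
  then have "set_integrable lborel A (\<lambda>_. B)" by (rule set_integrable_subset) (use assms(2,3) in simp_all)
  then show ?thesis
  proof (rule set_integrable_bound)
    show "set_borel_measurable lborel A \<gamma>" by (rule set_borel_measurable_cadlag[OF assms])
    show "AE x in lborel. x \<in> A \<longrightarrow> norm (\<gamma> x) \<le> norm B"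
      using B assms(3) by (intro AE_I2) (metis abs_ge_self order_trans real_norm_def subsetD)
  qed
qed

lemma norm_set_integral_le_nn:
  fixes f :: "'b \<Rightarrow> 'a::{banach, second_countable_topology}"
  assumes "set_integrable M A f"
  shows "ennreal (norm (LINT s:A|M. f s)) \<le> (\<integral>\<^sup>+s\<in>A. ennreal (norm (f s)) \<partial>M)"
proof -
  have "ennreal (norm (LINT s:A|M. f s)) \<le> (\<integral>\<^sup>+s. ennreal (norm (indicator A s *\<^sub>R f s)) \<partial>M)"
    using assms unfolding set_lebesgue_integral_def set_integrable_def by (rule integral_norm_bound_ennreal)
  also have "\<dots> = (\<integral>\<^sup>+s\<in>A. ennreal (norm (f s)) \<partial>M)"
    by (intro nn_integral_cong) (auto split: split_indicator)
  finally show ?thesis .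
qed

text \<open>Almost every time is a continuity point of the limit, and Skorokhod convergence forces a
  uniform bound on the differences eventually, so dominated convergence applies.\<close>

lemma skorokhod_limit_L1:
  fixes \<gamma> :: "real \<Rightarrow> 'a::euclidean_space"
  assumes T: "0 < T" and lim: "limitin (skorokhod_topology T) \<gamma>s \<gamma> sequentially"
  shows "(\<lambda>n. \<integral>\<^sup>+t\<in>{0..T}. ennreal (norm (\<gamma>s n t - \<gamma> t)) \<partial>lborel) \<longlonglongrightarrow> 0"
proof -
  have \<gamma>: "\<gamma> \<in> cadlag T" using lim limitin_skorokhod[OF T] by blast
  obtain B where B: "eventually (\<lambda>n. \<forall>t\<in>{0..T}. norm (\<gamma>s n t - \<gamma> t) \<le> B) sequentially"
    using skorokhod_limit_bounded[OF T lim] by blast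
  have "eventually (\<lambda>n. \<gamma>s n \<in> cadlag T) sequentially" using lim limitin_skorokhod[OF T] by blast
  from eventually_conj[OF this B] obtain N where N: "\<And>n. n \<ge> N \<Longrightarrow> \<gamma>s n \<in> cadlag T"
    "\<And>n t. n \<ge> N \<Longrightarrow> t \<in> {0..T} \<Longrightarrow> norm (\<gamma>s n t - \<gamma> t) \<le> B"
    by (metis (no_types, lifting) eventually_sequentially)
  \<comment> \<open>The bound and membership in \<open>cadlag T\<close> hold only eventually,
    whereas dominated convergence asks for every index; hence the shift by \<open>N\<close>.\<close>
  let ?u = "\<lambda>n t. ennreal (norm (\<gamma>s (n + N) t - \<gamma> t)) * indicator {0..T} t"
  have "(\<lambda>n. \<integral>\<^sup>+t. ?u n t \<partial>lborel) \<longlonglongrightarrow> (\<integral>\<^sup>+t. 0 \<partial>(lborel :: real measure))"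
  proof (rule nn_integral_dominated_convergence[where w = "\<lambda>t. ennreal B * indicator {0..T} t"])
    fix n
    have "(\<lambda>t. \<gamma>s (n + N) (max 0 (min T t)) - \<gamma> (max 0 (min T t))) \<in> borel_measurable lborel"
      using T N(1)[of "n + N"] \<gamma> by (intro borel_measurable_diff) (auto simp: cadlag_measurable_clamp)
    then have D: "(\<lambda>t. ennreal (norm (\<gamma>s (n + N) (max 0 (min T t)) - \<gamma> (max 0 (min T t))))) \<in> borel_measurable lborel"
      by (rule measurable_compose) measurable
    have "(\<lambda>t. ennreal (norm (\<gamma>s (n + N) (max 0 (min T t)) - \<gamma> (max 0 (min T t)))) * indicator {0..T} t) \<in> borel_measurable lborel"
      by (rule borel_measurable_times_ennreal[OF D]) simp
    also have "(\<lambda>t. ennreal (norm (\<gamma>s (n + N) (max 0 (min T t)) - \<gamma> (max 0 (min T t)))) * indicator {0..T} t) = ?u n"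
      by (auto simp: fun_eq_iff split: split_indicator)
    finally show "?u n \<in> borel_measurable lborel" .
    show "AE t in lborel. ?u n t \<le> ennreal B * indicator {0..T} t"
      using N(2)[of "n + N"] by (auto split: split_indicator intro!: ennreal_leI)
  next
    show "AE t in lborel. (\<lambda>n. ?u n t) \<longlonglongrightarrow> 0"
      using AE_isCont_cadlag[OF \<gamma>]
    proof eventually_elim
      case (elim t)
      show ?case
      proof (cases "t \<in> {0..T}")
        case True
        then have "(\<lambda>n. \<gamma>s n t) \<longlonglongrightarrow> \<gamma> t" using elim by (intro skorokhod_limit_at_continuity_point[OF T lim]) auto
        then have "(\<lambda>n. norm (\<gamma>s (n + N) t - \<gamma> t)) \<longlonglongrightarrow> 0"
          by (intro tendsto_norm_zero LIM_zero LIMSEQ_ignore_initial_segment)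
        then have "(\<lambda>n. ennreal (norm (\<gamma>s (n + N) t - \<gamma> t))) \<longlonglongrightarrow> ennreal 0" by (rule tendsto_ennrealI)
        then show ?thesis using True by simp
      qed simp
    qed
  qed (use T in \<open>auto simp: ennreal_mult_less_top nn_integral_cmult\<close>)
  then show ?thesis by (simp add: LIMSEQ_offset[of _ N])
qed

text \<open>Evaluation at \<open>s < T\<close> is not continuous, but it is the limit of the averages over
  \<open>[s, s + h]\<close>, which are continuous by convergence in \<open>L\<^sup>1\<close>.\<close>

lemma measurable_skorokhod_eval:
  assumes T: "0 < T" and s: "s \<in> {0..T}"
  shows "(\<lambda>\<gamma> :: real \<Rightarrow> 'a::euclidean_space. \<gamma> s) \<in> borel_measurable (borel_of (skorokhod_topology T))"
proof (cases "s = T")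
  case True
  \<comment> \<open>At \<open>T\<close> there is no interval to the right to average over, but
    evaluation is continuous there.\<close>
  have "continuous_map (skorokhod_topology T) euclidean (\<lambda>\<gamma> :: real \<Rightarrow> 'a. \<gamma> T)"
    by (rule continuous_map_sequentiallyI) (use skorokhod_limit_at_end[OF T] in auto)
  then show ?thesis using continuous_map_borel_of_measurable True by fastforce
next
  case False
  \<comment> \<open>The factor \<open>T - s\<close> keeps the averaging interval inside
    \<open>{0..T}\<close> for every \<open>n\<close>.\<close>
  define h where "h n = (T - s) / real (Suc n)" for n
  have sT: "s < T" "0 \<le> s" using s False by auto
  then have h: "h n > 0" for n unfolding h_def by auto
  have h_le: "s + h n \<le> T" for n
    using sT divide_left_mono[of 1 "real (Suc n)" "T - s"] unfolding h_def by auto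
  have h_lim: "h \<longlonglongrightarrow> 0"
    unfolding h_def divide_inverse by (rule tendsto_mult_right_zero[OF LIMSEQ_inverse_real_of_nat])
  show ?thesis
  proof (rule borel_measurable_LIMSEQ_metric)
    fix n
    have "continuous_map (skorokhod_topology T) euclidean (\<lambda>\<gamma> :: real \<Rightarrow> 'a. LINT u:{s..s + h n}|lborel. \<gamma> u)"
    proof (rule continuous_map_sequentiallyI)
      fix \<sigma> :: "nat \<Rightarrow> real \<Rightarrow> 'a" and \<gamma>
      assume \<sigma>: "range \<sigma> \<subseteq> mspace (skorokhod_metric T)" and lim: "limitin (skorokhod_topology T) \<sigma> \<gamma> sequentially"
      let ?A = "{s..s + h n}"
      have A: "?A \<subseteq> {0..T}" using sT h_le[of n] by auto
      have c: "\<sigma> i \<in> cadlag T" "\<gamma> \<in> cadlag T" for i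
        using \<sigma> T lim limitin_skorokhod[OF T] by auto
      have "(\<lambda>i. ennreal (norm ((LINT u:?A|lborel. \<sigma> i u) - (LINT u:?A|lborel. \<gamma> u)))) \<longlonglongrightarrow> ennreal 0"
      proof (rule tendsto_sandwich[OF _ _ tendsto_const])
        show "(\<lambda>i. \<integral>\<^sup>+t\<in>{0..T}. ennreal (norm (\<sigma> i t - \<gamma> t)) \<partial>lborel) \<longlonglongrightarrow> ennreal 0"
          using skorokhod_limit_L1[OF T lim] by simp
        have "ennreal (norm ((LINT u:?A|lborel. \<sigma> i u) - (LINT u:?A|lborel. \<gamma> u)))
          \<le> (\<integral>\<^sup>+t\<in>{0..T}. ennreal (norm (\<sigma> i t - \<gamma> t)) \<partial>lborel)" for i
        proof -
          note int = set_integrable_cadlag[OF c(1)[of i] _ A] set_integrable_cadlag[OF c(2) _ A]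
          have "(LINT u:?A|lborel. \<sigma> i u) - (LINT u:?A|lborel. \<gamma> u) = (LINT u:?A|lborel. \<sigma> i u - \<gamma> u)"
            using int by (intro set_integral_diff(2)[symmetric]) auto
          also have "ennreal (norm \<dots>) \<le> (\<integral>\<^sup>+t\<in>?A. ennreal (norm (\<sigma> i t - \<gamma> t)) \<partial>lborel)"
            using int by (intro norm_set_integral_le_nn set_integral_diff(1)) auto
          also have "\<dots> \<le> (\<integral>\<^sup>+t\<in>{0..T}. ennreal (norm (\<sigma> i t - \<gamma> t)) \<partial>lborel)"
            using A by (intro nn_integral_mono) (auto split: split_indicator)
          finally show ?thesis .
        qed
        then show "\<forall>\<^sub>F i in sequentially. ennreal (norm ((LINT u:?A|lborel. \<sigma> i u) - (LINT u:?A|lborel. \<gamma> u)))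
          \<le> (\<integral>\<^sup>+t\<in>{0..T}. ennreal (norm (\<sigma> i t - \<gamma> t)) \<partial>lborel)" by simp
      qed simp
      then have "(\<lambda>i. norm ((LINT u:?A|lborel. \<sigma> i u) - (LINT u:?A|lborel. \<gamma> u))) \<longlonglongrightarrow> 0"
        by (subst (asm) tendsto_ennreal_iff) auto
      then show "limitin euclidean (\<lambda>i. LINT u:?A|lborel. \<sigma> i u) (LINT u:?A|lborel. \<gamma> u) sequentially"
        by (simp add: LIM_zero_iff tendsto_norm_zero_iff)
    qed simp
    then have [measurable]: "(\<lambda>\<gamma> :: real \<Rightarrow> 'a. LINT u:{s..s + h n}|lborel. \<gamma> u) \<in> borel_measurable (borel_of (skorokhod_topology T))"
      using continuous_map_borel_of_measurable by fastforce
    show "(\<lambda>\<gamma> :: real \<Rightarrow> 'a. (1 / h n) *\<^sub>R (LINT u:{s..s + h n}|lborel. \<gamma> u)) \<in> borel_measurable (borel_of (skorokhod_topology T))"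
      by measurable
  next
    fix \<gamma> :: "real \<Rightarrow> 'a" assume "\<gamma> \<in> space (borel_of (skorokhod_topology T))"
    then have \<gamma>: "\<gamma> \<in> cadlag T" using T by simp
    show "(\<lambda>n. (1 / h n) *\<^sub>R (LINT u:{s..s + h n}|lborel. \<gamma> u)) \<longlonglongrightarrow> \<gamma> s"
    proof (rule tendstoI)
      fix e :: real assume e: "e > 0"
      have "eventually (\<lambda>u. dist (\<gamma> u) (\<gamma> s) < e / 2) (at_right s)"
        using cadlag_right[OF \<gamma>, of s] sT e by (intro tendstoD) auto
      then obtain c where c: "c > s" "\<And>u. u > s \<Longrightarrow> u < c \<Longrightarrow> dist (\<gamma> u) (\<gamma> s) < e / 2"
        by (auto simp: eventually_at_right_field)
      have "eventually (\<lambda>n. h n < c - s) sequentially" using order_tendstoD(2)[OF h_lim] c(1) by simp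
      then show "\<forall>\<^sub>F n in sequentially. dist ((1 / h n) *\<^sub>R (LINT u:{s..s + h n}|lborel. \<gamma> u)) (\<gamma> s) < e"
      proof eventually_elim
        case (elim n)
        let ?A = "{s..s + h n}"
        have A: "?A \<subseteq> {0..T}" using sT h_le[of n] by auto
        have cint: "set_integrable lborel ?A (\<lambda>_. \<gamma> s)" "set_integrable lborel ?A (\<lambda>_. e / 2)"
          by (auto intro!: borel_integrable_atLeastAtMost')
        have gint: "set_integrable lborel ?A \<gamma>" using set_integrable_cadlag[OF \<gamma> _ A] by simp
        have "(LINT u:?A|lborel. \<gamma> u) - h n *\<^sub>R \<gamma> s = (LINT u:?A|lborel. \<gamma> u - \<gamma> s)"
          using set_integral_diff(2)[OF gint cint(1)] h[of n] by (simp add: set_lebesgue_integral_def)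
        also have "norm \<dots> \<le> (LINT u:?A|lborel. norm (\<gamma> u - \<gamma> s))"
          by (rule set_integral_norm_bound[OF set_integral_diff(1)[OF gint cint(1)]])
        also have "\<dots> \<le> (LINT u:?A|lborel. e / 2)"
        proof (rule set_integral_mono[OF _ cint(2)])
          show "set_integrable lborel ?A (\<lambda>u. norm (\<gamma> u - \<gamma> s))"
            by (rule set_integrable_norm[OF set_integral_diff(1)[OF gint cint(1)]])
          fix u assume "u \<in> ?A"
          then show "norm (\<gamma> u - \<gamma> s) \<le> e / 2"
            using c(2)[of u] elim e by (cases "u = s") (auto simp: dist_norm)
        qed
        also have "\<dots> = h n * (e / 2)" using h[of n] by (simp add: set_lebesgue_integral_def)
        finally have "norm ((LINT u:?A|lborel. \<gamma> u) - h n *\<^sub>R \<gamma> s) \<le> h n * (e / 2)" .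
        then have "norm ((LINT u:?A|lborel. \<gamma> u) - h n *\<^sub>R \<gamma> s) / h n \<le> e / 2"
          using h[of n] by (subst pos_divide_le_eq) (auto simp: mult.commute)
        moreover have "(1 / h n) *\<^sub>R (LINT u:?A|lborel. \<gamma> u) - \<gamma> s = (1 / h n) *\<^sub>R ((LINT u:?A|lborel. \<gamma> u) - h n *\<^sub>R \<gamma> s)"
          using h[of n] by (simp add: scaleR_diff_right)
        ultimately have "norm ((1 / h n) *\<^sub>R (LINT u:?A|lborel. \<gamma> u) - \<gamma> s) \<le> e / 2"
          using h[of n] by simp
        then show ?case using e by (simp add: dist_norm)
      qed
    qed
  qed
qed

section \<open>Gronwall's inequality\<close>

text \<open>The supremum of \<open>exp (- 2 K t) u t\<close> is finite and at most \<open>a\<close> plus half of itself;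
  with lower integrals this needs no measurability of \<open>u\<close>.\<close>

lemma gronwall_nn:
  fixes u :: "real \<Rightarrow> ennreal"
  assumes K: "0 < K" and T: "0 \<le> T"
    and bound: "\<And>t. t \<in> {0..T} \<Longrightarrow> u t \<le> ennreal B"
    and ineq: "\<And>t. t \<in> {0..T} \<Longrightarrow> u t \<le> a + ennreal K * (\<integral>\<^sup>+s\<in>{0..t}. u s \<partial>lborel)"
    and t: "t \<in> {0..T}"
  shows "u t \<le> ennreal (2 * exp (2 * K * T)) * a"
proof -
  let ?E = "\<lambda>t. ennreal (exp (2 * K * t))" and ?I = "\<lambda>t. ennreal (exp (- (2 * K * t)))"
  have EI: "?E t * ?I t = 1" "?I t * ?E t = 1" for t
    by (simp_all flip: ennreal_mult exp_add)
  define m where "m = (SUP t\<in>{0..T}. ?I t * u t)"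
  have "m \<le> ennreal B"
    unfolding m_def
  proof (rule SUP_least)
    fix t assume t: "t \<in> {0..T}"
    have "?I t * u t \<le> 1 * ennreal B"
      using t K bound[OF t] by (intro mult_mono) (auto simp flip: ennreal_1 intro!: ennreal_leI)
    then show "?I t * u t \<le> ennreal B" by simp
  qed
  \<comment> \<open>The bound \<open>B\<close> serves only to make \<open>m\<close> finite, so that
    half of it can be absorbed below; it does not enter the final constant.\<close>
  then have m: "m < \<top>" using ennreal_less_top le_less_trans by blast
  have u_le: "u s \<le> m * ?E s" if "s \<in> {0..T}" for s
  proof -
    have "u s = (?I s * u s) * ?E s" by (metis EI(2) mult.assoc mult.commute mult.right_neutral)
    also have "\<dots> \<le> m * ?E s" unfolding m_def using that by (intro mult_right_mono SUP_upper) auto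
    finally show ?thesis .
  qed
  \<comment> \<open>The weight grows at rate \<open>2 * K\<close>, twice the constant of the
    inequality, so \<open>K\<close> times its integral up to \<open>t\<close> is at most half its
    value at \<open>t\<close>. This is the origin of the factor one half.\<close>
  have step: "?I t * u t \<le> a + m * ennreal (1 / 2)" if t: "t \<in> {0..T}" for t
  proof -
    have int: "(\<integral>\<^sup>+s\<in>{0..t}. ?E s \<partial>lborel) = ennreal ((exp (2 * K * t) - 1) / (2 * K))"
      using t K
      by (subst nn_integral_FTC_Icc[where F = "\<lambda>s. exp (2 * K * s) / (2 * K)"])
        (auto intro!: derivative_eq_intros simp: diff_divide_distrib)
    have "(\<integral>\<^sup>+s\<in>{0..t}. u s \<partial>lborel) \<le> (\<integral>\<^sup>+s. m * (?E s * indicator {0..t} s) \<partial>lborel)"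
      using t u_le by (intro nn_integral_mono) (auto split: split_indicator)
    also have "\<dots> = m * ennreal ((exp (2 * K * t) - 1) / (2 * K))"
      using int by (subst nn_integral_cmult) auto
    finally have "ennreal K * (\<integral>\<^sup>+s\<in>{0..t}. u s \<partial>lborel) \<le> ennreal K * (m * ennreal ((exp (2 * K * t) - 1) / (2 * K)))"
      by (rule mult_left_mono) simp
    also have "\<dots> = m * ennreal ((exp (2 * K * t) - 1) / 2)"
      using K t by (simp add: mult.left_commute flip: ennreal_mult)
    also have "\<dots> \<le> m * ennreal (exp (2 * K * t) / 2)"
      by (intro mult_left_mono ennreal_leI) auto
    finally have "u t \<le> a + m * ennreal (exp (2 * K * t) / 2)"
      using ineq[OF t] by (meson add_left_mono order_trans)
    then have "?I t * u t \<le> ?I t * a + ?I t * (m * ennreal (exp (2 * K * t) / 2))"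
      by (metis distrib_left mult_left_mono zero_le)
    also have "?I t * (m * ennreal (exp (2 * K * t) / 2)) = m * ennreal (exp (- (2 * K * t)) * (exp (2 * K * t) / 2))"
      by (simp add: mult.left_commute flip: ennreal_mult)
    also have "exp (- (2 * K * t)) * (exp (2 * K * t) / 2) = 1 / 2"
      by (simp flip: exp_add)
    also have "?I t * a \<le> 1 * a"
      using t K by (intro mult_right_mono) (auto simp flip: ennreal_1 intro!: ennreal_leI)
    finally show ?thesis by simp
  qed
  have le: "m \<le> a + m * ennreal (1 / 2)"
    by (subst m_def) (intro SUP_least step)
  have "m \<le> 2 * a"
  proof (cases "a = \<top>")
    case False
    then obtain a' where a': "a = ennreal a'" "0 \<le> a'" by (cases a) auto
    obtain m' where m': "m = ennreal m'" "0 \<le> m'" using m by (cases m) auto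
    have "m' \<le> a' + m' / 2"
      using le a' m' unfolding a'(1) m'(1) ennreal_mult[OF m'(2), of "1 / 2", symmetric, simplified]
      by (simp del: ennreal_half flip: ennreal_plus ennreal_mult)
    then show ?thesis using a' m' by (simp flip: ennreal_mult ennreal_numeral)
  qed (simp add: ennreal_mult_top)
  have "u t \<le> m * ?E t" by (rule u_le[OF t])
  also have "\<dots> \<le> (2 * a) * ?E T" using \<open>m \<le> 2 * a\<close> t K by (intro mult_mono ennreal_leI) auto
  also have "\<dots> = ennreal (2 * exp (2 * K * T)) * a"
    by (simp add: ennreal_mult' mult.assoc mult.left_commute mult.commute)
  finally show ?thesis .
qed

section \<open>Marginal laws of right-continuous processes\<close>

lemma admissible_metricD:
  assumes "admissible_metric E \<rho>"
  shows "mspace \<rho> = prob_measures (mtopology_of E)" "mtopology_of \<rho> = weak_topology (mtopology_of E)"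
  using assms by (auto simp: admissible_metric_def)

lemma prob_measures_euclidean_distr:
  assumes "prob_space M" "X \<in> borel_measurable M"
  shows "distr M borel X \<in> prob_measures euclidean"
  using prob_measures_distr[OF assms(1), of X euclidean] assms(2) by simp

lemma limitin_distr:
  fixes F :: "nat \<Rightarrow> 'b \<Rightarrow> 'a::{second_countable_topology, metric_space}"
  assumes M: "prob_space M" and meas: "\<And>n. F n \<in> borel_measurable M" "G \<in> borel_measurable M"
    and lim: "\<And>\<omega>. \<omega> \<in> space M \<Longrightarrow> (\<lambda>n. F n \<omega>) \<longlonglongrightarrow> G \<omega>"
  shows "limitin (weak_topology euclidean) (\<lambda>n. distr M borel (F n)) (distr M borel G) sequentially"
  unfolding limitin_weak_topology
proof (intro conjI allI impI)
  interpret prob_space M by (rule M)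
  show "distr M borel G \<in> prob_measures euclidean"
    by (intro prob_measures_euclidean_distr[OF M] meas)
  show "\<forall>\<^sub>F n in sequentially. distr M borel (F n) \<in> prob_measures euclidean"
    by (intro always_eventually allI prob_measures_euclidean_distr[OF M] meas)
  fix f :: "'a \<Rightarrow> real" assume f: "continuous_map euclidean euclidean f" "bounded (f ` topspace euclidean)"
  then have c: "continuous_on UNIV f" by simp
  then have [measurable]: "f \<in> borel_measurable borel" by (rule borel_measurable_continuous_onI)
  obtain B where B: "\<And>x. norm (f x) \<le> B" using f(2) by (auto simp: bounded_iff)
  note [measurable] = meas
  have "(\<lambda>n. \<integral>\<omega>. f (F n \<omega>) \<partial>M) \<longlonglongrightarrow> (\<integral>\<omega>. f (G \<omega>) \<partial>M)"
  proof (rule integral_dominated_convergence[where w = "\<lambda>_. B"])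
    show "AE \<omega> in M. (\<lambda>n. f (F n \<omega>)) \<longlonglongrightarrow> f (G \<omega>)"
      using lim c by (intro AE_I2 continuous_on_tendsto_compose[OF c]) auto
  qed (use B in auto)
  then show "(\<lambda>n. \<integral>x. f x \<partial>distr M borel (F n)) \<longlonglongrightarrow> (\<integral>x. f x \<partial>distr M borel G)"
    by (simp add: integral_distr)
qed

text \<open>Along a sequence of times decreasing to \<open>s\<close> the paths converge pointwise,
  hence in law, and the metric induces the weak topology.\<close>

lemma mdist_law_tendsto_right:
  fixes F :: "real \<Rightarrow> 'b \<Rightarrow> 'a::{second_countable_topology, metric_space}"
  assumes adm: "admissible_metric euclidean_metric \<rho>" and M: "prob_space M"
    and meas: "\<And>s. s \<in> {0..T} \<Longrightarrow> F s \<in> borel_measurable M"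
    and rc: "\<And>s \<omega>. s \<in> {0..<T} \<Longrightarrow> \<omega> \<in> space M \<Longrightarrow> ((\<lambda>u. F u \<omega>) \<longlongrightarrow> F s \<omega>) (at_right s)"
    and s: "s \<in> {0..<T}"
  shows "((\<lambda>u. mdist \<rho> (distr M borel (F u)) (distr M borel (F s))) \<longlongrightarrow> 0) (at_right s)"
proof (rule tendsto_at_right_sequentially[where b = T])
  show "s < T" using s by simp
  fix u :: "nat \<Rightarrow> real" assume u: "\<And>n. s < u n" "\<And>n. u n < T" "u \<longlonglongrightarrow> s"
  then have f: "filterlim u (at_right s) sequentially"
    by (auto simp: filterlim_at less_imp_neq[THEN not_sym] intro!: always_eventually)
  have "limitin (weak_topology euclidean) (\<lambda>n. distr M borel (F (u n))) (distr M borel (F s)) sequentially"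
  proof (rule limitin_distr[OF M])
    show "F (u n) \<in> borel_measurable M" for n using u(1,2)[of n] s by (intro meas) auto
    show "F s \<in> borel_measurable M" using s by (intro meas) auto
    show "(\<lambda>n. F (u n) \<omega>) \<longlonglongrightarrow> F s \<omega>" if "\<omega> \<in> space M" for \<omega>
      by (rule filterlim_compose[OF rc[OF s that] f])
  qed
  then show "(\<lambda>n. mdist \<rho> (distr M borel (F (u n))) (distr M borel (F s))) \<longlonglongrightarrow> 0"
    unfolding admissible_metricD(2)[OF adm, symmetric, simplified] limitin_mtopology_of by simp
qed

lemma mdist_diff_le:
  assumes "a \<in> mspace m" "a' \<in> mspace m" "c \<in> mspace m" "c' \<in> mspace m"
  shows "\<bar>mdist m a c - mdist m a' c'\<bar> \<le> mdist m a a' + mdist m c c'"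
  using mdist_triangle[of a m a' c] mdist_triangle[of a' m c' c] mdist_triangle[of a' m a c'] mdist_triangle[of a m c c']
    mdist_commute[of m a a'] mdist_commute[of m c c'] assms by (simp add: abs_le_iff)

text \<open>This serves measurability: a distance of two moving marginals that is right-continuous
  in time is Borel after clamping and can be integrated.\<close>

lemma mdist_laws_right_continuous:
  fixes F :: "real \<Rightarrow> 'b \<Rightarrow> 'a::{second_countable_topology, metric_space}" and G :: "real \<Rightarrow> 'c \<Rightarrow> 'a"
  assumes adm: "admissible_metric euclidean_metric \<rho>" and M: "prob_space M" and N: "prob_space N"
    and F: "\<And>s. s \<in> {0..T} \<Longrightarrow> F s \<in> borel_measurable M"
    and rF: "\<And>s \<omega>. s \<in> {0..<T} \<Longrightarrow> \<omega> \<in> space M \<Longrightarrow> ((\<lambda>u. F u \<omega>) \<longlongrightarrow> F s \<omega>) (at_right s)"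
    and G: "\<And>s. s \<in> {0..T} \<Longrightarrow> G s \<in> borel_measurable N"
    and rG: "\<And>s \<omega>. s \<in> {0..<T} \<Longrightarrow> \<omega> \<in> space N \<Longrightarrow> ((\<lambda>u. G u \<omega>) \<longlongrightarrow> G s \<omega>) (at_right s)"
    and s: "s \<in> {0..<T}"
  shows "((\<lambda>u. mdist \<rho> (distr M borel (F u)) (distr N borel (G u))) \<longlongrightarrow>
    mdist \<rho> (distr M borel (F s)) (distr N borel (G s))) (at_right s)"
proof -
  have P: "distr M borel (F u) \<in> mspace \<rho>" "distr N borel (G u) \<in> mspace \<rho>" if "u \<in> {0..T}" for u
    using prob_measures_euclidean_distr[OF M F[OF that]] prob_measures_euclidean_distr[OF N G[OF that]] adm
    by (simp_all add: admissible_metricD)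
  have "((\<lambda>u. mdist \<rho> (distr M borel (F u)) (distr M borel (F s)) + mdist \<rho> (distr N borel (G u)) (distr N borel (G s))) \<longlongrightarrow> 0) (at_right s)"
    using tendsto_add[OF mdist_law_tendsto_right[OF adm M F rF s] mdist_law_tendsto_right[OF adm N G rG s]] by simp
  moreover have "eventually (\<lambda>u. norm (mdist \<rho> (distr M borel (F u)) (distr N borel (G u)) - mdist \<rho> (distr M borel (F s)) (distr N borel (G s)))
     \<le> mdist \<rho> (distr M borel (F u)) (distr M borel (F s)) + mdist \<rho> (distr N borel (G u)) (distr N borel (G s))) (at_right s)"
  proof -
    have "eventually (\<lambda>u. u \<in> {s<..<T}) (at_right s)"
      using s by (intro eventually_at_rightI[of s T]) auto
    then show ?thesis
    proof eventually_elim
      case (elim u)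
      then have "u \<in> {0..T}" "s \<in> {0..T}" using s by auto
      then show ?case using mdist_diff_le P by (metis real_norm_def)
    qed
  qed
  ultimately have "((\<lambda>u. mdist \<rho> (distr M borel (F u)) (distr N borel (G u)) - mdist \<rho> (distr M borel (F s)) (distr N borel (G s))) \<longlongrightarrow> 0) (at_right s)"
    by (rule Lim_null_comparison[rotated])
  then show ?thesis by (simp add: LIM_zero_iff)
qed

section \<open>Comparison of solutions\<close>

text \<open>Gronwall's inequality for the difference of \<open>x - \<gamma>\<close> and
  \<open>x' - \<gamma>'\<close>, which contains no jumps. The drift sees \<open>x - x'\<close>, that
  is, this difference plus \<open>\<gamma> - \<gamma>'\<close>, so the inputs matter only through a
  time integral. The source \<open>g\<close> is 0 when the two solutions belong to the same law, and
  carries the distance of the marginals when they share the input.\<close>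

lemma solution_compare:
  fixes x x' \<gamma> \<gamma>' d d' :: "real \<Rightarrow> 'a::euclidean_space" and g :: "real \<Rightarrow> real"
  assumes K: "0 < K" and cadlag: "x \<in> cadlag T" "x' \<in> cadlag T" "\<gamma> \<in> cadlag T" "\<gamma>' \<in> cadlag T"
    and int: "set_integrable lborel {0..T} d" "set_integrable lborel {0..T} d'"
    and x: "\<And>s. s \<in> {0..T} \<Longrightarrow> x s = x0 + (LINT r:{0..s}|lborel. d r) + \<gamma> s"
    and x': "\<And>s. s \<in> {0..T} \<Longrightarrow> x' s = x0' + (LINT r:{0..s}|lborel. d' r) + \<gamma>' s"
    and dd: "\<And>s. s \<in> {0..T} \<Longrightarrow> norm (d s - d' s) \<le> K * norm (x s - x' s) + g s"
    and g: "g \<in> borel_measurable borel" "\<And>s. 0 \<le> g s"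
    and t: "t \<in> {0..T}"
  shows "ennreal (norm ((x t - \<gamma> t) - (x' t - \<gamma>' t))) \<le>
    ennreal (2 * exp (2 * K * T)) * (ennreal (norm (x0 - x0')) + (\<integral>\<^sup>+s\<in>{0..t}. ennreal (K * norm (\<gamma> s - \<gamma>' s) + g s) \<partial>lborel))"
    (is "?w t \<le> _ * ?a")
proof -
  let ?cl = "\<lambda>s. max 0 (min T s)"
  have T: "0 \<le> T" using t by auto
  note [measurable] = cadlag_measurable_clamp[OF cadlag(1) T] cadlag_measurable_clamp[OF cadlag(2) T]
    cadlag_measurable_clamp[OF cadlag(3) T] cadlag_measurable_clamp[OF cadlag(4) T] g(1)
  have bnd: "\<exists>B. \<forall>s\<in>{0..T}. norm (h s) \<le> B" if "h \<in> cadlag T" for h :: "real \<Rightarrow> 'a"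
    using cadlag_bounded[OF that] by metis
  obtain B1 B2 B3 B4 where B: "\<forall>s\<in>{0..T}. norm (x s) \<le> B1" "\<forall>s\<in>{0..T}. norm (x' s) \<le> B2"
      "\<forall>s\<in>{0..T}. norm (\<gamma> s) \<le> B3" "\<forall>s\<in>{0..T}. norm (\<gamma>' s) \<le> B4"
    using bnd[OF cadlag(1)] bnd[OF cadlag(2)] bnd[OF cadlag(3)] bnd[OF cadlag(4)] by blast
  \<comment> \<open>Gronwall's inequality is applied on \<open>{0..t}\<close>, so that the source is
    integrated only up to \<open>t\<close>. In \<open>solution_stability\<close> this integral, as a
    function of its upper limit, satisfies a Gronwall inequality of its own.\<close>
  have "?w t \<le> ennreal (2 * exp (2 * K * t)) * ?a"
  proof (rule gronwall_nn[where B = "B1 + B2 + B3 + B4" and u = ?w])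
    fix s assume s: "s \<in> {0..t}"
    then have sT: "s \<in> {0..T}" using t by auto
    have "norm ((x s - \<gamma> s) - (x' s - \<gamma>' s)) \<le> (norm (x s) + norm (\<gamma> s)) + (norm (x' s) + norm (\<gamma>' s))"
      by (intro order_trans[OF norm_triangle_ineq4] add_mono norm_triangle_ineq4)
    then show "?w s \<le> ennreal (B1 + B2 + B3 + B4)"
      using B[THEN bspec, OF sT] by (intro ennreal_leI) linarith
    have sub: "set_integrable lborel {0..s} d" "set_integrable lborel {0..s} d'"
      using sT by (auto intro: set_integrable_subset[OF int(1)] set_integrable_subset[OF int(2)])
    have "(x s - \<gamma> s) - (x' s - \<gamma>' s) = (x0 - x0') + (LINT r:{0..s}|lborel. d r - d' r)"
      using x[OF sT] x'[OF sT] set_integral_diff(2)[OF sub] by simp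
    then have "?w s \<le> ennreal (norm (x0 - x0') + norm (LINT r:{0..s}|lborel. d r - d' r))"
      by (metis ennreal_leI norm_triangle_ineq)
    also have "\<dots> = ennreal (norm (x0 - x0')) + ennreal (norm (LINT r:{0..s}|lborel. d r - d' r))"
      by simp
    also have "\<dots> \<le> ennreal (norm (x0 - x0')) + (\<integral>\<^sup>+r\<in>{0..s}. ennreal (norm (d r - d' r)) \<partial>lborel)"
      by (intro add_left_mono norm_set_integral_le_nn set_integral_diff(1)[OF sub])
    also have "(\<integral>\<^sup>+r\<in>{0..s}. ennreal (norm (d r - d' r)) \<partial>lborel) \<le>
      (\<integral>\<^sup>+r. ennreal K * (?w (?cl r) * indicator {0..s} r) + ennreal (K * norm (\<gamma> (?cl r) - \<gamma>' (?cl r)) + g r) * indicator {0..s} r \<partial>lborel)"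
    proof (rule nn_integral_mono)
      fix r
      show "ennreal (norm (d r - d' r)) * indicator {0..s} r \<le>
        ennreal K * (?w (?cl r) * indicator {0..s} r) + ennreal (K * norm (\<gamma> (?cl r) - \<gamma>' (?cl r)) + g r) * indicator {0..s} r"
      proof (cases "r \<in> {0..s}")
        case True
        then have r: "r \<in> {0..T}" "?cl r = r" using sT by auto
        have "norm (x r - x' r) \<le> norm ((x r - \<gamma> r) - (x' r - \<gamma>' r)) + norm (\<gamma> r - \<gamma>' r)"
          using norm_triangle_ineq[of "(x r - \<gamma> r) - (x' r - \<gamma>' r)" "\<gamma> r - \<gamma>' r"] by simp
        then have "K * norm (x r - x' r) \<le> K * (norm ((x r - \<gamma> r) - (x' r - \<gamma>' r)) + norm (\<gamma> r - \<gamma>' r))"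
          using K by (intro mult_left_mono) auto
        then have "norm (d r - d' r) \<le> K * norm ((x r - \<gamma> r) - (x' r - \<gamma>' r)) + (K * norm (\<gamma> r - \<gamma>' r) + g r)"
          using dd[OF r(1)] by (simp add: algebra_simps)
        then have "ennreal (norm (d r - d' r)) \<le> ennreal (K * norm ((x r - \<gamma> r) - (x' r - \<gamma>' r)) + (K * norm (\<gamma> r - \<gamma>' r) + g r))"
          by (rule ennreal_leI)
        also have "\<dots> = ennreal K * ?w r + ennreal (K * norm (\<gamma> r - \<gamma>' r) + g r)"
          using K g(2)[of r] by (subst ennreal_plus) (auto simp: ennreal_mult)
        finally show ?thesis using True unfolding r(2) by simp
      qed simp
    qed
    also have "\<dots> = ennreal K * (\<integral>\<^sup>+r. ?w (?cl r) * indicator {0..s} r \<partial>lborel)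
        + (\<integral>\<^sup>+r. ennreal (K * norm (\<gamma> (?cl r) - \<gamma>' (?cl r)) + g r) * indicator {0..s} r \<partial>lborel)"
      by (subst nn_integral_add) (simp_all add: nn_integral_cmult)
    also have "(\<integral>\<^sup>+r. ?w (?cl r) * indicator {0..s} r \<partial>lborel) = (\<integral>\<^sup>+r\<in>{0..s}. ?w r \<partial>lborel)"
      using sT by (intro nn_integral_cong) (auto split: split_indicator)
    also have "(\<integral>\<^sup>+r. ennreal (K * norm (\<gamma> (?cl r) - \<gamma>' (?cl r)) + g r) * indicator {0..s} r \<partial>lborel)
      \<le> (\<integral>\<^sup>+s\<in>{0..t}. ennreal (K * norm (\<gamma> s - \<gamma>' s) + g s) \<partial>lborel)"
      using s t by (intro nn_integral_mono) (auto split: split_indicator)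
    finally show "?w s \<le> ?a + ennreal K * (\<integral>\<^sup>+r\<in>{0..s}. ?w r \<partial>lborel)"
      by (simp add: add_left_mono add_ac)
  qed (use K t in auto)
  also have "\<dots> \<le> ennreal (2 * exp (2 * K * T)) * ?a"
    using K t by (intro mult_right_mono ennreal_leI) auto
  finally show ?thesis .
qed

section \<open>The solution map for a fixed input law\<close>

lemma topspace_input_topology:
  "0 < T \<Longrightarrow> topspace (input_topology T :: ('a::real_normed_vector \<times> (real \<Rightarrow> 'a)) topology) = UNIV \<times> cadlag T"
  by (simp add: input_topology_def)

lemma limitin_input_topologyD:
  assumes "limitin (input_topology T) \<omega>s \<omega> F"
  shows "((\<lambda>n. fst (\<omega>s n)) \<longlongrightarrow> fst \<omega>) F" "limitin (skorokhod_topology T) (\<lambda>n. snd (\<omega>s n)) (snd \<omega>) F"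
  using assms by (simp_all add: input_topology_def limitin_pairwise comp_def)

lemma measurable_input_eval:
  assumes "0 < T" "s \<in> {0..T}"
  shows "(\<lambda>\<omega> :: 'a::euclidean_space \<times> (real \<Rightarrow> 'a). snd \<omega> s) \<in> borel_measurable (borel_of (input_topology T))"
proof (rule measurable_compose[OF _ measurable_skorokhod_eval[OF assms]])
  show "snd \<in> borel_of (input_topology T) \<rightarrow>\<^sub>M borel_of (skorokhod_topology T)"
    unfolding input_topology_def by (intro continuous_map_borel_of_measurable continuous_map_snd)
qed

lemma filterlim_at_left_shift: "filterlim (\<lambda>n. s - 1 / real (Suc n)) (at_left s) sequentially"
proof -
  have "(\<lambda>n. s - 1 / real (Suc n)) \<longlonglongrightarrow> s - 0"
    by (intro tendsto_diff tendsto_const) (use LIMSEQ_inverse_real_of_nat in \<open>simp add: inverse_eq_divide\<close>)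
  then show ?thesis by (auto simp: filterlim_at)
qed

text \<open>With countable quantifiers only, convergence of measurable functions visibly defines a
  measurable set.\<close>

lemma LIMSEQ_iff_inverse_Suc:
  fixes X :: "nat \<Rightarrow> 'a::metric_space"
  shows "X \<longlonglongrightarrow> L \<longleftrightarrow> (\<forall>i. \<exists>N. \<forall>n\<ge>N. dist (X n) L < inverse (real (Suc i)))" (is "_ \<longleftrightarrow> ?R")
proof
  assume R: ?R
  show "X \<longlonglongrightarrow> L" unfolding lim_sequentially
  proof (intro allI impI)
    fix r :: real assume "0 < r"
    then obtain i where i: "inverse (real (Suc i)) < r" using reals_Archimedean by blast
    obtain N where N: "\<forall>n\<ge>N. dist (X n) L < inverse (real (Suc i))" using R by blast
    show "\<exists>N. \<forall>n\<ge>N. dist (X n) L < r"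
      by (rule exI[of _ N]) (use N i less_trans in blast)
  qed
qed (simp add: lim_sequentially)

text \<open>Fubini turns ``every path is continuous at almost every time'' into ``at almost every time,
  almost every path is continuous''; for a jointly measurable criterion, continuity at \<open>s\<close> of a
  path with left limits is tested along \<open>s - 1 / Suc n\<close> only.\<close>

lemma AE_input_isCont:
  fixes \<nu> :: "('a::euclidean_space \<times> (real \<Rightarrow> 'a)) measure"
  assumes T: "0 < T" and \<nu>: "\<nu> \<in> prob_measures (input_topology T)"
  shows "AE s in lborel. s \<in> {0..T} \<longrightarrow> s \<in> {0<..<T} \<and> (AE \<omega> in \<nu>. isCont (snd \<omega>) s)"
proof -
  note nu = prob_measuresD[OF \<nu>]
  interpret prob_space \<nu> by (rule nu(1))
  interpret pair_sigma_finite lborel \<nu> ..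
  define cl where "cl = (\<lambda>s. max 0 (min T s))"
  \<comment> \<open>The clamp keeps the finitely many early times \<open>s - 1 / Suc n\<close> that
    are negative inside the interval.\<close>
  define P where "P = (\<lambda>s (\<omega> :: 'a \<times> (real \<Rightarrow> 'a)). s \<in> {0<..<T} \<longrightarrow> (\<lambda>n. snd \<omega> (cl (s - 1 / real (Suc n)))) \<longlonglongrightarrow> snd \<omega> (cl s))"
  have sp: "snd \<omega> \<in> cadlag T" if "\<omega> \<in> space \<nu>" for \<omega>
    using that nu(3) topspace_input_topology[OF T, where 'a = 'a] by auto
  have "(\<lambda>(s, \<omega>). snd \<omega> (max 0 (min T s))) \<in> borel_measurable (borel \<Otimes>\<^sub>M \<nu>)"
  proof (rule right_continuous_measurable_pair)
    show "(\<lambda>\<omega>. snd \<omega> s) \<in> borel_measurable \<nu>" if "s \<in> {0..T}" for s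
      using measurable_input_eval[OF T that] nu(2) by (simp cong: measurable_cong_sets)
  qed (use T in \<open>auto intro: cadlag_right[OF sp] less_imp_le\<close>)
  then have ev: "(\<lambda>p. snd (snd p) (cl (fst p))) \<in> borel_measurable (lborel \<Otimes>\<^sub>M \<nu>)"
    by (simp add: cl_def case_prod_beta' cong: measurable_cong_sets)
  have ev': "(\<lambda>p. snd (snd p) (cl (fst p - 1 / real (Suc n)))) \<in> borel_measurable (lborel \<Otimes>\<^sub>M \<nu>)" for n
  proof -
    have "(\<lambda>p. (fst p - 1 / real (Suc n), snd p)) \<in> lborel \<Otimes>\<^sub>M \<nu> \<rightarrow>\<^sub>M lborel \<Otimes>\<^sub>M \<nu>" by measurable
    from measurable_compose[OF this ev] show ?thesis by simp
  qed
  have "{p \<in> space (lborel \<Otimes>\<^sub>M \<nu>). P (fst p) (snd p)} \<in> sets (lborel \<Otimes>\<^sub>M \<nu>)"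
  proof -
    define D where "D n p = dist (snd (snd p) (cl (fst p - 1 / real (Suc n)))) (snd (snd p) (cl (fst p)))"
      for n :: nat and p :: "real \<times> 'a \<times> (real \<Rightarrow> 'a)"
    have [measurable]: "D n \<in> borel_measurable (lborel \<Otimes>\<^sub>M \<nu>)" for n
      unfolding D_def by (intro borel_measurable_dist ev ev')
    have "P (fst p) (snd p) \<longleftrightarrow> (fst p \<in> {0<..<T} \<longrightarrow> (\<forall>i. \<exists>N. \<forall>n\<ge>N. D n p < inverse (real (Suc i))))" for p
      unfolding P_def LIMSEQ_iff_inverse_Suc D_def ..
    then show ?thesis by (simp only:) measurable
  qed
  note commute = AE_commute[OF this]
  have "AE \<omega> in \<nu>. AE s in lborel. P s \<omega>"
  proof (rule AE_I2)
    fix \<omega> assume "\<omega> \<in> space \<nu>"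
    from AE_isCont_cadlag[OF sp[OF this]] show "AE s in lborel. P s \<omega>"
    proof eventually_elim
      case (elim s)
      show ?case unfolding P_def
      proof
        assume s: "s \<in> {0<..<T}"
        then have "isCont (snd \<omega>) s" using elim by auto
        moreover have "(\<lambda>n. cl (s - 1 / real (Suc n))) \<longlonglongrightarrow> s"
        proof -
          have "(\<lambda>n. s - 1 / real (Suc n)) \<longlonglongrightarrow> s"
            using filterlim_at_left_shift[of s] by (simp add: filterlim_at)
          then have "(\<lambda>n. cl (s - 1 / real (Suc n))) \<longlonglongrightarrow> cl s" unfolding cl_def by (intro tendsto_intros)
          then show ?thesis using s by (simp add: cl_def)
        qed
        ultimately have "(\<lambda>n. snd \<omega> (cl (s - 1 / real (Suc n)))) \<longlonglongrightarrow> snd \<omega> s"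
          by (rule isCont_tendsto_compose)
        then show "(\<lambda>n. snd \<omega> (cl (s - 1 / real (Suc n)))) \<longlonglongrightarrow> snd \<omega> (cl s)" using s by (simp add: cl_def)
      qed
    qed
  qed
  then have "AE s in lborel. AE \<omega> in \<nu>. P s \<omega>" using commute by simp
  moreover have "AE s in lborel. s \<noteq> 0 \<and> s \<noteq> T" by (intro AE_conjI AE_lborel_singleton)
  ultimately show ?thesis
  proof eventually_elim
    case (elim s)
    show ?case
    proof (intro impI conjI)
      assume "s \<in> {0..T}"
      then show s: "s \<in> {0<..<T}" using elim(2) by auto
      show "AE \<omega> in \<nu>. isCont (snd \<omega>) s"
        using elim(1) AE_space
      proof eventually_elim
        case (elim \<omega>)
        have g: "snd \<omega> \<in> cadlag T" using elim(2) by (rule sp)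
        \<comment> \<open>Since a left limit exists, the single test sequence identifies it with the
          value at \<open>s\<close>; right continuity supplies the other side.\<close>
        obtain l where l: "(snd \<omega> \<longlongrightarrow> l) (at_left s)" using cadlag_left[OF g, of s] s by auto
        have "eventually (\<lambda>n. cl (s - 1 / real (Suc n)) = s - 1 / real (Suc n)) sequentially"
        proof -
          have "(\<lambda>n. s - 1 / real (Suc n)) \<longlonglongrightarrow> s"
            using filterlim_at_left_shift[of s] by (simp add: filterlim_at)
          then have "eventually (\<lambda>n. 0 < s - 1 / real (Suc n)) sequentially" using s by (intro order_tendstoD) auto
          then show ?thesis
          proof eventually_elim
            case (elim n)
            have "s - 1 / real (Suc n) \<le> s" by simp
            then have "s - 1 / real (Suc n) \<le> T" using s by (meson greaterThanLessThan_iff less_imp_le order_trans)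
            then show ?case using elim by (simp add: cl_def)
          qed
        qed
        then have "eventually (\<lambda>n. snd \<omega> (cl (s - 1 / real (Suc n))) = snd \<omega> (s - 1 / real (Suc n))) sequentially"
          by eventually_elim simp
        then have "(\<lambda>n. snd \<omega> (s - 1 / real (Suc n))) \<longlonglongrightarrow> snd \<omega> s"
          using elim(1) s tendsto_cong by (fastforce simp: P_def cl_def)
        moreover have "(\<lambda>n. snd \<omega> (s - 1 / real (Suc n))) \<longlonglongrightarrow> l"
          by (rule filterlim_compose[OF l filterlim_at_left_shift])
        ultimately have "l = snd \<omega> s" by (rule LIMSEQ_unique[symmetric])
        then show "isCont (snd \<omega>) s"
          unfolding isCont_def using l cadlag_right[OF g, of s] s by (intro filterlim_split_at) auto
      qed
    qed
  qed
qed

section \<open>Continuity of the solution in its input\<close>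

locale mckean_vlasov_drift =
  fixes T K :: real
    and \<rho>\<^sub>R :: "'a::euclidean_space measure metric"
    and b :: "'a \<times> 'a measure \<Rightarrow> 'a"
  assumes T: "0 < T" and K: "0 < K"
    and adm: "admissible_metric euclidean_metric \<rho>\<^sub>R"
    and lip: "\<And>x x' \<mu> \<mu>'. \<mu> \<in> prob_measures euclidean \<Longrightarrow> \<mu>' \<in> prob_measures euclidean \<Longrightarrow>
           norm (b (x, \<mu>) - b (x', \<mu>')) \<le> K * (norm (x - x') + mdist \<rho>\<^sub>R \<mu> \<mu>')"
    and bdd: "\<And>x \<mu>. \<mu> \<in> prob_measures euclidean \<Longrightarrow> norm (b (x, \<mu>)) \<le> K"
begin

text \<open>The factor with which \<open>solution_compare\<close> controls paths by their
  data.\<close>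

definition gronwall_const :: real where "gronwall_const = 2 * exp (2 * K * T)"

lemma gronwall_const_pos: "0 < gronwall_const" by (simp add: gronwall_const_def)

end

locale mckean_vlasov_solution = mckean_vlasov_drift T K \<rho>\<^sub>R b
  for T K :: real and \<rho>\<^sub>R :: "'a::euclidean_space measure metric" and b :: "'a \<times> 'a measure \<Rightarrow> 'a" +
  fixes \<nu> :: "('a \<times> (real \<Rightarrow> 'a)) measure" and S :: "'a \<times> (real \<Rightarrow> 'a) \<Rightarrow> real \<Rightarrow> 'a"
  assumes \<nu>: "\<nu> \<in> prob_measures (input_topology T)" and S: "is_solution_map b T \<nu> S"
begin

definition law :: "real \<Rightarrow> 'a measure" where "law s = distr \<nu> borel (\<lambda>\<omega>. S \<omega> s)"

definition drift :: "'a \<times> (real \<Rightarrow> 'a) \<Rightarrow> real \<Rightarrow> 'a" where "drift \<omega> s = b (S \<omega> s, law s)"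

lemma S_measurable: "S \<in> borel_of (input_topology T) \<rightarrow>\<^sub>M borel_of (skorokhod_topology T)"
  using S by (simp add: is_solution_map_def)

lemma S_cadlag: "snd \<omega> \<in> cadlag T \<Longrightarrow> S \<omega> \<in> cadlag T"
  using measurable_space[OF S_measurable, of \<omega>] T by (cases \<omega>) (auto simp: topspace_input_topology)

lemma S_eval_measurable:
  "s \<in> {0..T} \<Longrightarrow> (\<lambda>\<omega>. S \<omega> s) \<in> borel_measurable (borel_of (input_topology T))"
  using measurable_compose[OF S_measurable measurable_skorokhod_eval[OF T]] by simp

lemma S_eval_measurable':
  assumes "\<nu>' \<in> prob_measures (input_topology T)" "s \<in> {0..T}"
  shows "(\<lambda>\<omega>. S \<omega> s) \<in> borel_measurable \<nu>'"
  using S_eval_measurable[OF assms(2)] prob_measuresD(2)[OF assms(1)] by (simp cong: measurable_cong_sets)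

lemma S_measurable':
  assumes "\<nu>' \<in> prob_measures (input_topology T)"
  shows "S \<in> \<nu>' \<rightarrow>\<^sub>M borel_of (skorokhod_topology T)"
  using S_measurable prob_measuresD(2)[OF assms(1)] by (simp cong: measurable_cong_sets)

lemma S_right_continuous:
  assumes "\<nu>' \<in> prob_measures (input_topology T)" "s \<in> {0..<T}" "\<omega> \<in> space \<nu>'"
  shows "((\<lambda>u. S \<omega> u) \<longlongrightarrow> S \<omega> s) (at_right s)"
proof (rule cadlag_right[OF S_cadlag assms(2)])
  show "snd \<omega> \<in> cadlag T"
    using assms(3) unfolding prob_measuresD(3)[OF assms(1)] topspace_input_topology[OF T] by (simp add: mem_Times_iff)
qed

lemma law_prob: "\<nu>' \<in> prob_measures (input_topology T) \<Longrightarrow> s \<in> {0..T} \<Longrightarrow> distr \<nu>' borel (\<lambda>\<omega>. S \<omega> s) \<in> prob_measures euclidean"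
  by (intro prob_measures_euclidean_distr S_eval_measurable' prob_measuresD)

lemma drift_bound: "s \<in> {0..T} \<Longrightarrow> norm (drift \<omega> s) \<le> K"
  unfolding drift_def law_def by (intro bdd law_prob \<nu>)

lemma drift_integrable: "snd \<omega> \<in> cadlag T \<Longrightarrow> set_integrable lborel {0..T} (drift \<omega>)"
  using S by (cases \<omega>) (auto simp: is_solution_map_def Let_def drift_def[abs_def] law_def)

lemma S_eq:
  "snd \<omega> \<in> cadlag T \<Longrightarrow> t \<in> {0..T} \<Longrightarrow> S \<omega> t = fst \<omega> + (LINT s:{0..t}|lborel. drift \<omega> s) + snd \<omega> t"
  using S by (cases \<omega>) (auto simp: is_solution_map_def Let_def drift_def[abs_def] law_def)

text \<open>The difference is the integral of a drift bounded by \<open>K\<close>. It therefore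
  moves little under a small time change, although the solution itself may jump.\<close>

lemma S_minus_input_lipschitz:
  assumes \<omega>: "snd \<omega> \<in> cadlag T" and st: "s \<in> {0..T}" "t \<in> {0..T}"
  shows "norm ((S \<omega> t - snd \<omega> t) - (S \<omega> s - snd \<omega> s)) \<le> K * \<bar>t - s\<bar>"
proof -
  have le: "norm ((S \<omega> t - snd \<omega> t) - (S \<omega> s - snd \<omega> s)) \<le> K * (t - s)"
    if st: "s \<in> {0..T}" "t \<in> {0..T}" "s \<le> t" for s t
  proof -
    have sub: "set_integrable lborel A (drift \<omega>)" if "A \<subseteq> {0..T}" "A \<in> sets borel" for A
      using that by (auto intro: set_integrable_subset[OF drift_integrable[OF \<omega>]])
    have "{0..t} = {0..s} \<union> {s<..t}" using st by auto
    then have "(LINT r:{0..t}|lborel. drift \<omega> r) = (LINT r:{0..s}|lborel. drift \<omega> r) + (LINT r:{s<..t}|lborel. drift \<omega> r)"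
      using st by (simp only:) (intro set_integral_Un sub; auto)
    then have "(S \<omega> t - snd \<omega> t) - (S \<omega> s - snd \<omega> s) = (LINT r:{s<..t}|lborel. drift \<omega> r)"
      using S_eq[OF \<omega> st(1)] S_eq[OF \<omega> st(2)] by simp
    then have "ennreal (norm ((S \<omega> t - snd \<omega> t) - (S \<omega> s - snd \<omega> s))) \<le> (\<integral>\<^sup>+r\<in>{s<..t}. ennreal (norm (drift \<omega> r)) \<partial>lborel)"
      using st by (simp only:) (intro norm_set_integral_le_nn sub; auto)
    also have "\<dots> \<le> (\<integral>\<^sup>+r\<in>{s<..t}. ennreal K \<partial>lborel)"
      using st drift_bound[of _ \<omega>] by (intro nn_integral_mono) (auto split: split_indicator intro!: ennreal_leI)
    also have "\<dots> = ennreal (K * (t - s))"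
      using st K by (simp add: nn_integral_cmult ennreal_mult)
    finally show ?thesis using st K by (subst (asm) ennreal_le_iff) auto
  qed
  show ?thesis
  proof (cases "s \<le> t")
    case True then show ?thesis using le[OF st] by simp
  next
    case False then show ?thesis using le[OF st(2,1)] by (simp add: norm_minus_commute)
  qed
qed

text \<open>The conclusion is uniform in time although the inputs need not converge uniformly: they
  enter only through \<open>skorokhod_limit_L1\<close>.\<close>

lemma S_minus_input_limit:
  assumes lim: "limitin (input_topology T) \<omega>s \<omega> sequentially" and e: "0 < e"
  shows "eventually (\<lambda>n. \<forall>t\<in>{0..T}. norm ((S (\<omega>s n) t - snd (\<omega>s n) t) - (S \<omega> t - snd \<omega> t)) \<le> e) sequentially"
proof -
  note lims = limitin_input_topologyD[OF lim]
  have c: "snd \<omega> \<in> cadlag T" "eventually (\<lambda>n. snd (\<omega>s n) \<in> cadlag T) sequentially"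
    using lims(2)[unfolded limitin_skorokhod[OF T]] by blast+
  let ?I = "\<lambda>n. \<integral>\<^sup>+t\<in>{0..T}. ennreal (norm (snd (\<omega>s n) t - snd \<omega> t)) \<partial>lborel"
  have "(\<lambda>n. norm (fst (\<omega>s n) - fst \<omega>)) \<longlonglongrightarrow> 0" using lims(1) by (intro tendsto_norm_zero LIM_zero)
  then have "(\<lambda>n. ennreal gronwall_const * (ennreal (norm (fst (\<omega>s n) - fst \<omega>)) + ennreal K * ?I n)) \<longlonglongrightarrow> ennreal gronwall_const * (ennreal 0 + ennreal K * 0)"
    by (intro tendsto_intros ennreal_tendsto_cmult skorokhod_limit_L1[OF T lims(2)]) auto
  then have "eventually (\<lambda>n. ennreal gronwall_const * (ennreal (norm (fst (\<omega>s n) - fst \<omega>)) + ennreal K * ?I n) < ennreal e) sequentially"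
    using e by (intro order_tendstoD(2)) auto
  then show ?thesis using c(2)
  proof eventually_elim
    case (elim n)
    show ?case
    proof
      fix t assume t: "t \<in> {0..T}"
      have "ennreal (norm ((S (\<omega>s n) t - snd (\<omega>s n) t) - (S \<omega> t - snd \<omega> t))) \<le>
        ennreal gronwall_const * (ennreal (norm (fst (\<omega>s n) - fst \<omega>)) + (\<integral>\<^sup>+s\<in>{0..t}. ennreal (K * norm (snd (\<omega>s n) s - snd \<omega> s) + 0) \<partial>lborel))"
        unfolding gronwall_const_def
      proof (rule solution_compare[where d = "drift (\<omega>s n)" and d' = "drift \<omega>"])
        \<comment> \<open>Both drifts contain the same \<open>law s\<close>, so the distance in the
          measure argument vanishes and the source term is 0.\<close>
        fix s assume "s \<in> {0..T}"
        then show "norm (drift (\<omega>s n) s - drift \<omega> s) \<le> K * norm (S (\<omega>s n) s - S \<omega> s) + 0"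
          using lip[OF law_prob[OF \<nu>] law_prob[OF \<nu>], of s s "S (\<omega>s n) s" "S \<omega> s"]
            mdist_zero[of "law s" \<rho>\<^sub>R "law s", THEN iffD2, OF _ _ refl] law_prob[OF \<nu>, of s]
          by (simp only: drift_def law_def admissible_metricD(1)[OF adm] mtopology_of_euclidean add_0_right)
      qed (use K c(1) elim t in \<open>auto intro: S_cadlag drift_integrable S_eq\<close>)
      also have "(\<integral>\<^sup>+s\<in>{0..t}. ennreal (K * norm (snd (\<omega>s n) s - snd \<omega> s) + 0) \<partial>lborel)
          \<le> (\<integral>\<^sup>+s. ennreal (K * norm (snd (\<omega>s n) (max 0 (min T s)) - snd \<omega> (max 0 (min T s)))) * indicator {0..T} s \<partial>lborel)"
        using t by (intro nn_integral_mono) (auto split: split_indicator)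
      also have "\<dots> = ennreal K * ?I n"
      proof -
        note [measurable] = cadlag_measurable_clamp[OF elim(2) less_imp_le[OF T]] cadlag_measurable_clamp[OF c(1) less_imp_le[OF T]]
        have "(\<integral>\<^sup>+s. ennreal (K * norm (snd (\<omega>s n) (max 0 (min T s)) - snd \<omega> (max 0 (min T s)))) * indicator {0..T} s \<partial>lborel)
          = (\<integral>\<^sup>+s. ennreal K * (ennreal (norm (snd (\<omega>s n) (max 0 (min T s)) - snd \<omega> (max 0 (min T s)))) * indicator {0..T} s) \<partial>lborel)"
          using K by (intro nn_integral_cong) (simp add: ennreal_mult mult.assoc)
        also have "\<dots> = ennreal K * (\<integral>\<^sup>+s. (ennreal (norm (snd (\<omega>s n) (max 0 (min T s)) - snd \<omega> (max 0 (min T s)))) * indicator {0..T} s) \<partial>lborel)"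
          by (rule nn_integral_cmult) measurable
        also have "(\<integral>\<^sup>+s. (ennreal (norm (snd (\<omega>s n) (max 0 (min T s)) - snd \<omega> (max 0 (min T s)))) * indicator {0..T} s) \<partial>lborel) = ?I n"
          by (intro nn_integral_cong) (auto split: split_indicator)
        finally show ?thesis .
      qed
      finally have "ennreal (norm ((S (\<omega>s n) t - snd (\<omega>s n) t) - (S \<omega> t - snd \<omega> t))) \<le> ennreal e"
        using elim(1) by (auto simp: mult_left_mono add_left_mono intro: order_trans)
      then show "norm ((S (\<omega>s n) t - snd (\<omega>s n) t) - (S \<omega> t - snd \<omega> t)) \<le> e" using e by simp
    qed
  qed
qed

text \<open>The time change that aligns the inputs also aligns the solutions: the differences
  between solution and input converge uniformly, and the limiting difference is Lipschitz.\<close>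

lemma S_limit:
  assumes lim: "limitin (input_topology T) \<omega>s \<omega> sequentially"
  shows "limitin (skorokhod_topology T) (\<lambda>n. S (\<omega>s n)) (S \<omega>) sequentially"
  unfolding limitin_skorokhod[OF T]
proof (intro conjI allI impI)
  note lims = limitin_input_topologyD[OF lim]
  have c: "snd \<omega> \<in> cadlag T" "eventually (\<lambda>n. snd (\<omega>s n) \<in> cadlag T) sequentially"
    using lims(2)[unfolded limitin_skorokhod[OF T]] by blast+
  show "S \<omega> \<in> cadlag T" by (rule S_cadlag[OF c(1)])
  show "\<forall>\<^sub>F n in sequentially. S (\<omega>s n) \<in> cadlag T" using c(2) by eventually_elim (rule S_cadlag)
  fix e :: real assume e: "e > 0"
  \<comment> \<open>The bound \<open>e / 3\<close> is for the mismatch of the inputs. The bound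
    \<open>e / (3 * K)\<close> is for the displacement, which the Lipschitz constant
    \<open>K\<close> turns into the second \<open>e / 3\<close>; the third comes from
    \<open>S_minus_input_limit\<close>.\<close>
  obtain e' where e': "0 < e'" "e' \<le> min (e / 3) (e / (3 * K))" "T * (exp e' - 1) < min (e / 3) (e / (3 * K))"
    using small_displacement[of "min (e / 3) (e / (3 * K))" T] e K by auto
  have "eventually (\<lambda>n. skorokhod_close T e' (snd (\<omega>s n)) (snd \<omega>)) sequentially"
    using lims(2)[unfolded limitin_skorokhod[OF T]] e'(1) by blast
  moreover have "eventually (\<lambda>n. \<forall>t\<in>{0..T}. norm ((S (\<omega>s n) t - snd (\<omega>s n) t) - (S \<omega> t - snd \<omega> t)) \<le> e / 3) sequentially"
    using e by (intro S_minus_input_limit[OF lim]) simp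
  ultimately show "\<forall>\<^sub>F n in sequentially. skorokhod_close T e (S (\<omega>s n)) (S \<omega>)"
  proof eventually_elim
    case (elim n)
    obtain \<tau> where \<tau>: "\<tau> \<in> time_changes T" "time_change_norm T \<tau> \<le> ennreal e'"
      "\<And>t. t \<in> {0..T} \<Longrightarrow> norm (snd (\<omega>s n) t - snd \<omega> (\<tau> t)) \<le> e'" "\<And>t. t \<in> {0..T} \<Longrightarrow> \<bar>\<tau> t - t\<bar> \<le> T * (exp e' - 1)"
      using skorokhod_close_displacement[OF T elim(1)] e'(1) by (metis less_imp_le)
    show ?case unfolding skorokhod_close_def
    proof (intro bexI[OF _ \<tau>(1)] conjI ballI)
      show "time_change_norm T \<tau> \<le> ennreal e" using e'(2) e by (intro order_trans[OF \<tau>(2)] ennreal_leI) auto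
      fix t assume t: "t \<in> {0..T}"
      have "K * \<bar>\<tau> t - t\<bar> \<le> K * (e / (3 * K))" using \<tau>(4)[OF t] e'(3) K by (intro mult_left_mono) auto
      also have "\<dots> = e / 3" using K by simp
      finally have "norm ((S \<omega> t - snd \<omega> t) - (S \<omega> (\<tau> t) - snd \<omega> (\<tau> t))) \<le> e / 3"
        using S_minus_input_lipschitz[OF c(1) time_changes_in[OF \<tau>(1) t] t] by (simp add: abs_minus_commute)
      moreover have "norm ((S (\<omega>s n) t - snd (\<omega>s n) t) - (S \<omega> t - snd \<omega> t)) \<le> e / 3" using elim(2) t by blast
      moreover have "norm (snd (\<omega>s n) t - snd \<omega> (\<tau> t)) \<le> e / 3" using \<tau>(3)[OF t] e'(2) by simp
      moreover have "S (\<omega>s n) t - S \<omega> (\<tau> t) = ((S (\<omega>s n) t - snd (\<omega>s n) t) - (S \<omega> t - snd \<omega> t))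
        + ((S \<omega> t - snd \<omega> t) - (S \<omega> (\<tau> t) - snd \<omega> (\<tau> t))) + (snd (\<omega>s n) t - snd \<omega> (\<tau> t))" by simp
      ultimately have "norm (S (\<omega>s n) t - S \<omega> (\<tau> t)) \<le> e / 3 + e / 3 + e / 3"
        by (simp only:) (intro norm_triangle_mono)
      then show "norm (S (\<omega>s n) t - S \<omega> (\<tau> t)) \<le> e" by simp
    qed
  qed
qed

text \<open>The difference between solution and input converges at every time; continuity of the
  limiting input at \<open>t\<close> makes the input values converge too.\<close>

lemma S_limit_at_continuity_point:
  assumes lim: "limitin (input_topology T) \<omega>s \<omega> sequentially" and t: "t \<in> {0..T}" "isCont (snd \<omega>) t"
  shows "(\<lambda>n. S (\<omega>s n) t) \<longlonglongrightarrow> S \<omega> t"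
proof -
  note lims = limitin_input_topologyD[OF lim]
  have "(\<lambda>n. (S (\<omega>s n) t - snd (\<omega>s n) t) - (S \<omega> t - snd \<omega> t)) \<longlonglongrightarrow> 0"
  proof (rule LIMSEQ_I)
    fix r :: real assume "0 < r"
    then have "eventually (\<lambda>n. \<forall>t\<in>{0..T}. norm ((S (\<omega>s n) t - snd (\<omega>s n) t) - (S \<omega> t - snd \<omega> t)) \<le> r / 2) sequentially"
      by (intro S_minus_input_limit[OF lim]) simp
    then have "eventually (\<lambda>n. norm ((S (\<omega>s n) t - snd (\<omega>s n) t) - (S \<omega> t - snd \<omega> t) - 0) < r) sequentially"
      by eventually_elim (use t(1) \<open>0 < r\<close> in force)
    then show "\<exists>N. \<forall>n\<ge>N. norm ((S (\<omega>s n) t - snd (\<omega>s n) t) - (S \<omega> t - snd \<omega> t) - 0) < r"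
      by (simp add: eventually_sequentially)
  qed
  moreover have "(\<lambda>n. snd (\<omega>s n) t) \<longlonglongrightarrow> snd \<omega> t"
    by (rule skorokhod_limit_at_continuity_point[OF T lims(2) t])
  ultimately have "(\<lambda>n. ((S (\<omega>s n) t - snd (\<omega>s n) t) - (S \<omega> t - snd \<omega> t)) + snd (\<omega>s n) t + (S \<omega> t - snd \<omega> t)) \<longlonglongrightarrow>
    0 + snd \<omega> t + (S \<omega> t - snd \<omega> t)"
    by (intro tendsto_intros)
  then show ?thesis by simp
qed

end

section \<open>Dependence on the input law\<close>

lemma skorokhod_dist_le_sup:
  fixes f g :: "real \<Rightarrow> 'a::real_normed_vector"
  assumes "f \<in> cadlag T" "g \<in> cadlag T" "\<And>t. t \<in> {0..T} \<Longrightarrow> ennreal (norm (f t - g t)) \<le> e"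
  shows "ennreal (skorokhod_dist T f g) \<le> e"
proof -
  have "ennreal (skorokhod_dist T f g) = skorokhod_edist T f g"
    unfolding skorokhod_dist_def using skorokhod_edist_finite[OF assms(1,2)] by (rule ennreal_enn2real)
  also have "\<dots> \<le> time_change_norm T id + sup_dist T f (g \<circ> id)" by (rule INF_lower[OF id_time_changes])
  also have "\<dots> \<le> e" unfolding time_change_norm_id sup_dist_def using assms(3) by (auto intro: SUP_least)
  finally show ?thesis .
qed

text \<open>Both maps are run on the same space \<open>\<nu>'\<close>, so the coupling bound applies
  and a bound uniform in the input passes unchanged through the expectation. On the right only the
  fixed map \<open>S\<close> occurs, under two measures; this is a quantity that weak convergence
  controls.\<close>

lemma (in mckean_vlasov_drift) solution_stability:
  fixes \<rho>\<^sub>D :: "(real \<Rightarrow> 'a) measure metric"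
  assumes sol: "mckean_vlasov_solution T K \<rho>\<^sub>R b \<nu> S" and sol': "mckean_vlasov_solution T K \<rho>\<^sub>R b \<nu>' S'"
    and admD: "admissible_metric (skorokhod_metric T) \<rho>\<^sub>D"
  shows "ennreal (mdist \<rho>\<^sub>D (distr \<nu>' (borel_of (skorokhod_topology T)) S') (distr \<nu>' (borel_of (skorokhod_topology T)) S)) \<le>
    ennreal gronwall_const * (ennreal (2 * exp (2 * (K * gronwall_const) * T)) *
      (\<integral>\<^sup>+s\<in>{0..T}. ennreal (min (2 * K) (K * mdist \<rho>\<^sub>R (distr \<nu>' borel (\<lambda>\<omega>. S \<omega> s)) (distr \<nu> borel (\<lambda>\<omega>. S \<omega> s)))) \<partial>lborel))"
proof -
  interpret X: mckean_vlasov_solution T K \<rho>\<^sub>R b \<nu> S by (rule sol)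
  interpret X': mckean_vlasov_solution T K \<rho>\<^sub>R b \<nu>' S' by (rule sol')
  note T0 = less_imp_le[OF T]
  note nu = prob_measuresD[OF X.\<nu>] and nu' = prob_measuresD[OF X'.\<nu>]
  interpret prob_space \<nu>' by (rule nu'(1))
  let ?q = "\<lambda>s. distr \<nu>' borel (\<lambda>\<omega>. S \<omega> s)"
  let ?cl = "\<lambda>s. max 0 (min T s)"
  \<comment> \<open>Each drift is at most \<open>K\<close>, so their difference is at most
    \<open>2 * K\<close> whatever the distance of the laws. The cap keeps \<open>G\<close> bounded,
    as \<open>gronwall_nn\<close> requires.\<close>
  define D where "D s = min (2 * K) (K * mdist \<rho>\<^sub>R (X'.law (?cl s)) (X.law (?cl s)))" for s
  define H where "H s = min (2 * K) (K * mdist \<rho>\<^sub>R (?q (?cl s)) (X.law (?cl s)))" for s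
  define G where "G t = (\<integral>\<^sup>+s\<in>{0..t}. ennreal (D s) \<partial>lborel)" for t
  have law: "X.law s \<in> mspace \<rho>\<^sub>R" "X'.law s \<in> mspace \<rho>\<^sub>R" "?q s \<in> mspace \<rho>\<^sub>R" if "s \<in> {0..T}" for s
    using X.law_prob[OF X.\<nu> that] X'.law_prob[OF X'.\<nu> that] X.law_prob[OF X'.\<nu> that]
    by (simp_all add: admissible_metricD(1)[OF adm] X.law_def X'.law_def)
  have "(\<lambda>s. mdist \<rho>\<^sub>R (X'.law (?cl s)) (X.law (?cl s))) \<in> borel_measurable borel"
    unfolding X.law_def X'.law_def
    by (rule right_continuous_measurable[OF T0], rule mdist_laws_right_continuous[OF adm nu'(1) nu(1)])
      (blast intro: X.S_eval_measurable'[OF X.\<nu>] X'.S_eval_measurable'[OF X'.\<nu>]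
        X.S_right_continuous[OF X.\<nu>] X'.S_right_continuous[OF X'.\<nu>])+
  then have Dm [measurable]: "D \<in> borel_measurable borel" unfolding D_def by measurable
  have "(\<lambda>s. mdist \<rho>\<^sub>R (?q (?cl s)) (X.law (?cl s))) \<in> borel_measurable borel"
    unfolding X.law_def X'.law_def
    by (rule right_continuous_measurable[OF T0], rule mdist_laws_right_continuous[OF adm nu'(1) nu(1)])
      (blast intro: X.S_eval_measurable'[OF X.\<nu>] X.S_eval_measurable'[OF X'.\<nu>]
        X.S_right_continuous[OF X.\<nu>] X.S_right_continuous[OF X'.\<nu>])+
  then have Hm [measurable]: "H \<in> borel_measurable borel" unfolding H_def by measurable
  have D0: "0 \<le> D s" "D s \<le> 2 * K" and H0: "0 \<le> H s" for s unfolding D_def H_def using K by auto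
  have sp: "snd \<omega> \<in> cadlag T" if "\<omega> \<in> space \<nu>'" for \<omega>
    using that unfolding nu'(3) topspace_input_topology[OF T] by (simp add: mem_Times_iff)
  have paths: "ennreal (norm (S' \<omega> t - S \<omega> t)) \<le> ennreal gronwall_const * G t" if \<omega>: "\<omega> \<in> space \<nu>'" and t: "t \<in> {0..T}" for \<omega> t
  proof -
    have "ennreal (norm ((S' \<omega> t - snd \<omega> t) - (S \<omega> t - snd \<omega> t))) \<le>
        ennreal gronwall_const * (ennreal (norm (fst \<omega> - fst \<omega>)) + (\<integral>\<^sup>+s\<in>{0..t}. ennreal (K * norm (snd \<omega> s - snd \<omega> s) + D s) \<partial>lborel))"
      unfolding gronwall_const_def
    proof (rule solution_compare[where d = "X'.drift \<omega>" and d' = "X.drift \<omega>"])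
      fix s assume s: "s \<in> {0..T}"
      then have cl: "?cl s = s" by auto
      have P: "X'.law s \<in> prob_measures euclidean" "X.law s \<in> prob_measures euclidean"
        using law[OF s] by (simp_all add: admissible_metricD(1)[OF adm])
      have "norm (X'.drift \<omega> s - X.drift \<omega> s) \<le> norm (X'.drift \<omega> s) + norm (X.drift \<omega> s)" by (rule norm_triangle_ineq4)
      then have 1: "norm (X'.drift \<omega> s - X.drift \<omega> s) \<le> 2 * K"
        using X.drift_bound[OF s, of \<omega>] X'.drift_bound[OF s, of \<omega>] by linarith
      have 2: "norm (X'.drift \<omega> s - X.drift \<omega> s) \<le> K * norm (S' \<omega> s - S \<omega> s) + K * mdist \<rho>\<^sub>R (X'.law s) (X.law s)"
        using lip[OF P] unfolding X.drift_def X'.drift_def by (simp add: distrib_left)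
      have "0 \<le> K * norm (S' \<omega> s - S \<omega> s)" using K by simp
      then show "norm (X'.drift \<omega> s - X.drift \<omega> s) \<le> K * norm (S' \<omega> s - S \<omega> s) + D s"
        unfolding D_def cl using 1 2 by (auto simp: min_def)
    qed (use K sp[OF \<omega>] t D0 Dm in \<open>auto intro: X.S_cadlag X'.S_cadlag X.drift_integrable X'.drift_integrable X.S_eq X'.S_eq\<close>)
    then show ?thesis by (simp add: G_def)
  qed
  \<comment> \<open>The triangle inequality passes through \<open>?q s\<close>. From
    \<open>X'.law s\<close> to \<open>?q s\<close> one measure carries two maps, so the coupling
    bound and \<open>paths\<close> give \<open>gronwall_const * G s\<close>; from
    \<open>?q s\<close> to \<open>X.law s\<close> the distance is the datum in
    \<open>H\<close>.\<close>
  have D_le: "ennreal (D s) \<le> ennreal (H s) + ennreal (K * gronwall_const) * G s" if s: "s \<in> {0..T}" for s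
  proof -
    have cl: "?cl s = s" using s by auto
    let ?p = "mdist \<rho>\<^sub>R (X'.law s) (?q s)" and ?r = "mdist \<rho>\<^sub>R (?q s) (X.law s)"
    have "ennreal ?p \<le> (\<integral>\<^sup>+\<omega>. ennreal (dist (S' \<omega> s) (S \<omega> s)) \<partial>\<nu>')"
      using admissible_metric_le[OF adm nu'(1), of "\<lambda>\<omega>. S' \<omega> s" "\<lambda>\<omega>. S \<omega> s"]
        X.S_eval_measurable'[OF X'.\<nu> s] X'.S_eval_measurable'[OF X'.\<nu> s] by (simp add: X'.law_def)
    also have "\<dots> \<le> (\<integral>\<^sup>+\<omega>. ennreal gronwall_const * G s \<partial>\<nu>')"
      using paths[OF _ s] by (intro nn_integral_mono) (simp add: dist_norm)
    also have "\<dots> = ennreal gronwall_const * G s" by (simp add: emeasure_space_1)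
    finally have p: "ennreal ?p \<le> ennreal gronwall_const * G s" .
    have "mdist \<rho>\<^sub>R (X'.law s) (X.law s) \<le> ?p + ?r" using law[OF s] by (intro mdist_triangle)
    then have "K * mdist \<rho>\<^sub>R (X'.law s) (X.law s) \<le> K * ?p + K * ?r"
      using K by (metis distrib_left less_imp_le mult_left_mono)
    moreover have "0 \<le> K * ?p" using K by simp
    \<comment> \<open>For nonnegative \<open>a\<close>,
      \<open>min c (a + b) \<le> a + min c b\<close>.\<close>
    ultimately have "D s \<le> H s + K * ?p" unfolding D_def H_def cl by (auto simp: min_def)
    then have "ennreal (D s) \<le> ennreal (H s) + ennreal K * ennreal ?p"
      using H0 K by (subst ennreal_mult[symmetric]) (auto simp flip: ennreal_plus intro!: ennreal_leI)
    also have "\<dots> \<le> ennreal (H s) + ennreal K * (ennreal gronwall_const * G s)"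
      by (intro add_left_mono mult_left_mono p) simp
    also have "\<dots> = ennreal (H s) + ennreal (K * gronwall_const) * G s"
      using K gronwall_const_pos by (simp add: ennreal_mult mult.assoc)
    finally show ?thesis .
  qed
  have Gm [measurable]: "G \<in> borel_measurable borel"
  proof -
    \<comment> \<open>The indicator of the moving interval becomes a condition jointly measurable in
      \<open>s\<close> and \<open>t\<close>, so \<open>G\<close> is an integral depending measurably
      on a parameter.\<close>
    have "G = (\<lambda>t. \<integral>\<^sup>+s. ennreal (D s) * (if 0 \<le> s \<and> s \<le> t then 1 else 0) \<partial>lborel)"
      unfolding G_def by (intro ext nn_integral_cong) (auto split: split_indicator)
    then show ?thesis by (simp only:) measurable
  qed
  let ?h = "\<integral>\<^sup>+s\<in>{0..T}. ennreal (H s) \<partial>lborel"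
  \<comment> \<open>The rate is the Lipschitz constant of \<open>b\<close> in the measure times the
    constant of the pathwise bound, whence the iterated exponential in the result.\<close>
  have GT: "G t \<le> ennreal (2 * exp (2 * (K * gronwall_const) * T)) * ?h" if "t \<in> {0..T}" for t
  proof (rule gronwall_nn[where B = "2 * K * T", OF _ T0 _ _ that])
    show "0 < K * gronwall_const" using K gronwall_const_pos by simp
    fix t assume t: "t \<in> {0..T}"
    have "G t \<le> (\<integral>\<^sup>+s\<in>{0..T}. ennreal (2 * K) \<partial>lborel)"
      unfolding G_def using t D0(2) by (intro nn_integral_mono) (auto split: split_indicator intro!: ennreal_leI)
    also have "\<dots> = ennreal (2 * K * T)" using K T by (simp add: nn_integral_cmult ennreal_mult)
    finally show "G t \<le> ennreal (2 * K * T)" .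
    have "G t \<le> (\<integral>\<^sup>+s. ennreal (H s) * indicator {0..t} s + ennreal (K * gronwall_const) * (G s * indicator {0..t} s) \<partial>lborel)"
      unfolding G_def[of t] using t D_le by (intro nn_integral_mono) (auto split: split_indicator)
    also have "\<dots> = (\<integral>\<^sup>+s\<in>{0..t}. ennreal (H s) \<partial>lborel) + ennreal (K * gronwall_const) * (\<integral>\<^sup>+s\<in>{0..t}. G s \<partial>lborel)"
      by (subst nn_integral_add) (simp_all add: nn_integral_cmult)
    also have "\<dots> \<le> ?h + ennreal (K * gronwall_const) * (\<integral>\<^sup>+s\<in>{0..t}. G s \<partial>lborel)"
      using t by (intro add_right_mono nn_integral_mono) (auto split: split_indicator)
    finally show "G t \<le> ?h + ennreal (K * gronwall_const) * (\<integral>\<^sup>+s\<in>{0..t}. G s \<partial>lborel)" .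
  qed
  let ?c = "ennreal gronwall_const * (ennreal (2 * exp (2 * (K * gronwall_const) * T)) * ?h)"
  have "ennreal (mdist \<rho>\<^sub>D (distr \<nu>' (borel_of (skorokhod_topology T)) S') (distr \<nu>' (borel_of (skorokhod_topology T)) S))
      \<le> (\<integral>\<^sup>+\<omega>. ennreal (skorokhod_dist T (S' \<omega>) (S \<omega>)) \<partial>\<nu>')"
    using admissible_metric_le[OF admD nu'(1) X'.S_measurable'[OF X'.\<nu>] X.S_measurable'[OF X'.\<nu>]] T by simp
  also have "\<dots> \<le> (\<integral>\<^sup>+\<omega>. ?c \<partial>\<nu>')"
  proof (rule nn_integral_mono, rule skorokhod_dist_le_sup)
    fix \<omega> t assume \<omega>: "\<omega> \<in> space \<nu>'" and t: "t \<in> {0..T}"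
    show "ennreal (norm (S' \<omega> t - S \<omega> t)) \<le> ?c"
      by (rule order_trans[OF paths[OF \<omega> t]]) (intro mult_left_mono GT t; simp)
  qed (auto intro: X.S_cadlag X'.S_cadlag sp)
  also have "\<dots> = ?c" by (simp add: emeasure_space_1)
  also have "?h = (\<integral>\<^sup>+s\<in>{0..T}. ennreal (min (2 * K) (K * mdist \<rho>\<^sub>R (?q s) (distr \<nu> borel (\<lambda>\<omega>. S \<omega> s)))) \<partial>lborel)"
    unfolding H_def X.law_def by (intro nn_integral_cong) (auto split: split_indicator)
  finally show ?thesis .
qed

section \<open>Weak limits under a fixed solution map, and continuity in the law\<close>

lemma (in mckean_vlasov_solution) law_limit:
  fixes E :: "('a \<times> (real \<Rightarrow> 'a)) metric"
  assumes lim: "limitin (weak_topology (input_topology T)) \<nu>s \<nu> sequentially"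
    and E: "mtopology_of E = input_topology T"
    and \<nu>s: "\<And>n. \<nu>s n \<in> prob_measures (input_topology T)"
    and s: "s \<in> {0..T}" and cont: "AE \<omega> in \<nu>. isCont (snd \<omega>) s"
  shows "(\<lambda>n. mdist \<rho>\<^sub>R (distr (\<nu>s n) borel (\<lambda>\<omega>. S \<omega> s)) (distr \<nu> borel (\<lambda>\<omega>. S \<omega> s))) \<longlonglongrightarrow> 0"
proof -
  have "limitin (weak_topology euclidean) (\<lambda>n. distr (\<nu>s n) borel (\<lambda>\<omega>. S \<omega> s)) (distr \<nu> borel (\<lambda>\<omega>. S \<omega> s)) sequentially"
    unfolding limitin_weak_topology
  proof (intro conjI allI impI always_eventually)
    fix f :: "'a \<Rightarrow> real" assume f: "continuous_map euclidean euclidean f" "bounded (f ` topspace euclidean)"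
    then have c: "continuous_on UNIV f" by simp
    then have fm: "f \<in> borel_measurable borel" by (rule borel_measurable_continuous_onI)
    obtain B where B: "\<And>x. \<bar>f x\<bar> \<le> B" using f(2) by (auto simp: bounded_iff)
    have "(\<lambda>n. \<integral>\<omega>. f (S \<omega> s) \<partial>\<nu>s n) \<longlonglongrightarrow> (\<integral>\<omega>. f (S \<omega> s) \<partial>\<nu>)"
    \<comment> \<open>The Lipschitz envelopes need a metric on the inputs; \<open>E\<close> is one
      that induces the product topology. The functional \<open>f (S \<omega> s)\<close> is
      continuous at every input whose path is continuous at \<open>s\<close>.\<close>
    proof (rule weak_limit_AE_continuous[where m = E and B = B])
      show "limitin (weak_topology (mtopology_of E)) \<nu>s \<nu> sequentially" using lim E by simp
      show "(\<lambda>\<omega>. f (S \<omega> s)) \<in> borel_measurable (borel_of (mtopology_of E))"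
        unfolding E by (rule measurable_compose[OF S_eval_measurable[OF s] fm])
      show "AE \<omega> in \<nu>. \<forall>\<sigma>. limitin (mtopology_of E) \<sigma> \<omega> sequentially \<longrightarrow> (\<lambda>n. f (S (\<sigma> n) s)) \<longlonglongrightarrow> f (S \<omega> s)"
        using cont
      proof eventually_elim
        case (elim \<omega>)
        then show ?case unfolding E
          by (intro allI impI continuous_on_tendsto_compose[OF c] S_limit_at_continuity_point s) auto
      qed
    qed (rule B)
    then show "(\<lambda>n. \<integral>x. f x \<partial>distr (\<nu>s n) borel (\<lambda>\<omega>. S \<omega> s)) \<longlonglongrightarrow> (\<integral>x. f x \<partial>distr \<nu> borel (\<lambda>\<omega>. S \<omega> s))"
      using S_eval_measurable'[OF \<nu>s s] S_eval_measurable'[OF \<nu> s] fm by (simp add: integral_distr)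
  qed (intro law_prob \<nu> \<nu>s s)+
  then show ?thesis
    unfolding admissible_metricD(2)[OF adm, symmetric, simplified] limitin_mtopology_of by simp
qed

text \<open>As a map into path space \<open>S\<close> is continuous everywhere, unlike its
  evaluations, so bounded continuous test functions pull back to bounded continuous ones.\<close>

lemma (in mckean_vlasov_solution) distr_S_limit:
  fixes E :: "('a \<times> (real \<Rightarrow> 'a)) metric"
  assumes lim: "limitin (weak_topology (input_topology T)) \<nu>s \<nu> sequentially"
    and E: "mtopology_of E = input_topology T"
    and \<nu>s: "\<And>n. \<nu>s n \<in> prob_measures (input_topology T)"
  shows "limitin (weak_topology (skorokhod_topology T)) (\<lambda>n. distr (\<nu>s n) (borel_of (skorokhod_topology T)) S)
    (distr \<nu> (borel_of (skorokhod_topology T)) S) sequentially"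
  unfolding limitin_weak_topology
proof (intro conjI allI impI always_eventually)
  have Sc: "continuous_map (input_topology T) (skorokhod_topology T) S"
    unfolding E[symmetric]
  proof (rule continuous_map_sequentiallyI)
    have "mspace E = topspace (input_topology T)" by (metis E topspace_mtopology_of)
    then show "S \<in> mspace E \<rightarrow> topspace (skorokhod_topology T)"
      using measurable_space[OF S_measurable] by auto
  qed (simp add: E S_limit)
  fix f :: "(real \<Rightarrow> 'a) \<Rightarrow> real"
  assume f: "continuous_map (skorokhod_topology T) euclidean f" "bounded (f ` topspace (skorokhod_topology T))"
  have "continuous_map (input_topology T) euclidean (\<lambda>\<omega>. f (S \<omega>))"
    using continuous_map_compose[OF Sc f(1)] by (simp add: comp_def)
  moreover have "bounded ((\<lambda>\<omega>. f (S \<omega>)) ` topspace (input_topology T))"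
    using continuous_map_funspace[OF Sc] by (intro bounded_subset[OF f(2)]) auto
  ultimately have "(\<lambda>n. \<integral>\<omega>. f (S \<omega>) \<partial>\<nu>s n) \<longlonglongrightarrow> (\<integral>\<omega>. f (S \<omega>) \<partial>\<nu>)"
    using lim unfolding limitin_weak_topology by blast
  moreover have fm: "f \<in> borel_measurable (borel_of (skorokhod_topology T))"
    using continuous_map_borel_of_measurable[OF f(1)] by simp
  ultimately show "(\<lambda>n. \<integral>x. f x \<partial>distr (\<nu>s n) (borel_of (skorokhod_topology T)) S)
      \<longlonglongrightarrow> (\<integral>x. f x \<partial>distr \<nu> (borel_of (skorokhod_topology T)) S)"
    by (simp add: integral_distr[OF S_measurable'[OF \<nu>s] fm] integral_distr[OF S_measurable'[OF \<nu>] fm])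
qed (intro prob_measures_distr prob_measuresD(1)[OF \<nu>] prob_measuresD(1)[OF \<nu>s] S_measurable' \<nu> \<nu>s)+

text \<open>The intermediate law is that of \<open>S \<nu>\<close> under \<open>\<nu>s n\<close>:
  \<open>d1\<close> changes the map at a fixed measure by \<open>solution_stability\<close>, and
  \<open>d2\<close> changes the measure at a fixed map by \<open>distr_S_limit\<close>.\<close>

lemma (in mckean_vlasov_drift) continuous_solution_law:
  fixes E :: "('a \<times> (real \<Rightarrow> 'a)) metric" and \<rho>\<^sub>D :: "(real \<Rightarrow> 'a) measure metric"
  assumes E: "mtopology_of E = input_topology T"
    and admD: "admissible_metric (skorokhod_metric T) \<rho>\<^sub>D" and admE: "admissible_metric E \<rho>\<^sub>E"
    and S: "\<And>\<nu>. \<nu> \<in> prob_measures (input_topology T) \<Longrightarrow> is_solution_map b T \<nu> (S \<nu>)"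
  shows "continuous_map (mtopology_of \<rho>\<^sub>E) (mtopology_of \<rho>\<^sub>D) (\<lambda>\<nu>. distr \<nu> (borel_of (skorokhod_topology T)) (S \<nu>))"
proof (rule continuous_map_sequentiallyI)
  let ?B = "borel_of (skorokhod_topology T) :: (real \<Rightarrow> 'a) measure"
  have sol: "mckean_vlasov_solution T K \<rho>\<^sub>R b \<nu> (S \<nu>)" if "\<nu> \<in> prob_measures (input_topology T)" for \<nu>
    using that S[OF that] by unfold_locales
  have mE: "mspace \<rho>\<^sub>E = prob_measures (input_topology T)" using admissible_metricD(1)[OF admE] E by simp
  have mD: "mspace \<rho>\<^sub>D = prob_measures (skorokhod_topology T)" using admissible_metricD(1)[OF admD] .
  have distr_in: "distr \<nu>' ?B (S \<nu>) \<in> mspace \<rho>\<^sub>D"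
    if "\<nu> \<in> prob_measures (input_topology T)" "\<nu>' \<in> prob_measures (input_topology T)" for \<nu> \<nu>'
    unfolding mD using mckean_vlasov_solution.S_measurable'[OF sol[OF that(1)] that(2)] prob_measuresD(1)[OF that(2)]
    by (intro prob_measures_distr)
  show "(\<lambda>\<nu>. distr \<nu> ?B (S \<nu>)) \<in> mspace \<rho>\<^sub>E \<rightarrow> topspace (mtopology_of \<rho>\<^sub>D)"
    using distr_in by (simp add: mE)
  fix \<nu>s \<nu> assume ran: "range \<nu>s \<subseteq> mspace \<rho>\<^sub>E" and lim': "limitin (mtopology_of \<rho>\<^sub>E) \<nu>s \<nu> sequentially"
  have lim: "limitin (weak_topology (input_topology T)) \<nu>s \<nu> sequentially"
    using lim' by (simp add: admissible_metricD(2)[OF admE] E)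
  have \<nu>: "\<nu> \<in> prob_measures (input_topology T)" using lim by (simp add: limitin_weak_topology)
  have \<nu>s: "\<nu>s n \<in> prob_measures (input_topology T)" for n using ran mE by auto
  interpret X: mckean_vlasov_solution T K \<rho>\<^sub>R b \<nu> "S \<nu>" by (rule sol[OF \<nu>])
  note T0 = less_imp_le[OF T]
  define h where "h n s = min (2 * K) (K * mdist \<rho>\<^sub>R (distr (\<nu>s n) borel (\<lambda>\<omega>. S \<nu> \<omega> s)) (distr \<nu> borel (\<lambda>\<omega>. S \<nu> \<omega> s)))" for n s
  have "(\<lambda>n. \<integral>\<^sup>+s. ennreal (h n s) * indicator {0..T} s \<partial>lborel) \<longlonglongrightarrow> (\<integral>\<^sup>+s. 0 \<partial>(lborel :: real measure))"
  proof (rule nn_integral_dominated_convergence[where w = "\<lambda>s. ennreal (2 * K) * indicator {0..T} s"])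
    fix n
    have "(\<lambda>s. mdist \<rho>\<^sub>R (distr (\<nu>s n) borel (\<lambda>\<omega>. S \<nu> \<omega> (max 0 (min T s)))) (distr \<nu> borel (\<lambda>\<omega>. S \<nu> \<omega> (max 0 (min T s))))) \<in> borel_measurable borel"
      by (rule right_continuous_measurable[OF T0], rule mdist_laws_right_continuous[OF adm prob_measuresD(1)[OF \<nu>s] prob_measuresD(1)[OF \<nu>]])
        (blast intro: X.S_eval_measurable'[OF \<nu>s] X.S_eval_measurable'[OF \<nu>] X.S_right_continuous[OF \<nu>s] X.S_right_continuous[OF \<nu>])+
    then have "(\<lambda>s. h n (max 0 (min T s))) \<in> borel_measurable borel" unfolding h_def by measurable
    then have m: "(\<lambda>s. ennreal (h n (max 0 (min T s))) * indicator {0..T} s) \<in> borel_measurable lborel"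
      by (intro borel_measurable_times_ennreal measurable_compose[OF _ measurable_ennreal]) auto
    have "(\<lambda>s. ennreal (h n (max 0 (min T s))) * indicator {0..T} s) = (\<lambda>s. ennreal (h n s) * indicator {0..T} s)"
      by (auto simp: fun_eq_iff split: split_indicator)
    with m show "(\<lambda>s. ennreal (h n s) * indicator {0..T} s) \<in> borel_measurable lborel" by simp
    show "AE s in lborel. ennreal (h n s) * indicator {0..T} s \<le> ennreal (2 * K) * indicator {0..T} s"
      by (intro AE_I2 mult_right_mono ennreal_leI) (auto simp: h_def)
  next
    show "AE s in lborel. (\<lambda>n. ennreal (h n s) * indicator {0..T} s) \<longlonglongrightarrow> 0"
      \<comment> \<open>Times at which the input jumps with positive probability under the limit law
        are left out; they form a null set, which the time integral ignores.\<close>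
      using AE_input_isCont[OF T \<nu>]
    proof eventually_elim
      case (elim s)
      show ?case
      proof (cases "s \<in> {0..T}")
        case True
        then have "(\<lambda>n. mdist \<rho>\<^sub>R (distr (\<nu>s n) borel (\<lambda>\<omega>. S \<nu> \<omega> s)) (distr \<nu> borel (\<lambda>\<omega>. S \<nu> \<omega> s))) \<longlonglongrightarrow> 0"
          using elim by (intro X.law_limit[OF lim E \<nu>s]) auto
        then have "(\<lambda>n. h n s) \<longlonglongrightarrow> min (2 * K) (K * 0)"
          unfolding h_def by (intro tendsto_intros)
        then have "(\<lambda>n. ennreal (h n s)) \<longlonglongrightarrow> ennreal 0" using K by (intro tendsto_ennrealI) simp
        then show ?thesis using True by simp
      qed simp
    qed
  qed (use T in \<open>auto simp: ennreal_mult_less_top nn_integral_cmult\<close>)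
  then have bound_lim: "(\<lambda>n. ennreal gronwall_const * (ennreal (2 * exp (2 * (K * gronwall_const) * T)) * (\<integral>\<^sup>+s\<in>{0..T}. ennreal (h n s) \<partial>lborel)))
      \<longlonglongrightarrow> ennreal gronwall_const * (ennreal (2 * exp (2 * (K * gronwall_const) * T)) * 0)"
    by (intro ennreal_tendsto_cmult) auto
  have "(\<lambda>n. ennreal (mdist \<rho>\<^sub>D (distr (\<nu>s n) ?B (S (\<nu>s n))) (distr (\<nu>s n) ?B (S \<nu>)))) \<longlonglongrightarrow> ennreal 0"
  proof (rule tendsto_sandwich[OF _ _ tendsto_const])
    show "(\<lambda>n. ennreal gronwall_const * (ennreal (2 * exp (2 * (K * gronwall_const) * T)) * (\<integral>\<^sup>+s\<in>{0..T}. ennreal (h n s) \<partial>lborel))) \<longlonglongrightarrow> ennreal 0"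
      using bound_lim by simp
    show "\<forall>\<^sub>F n in sequentially. ennreal (mdist \<rho>\<^sub>D (distr (\<nu>s n) ?B (S (\<nu>s n))) (distr (\<nu>s n) ?B (S \<nu>))) \<le>
      ennreal gronwall_const * (ennreal (2 * exp (2 * (K * gronwall_const) * T)) * (\<integral>\<^sup>+s\<in>{0..T}. ennreal (h n s) \<partial>lborel))"
      unfolding h_def by (intro always_eventually allI solution_stability sol \<nu> \<nu>s admD)
  qed simp
  then have d1: "(\<lambda>n. mdist \<rho>\<^sub>D (distr (\<nu>s n) ?B (S (\<nu>s n))) (distr (\<nu>s n) ?B (S \<nu>))) \<longlonglongrightarrow> 0"
    by (subst (asm) tendsto_ennreal_iff) auto
  have d2: "(\<lambda>n. mdist \<rho>\<^sub>D (distr (\<nu>s n) ?B (S \<nu>)) (distr \<nu> ?B (S \<nu>))) \<longlonglongrightarrow> 0"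
    using X.distr_S_limit[OF lim E \<nu>s]
    unfolding admissible_metricD(2)[OF admD, symmetric] limitin_mtopology_of by simp
  have "(\<lambda>n. mdist \<rho>\<^sub>D (distr (\<nu>s n) ?B (S (\<nu>s n))) (distr \<nu> ?B (S \<nu>))) \<longlonglongrightarrow> 0"
  proof (rule tendsto_sandwich[OF _ _ tendsto_const])
    show "(\<lambda>n. mdist \<rho>\<^sub>D (distr (\<nu>s n) ?B (S (\<nu>s n))) (distr (\<nu>s n) ?B (S \<nu>)) +
        mdist \<rho>\<^sub>D (distr (\<nu>s n) ?B (S \<nu>)) (distr \<nu> ?B (S \<nu>))) \<longlonglongrightarrow> 0"
      using tendsto_add[OF d1 d2] by simp
    show "\<forall>\<^sub>F n in sequentially. mdist \<rho>\<^sub>D (distr (\<nu>s n) ?B (S (\<nu>s n))) (distr \<nu> ?B (S \<nu>)) \<le>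
      mdist \<rho>\<^sub>D (distr (\<nu>s n) ?B (S (\<nu>s n))) (distr (\<nu>s n) ?B (S \<nu>)) + mdist \<rho>\<^sub>D (distr (\<nu>s n) ?B (S \<nu>)) (distr \<nu> ?B (S \<nu>))"
      by (intro always_eventually allI mdist_triangle distr_in \<nu> \<nu>s)
  qed simp
  then show "limitin (mtopology_of \<rho>\<^sub>D) (\<lambda>n. distr (\<nu>s n) ?B (S (\<nu>s n))) (distr \<nu> ?B (S \<nu>)) sequentially"
    unfolding limitin_mtopology_of using distr_in \<nu> \<nu>s by simp
qed

theorem lemma20:
  fixes T K :: real
    and E :: "((real ^ 'd) \<times> (real \<Rightarrow> real ^ 'd)) metric"
    and \<rho>\<^sub>R :: "(real ^ 'd) measure metric"
    and \<rho>\<^sub>D :: "(real \<Rightarrow> real ^ 'd) measure metric"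
    and \<rho>\<^sub>E :: "((real ^ 'd) \<times> (real \<Rightarrow> real ^ 'd)) measure metric"
    and b :: "(real ^ 'd) \<times> (real ^ 'd) measure \<Rightarrow> real ^ 'd"
    and S :: "((real ^ 'd) \<times> (real \<Rightarrow> real ^ 'd)) measure
                \<Rightarrow> (real ^ 'd) \<times> (real \<Rightarrow> real ^ 'd) \<Rightarrow> (real \<Rightarrow> real ^ 'd)"
  assumes "0 < T"
    and "mtopology_of E = input_topology T"
    and "admissible_metric euclidean_metric \<rho>\<^sub>R"
    and "admissible_metric (skorokhod_metric T) \<rho>\<^sub>D"
    and "admissible_metric E \<rho>\<^sub>E"
    and "b \<in> borel_measurable (borel_of (prod_topology euclidean (mtopology_of \<rho>\<^sub>R)))"
    and "\<And>x x' \<mu> \<mu>'. \<mu> \<in> prob_measures euclidean \<Longrightarrow> \<mu>' \<in> prob_measures euclidean \<Longrightarrow>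
           norm (b (x, \<mu>) - b (x', \<mu>')) \<le> K * (norm (x - x') + mdist \<rho>\<^sub>R \<mu> \<mu>')"
    and "\<And>x \<mu>. \<mu> \<in> prob_measures euclidean \<Longrightarrow> norm (b (x, \<mu>)) \<le> K"
    and "\<And>\<nu>. \<nu> \<in> prob_measures (input_topology T) \<Longrightarrow> is_solution_map b T \<nu> (S \<nu>)"
  shows "let \<Psi> = (\<lambda>\<nu>. distr \<nu> (borel_of (skorokhod_topology T)) (S \<nu>)) in
      continuous_map (mtopology_of \<rho>\<^sub>E) (mtopology_of \<rho>\<^sub>D) \<Psi>
      \<and> continuous_map (weak_topology (input_topology T)) (weak_topology (skorokhod_topology T)) \<Psi>"
proof -
  \<comment> \<open>Any probability measure would do to read off \<open>0 \<le> K\<close> from the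
    bound on \<open>b\<close>; the point mass at 0 is one.\<close>
  have "return borel (0 :: real ^ 'd) \<in> prob_measures euclidean"
    by (simp add: prob_measures_iff prob_space_return)
  from assms(8)[OF this, of 0] have K: "0 \<le> K" using norm_ge_zero order_trans by blast
  \<comment> \<open>The arguments divide by the constant, and the hypotheses allow it to be 0;
    enlarging it to \<open>K + 1\<close> preserves both bounds on \<open>b\<close>.\<close>
  interpret mckean_vlasov_drift T "K + 1" \<rho>\<^sub>R b
  proof
    fix x x' :: "real ^ 'd" and \<mu> \<mu>' :: "(real ^ 'd) measure"
    assume P: "\<mu> \<in> prob_measures euclidean" "\<mu>' \<in> prob_measures euclidean"
    have "K * (norm (x - x') + mdist \<rho>\<^sub>R \<mu> \<mu>') \<le> (K + 1) * (norm (x - x') + mdist \<rho>\<^sub>R \<mu> \<mu>')"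
      by (intro mult_right_mono) auto
    then show "norm (b (x, \<mu>) - b (x', \<mu>')) \<le> (K + 1) * (norm (x - x') + mdist \<rho>\<^sub>R \<mu> \<mu>')"
      using assms(7)[OF P, of x x'] by linarith
  next
    fix x :: "real ^ 'd" and \<mu> :: "(real ^ 'd) measure"
    assume "\<mu> \<in> prob_measures euclidean"
    from assms(8)[OF this, of x] show "norm (b (x, \<mu>)) \<le> K + 1" by linarith
  qed (use assms(1,3) K in auto)
  have "continuous_map (mtopology_of \<rho>\<^sub>E) (mtopology_of \<rho>\<^sub>D) (\<lambda>\<nu>. distr \<nu> (borel_of (skorokhod_topology T)) (S \<nu>))"
    by (rule continuous_solution_law[OF assms(2,4,5,9)])
  then show ?thesis
    \<comment> \<open>The two admissible metrics induce the two weak topologies, so both conjuncts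
      become the same statement.\<close>
    unfolding Let_def admissible_metricD(2)[OF assms(4)] admissible_metricD(2)[OF assms(5)] assms(2) by blast
qed

end
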